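(* A sequence $\{\lambda_k\}$ of complex numbers is the spectrum of the boundary value problem $R(1,q)$ for some real-valued potential $q\in L_2(0,1)$ if and only if the infinite product in $$\Theta(\lambda)=\lambda^s\prod_{\lambda_k\ne 0}\Big(1-\frac{\lambda}{\lambda_k}\Big)$$ (where $s\ge 0$ is the number of indices $k$ with $\lambda_k=0$) is convergent for each complex $\lambda$ and the corresponding function $\Theta(\lambda)$ has the form $$\Theta(\lambda)=\int_0^2 u(x)\frac{\sin\rho x}{\rho}\,dx,\qquad \rho^2=\lambda,$$ for some function $u\in W_{2,\mathbb R}^1[0,2]$ with $u(2)=0$.
   Context: $W_{2,\mathbb R}^1[0,2]$ is the space of real-valued absolutely continuous functions on $[0,2]$ whose derivative lies in $L_2(0,2)$. For $q\in L_2(0,1)$, $R(1,q)$ denotes the boundary value problem $$-y''+q(x)y=\lambda y,\quad 0<x<1,\qquad y(0)=0,\qquad y(1)\cos\rho-y'(1)\frac{\sin\rho}{\rho}=0,$$ where $\lambda=\rho^2$ is the spectral parameter (expressions such as $\rho^{-1}\sin\rho x$ are understood by continuity at $\rho=0$). Let $S(x,\lambda)$ be the solution of $-y''+q(x)y=\lambda y$ with $S(0,\lambda)=0$, $S'(0,\lambda)=1$. The characteristic function of $R(1,q)$ is the entire function of $\lambda$ $$\Delta(\lambda)=S(1,\lambda)\cos\rho-S'(1,\lambda)\frac{\sin\rho}{\rho},\qquad\rho^2=\lambda,$$ and the spectrum of $R(1,q)$ is the collection of zeros of $\Delta$ counted with multiplicity. (If $\Delta\equiv0$, the spectrum is all of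 $\mathbb C$ and is not a sequence.)
   Formalization: The infinite product is required to converge for each complex λ under every ordering of the indices k, not only in the given order; with convergence in the given order alone the "if" part fails, and only sequences for which it fails are excluded. *)

theory Defs
  imports "HOL-Complex_Analysis.Complex_Analysis"
begin

definition L2_on :: "real \<Rightarrow> real \<Rightarrow> (real \<Rightarrow> real) \<Rightarrow> bool" where
  "L2_on a b f \<longleftrightarrow>
     set_borel_measurable lebesgue {a<..<b} f \<and>
     set_integrable lebesgue {a<..<b} (\<lambda>x. (f x)\<^sup>2)"

(* A pair (s, t) in D stands for the interval between s and t; the intervals of D do not overlap. *)
definition abs_cont_on :: "real \<Rightarrow> real \<Rightarrow> (real \<Rightarrow> 'a::real_normed_vector) \<Rightarrow> bool" where
  "abs_cont_on a b f \<longleftrightarrow>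
     (\<forall>\<epsilon>>0. \<exists>\<delta>>0. \<forall>D :: (real \<times> real) set.
        finite D \<and> (\<forall>(s, t)\<in>D. a \<le> s \<and> s \<le> t \<and> t \<le> b) \<and>
        disjoint_family_on (\<lambda>(s, t). {s<..<t}) D \<and> (\<Sum>(s, t)\<in>D. t - s) < \<delta>
        \<longrightarrow> (\<Sum>(s, t)\<in>D. norm (f t - f s)) < \<epsilon>)"

definition W12_on :: "real \<Rightarrow> real \<Rightarrow> (real \<Rightarrow> real) \<Rightarrow> bool" where
  "W12_on a b u \<longleftrightarrow>
     abs_cont_on a b u \<and>
     (\<exists>v. L2_on a b v \<and>
        (AE x in lebesgue. x \<in> {a<..<b} \<longrightarrow> (u has_real_derivative v x) (at x)))"

(* As q is only square integrable, -y'' + q y = z y is understood in the Caratheodory sense: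
   y' is absolutely continuous on [0,1] and the equation holds almost everywhere. *)
definition SL_solution :: "(real \<Rightarrow> real) \<Rightarrow> complex \<Rightarrow> (real \<Rightarrow> complex) \<Rightarrow> bool" where
  "SL_solution q z y \<longleftrightarrow>
     (\<exists>y'. (\<forall>x\<in>{0..1}. (y has_vector_derivative y' x) (at x within {0..1})) \<and>
        abs_cont_on 0 1 y' \<and>
        (AE x in lebesgue. x \<in> {0<..<1} \<longrightarrow>
           (\<exists>y''. (y' has_vector_derivative y'') (at x) \<and>
                  - y'' + complex_of_real (q x) * y x = z * y x)))"

abbreviation deriv01 :: "(real \<Rightarrow> complex) \<Rightarrow> real \<Rightarrow> complex" where
  "deriv01 y x \<equiv> vector_derivative y (at x within {0..1})"

(* Unique on [0,1] for q in L2(0,1); the values outside [0,1] are irrelevant. *)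
definition S_sol :: "(real \<Rightarrow> real) \<Rightarrow> complex \<Rightarrow> real \<Rightarrow> complex" where
  "S_sol q z = (SOME y. SL_solution q z y \<and> y 0 = 0 \<and> deriv01 y 0 = 1)"

(* sin (r x) / r, extended to r = 0 by continuity *)
definition sin_quot :: "complex \<Rightarrow> real \<Rightarrow> complex" where
  "sin_quot r x = (if r = 0 then complex_of_real x else sin (r * complex_of_real x) / r)"

(* Both cos r and sin r / r are even in r, so the choice of the square root r of z is immaterial. *)
definition char_fun :: "(real \<Rightarrow> real) \<Rightarrow> complex \<Rightarrow> complex" where
  "char_fun q z =
     S_sol q z 1 * cos (csqrt z) - deriv01 (S_sol q z) 1 * sin_quot (csqrt z) 1"

(* The sequence lists the zeros of the characteristic function with multiplicity; zorder is 0
   where the function does not vanish. If the function vanishes identically, then the spectrum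
   is the whole plane and no sequence lists it. *)
definition is_spectrum :: "(real \<Rightarrow> real) \<Rightarrow> (nat \<Rightarrow> complex) \<Rightarrow> bool" where
  "is_spectrum q lam \<longleftrightarrow>
     (\<exists>z. char_fun q z \<noteq> 0) \<and>
     (\<forall>z. finite {k. lam k = z} \<and> int (card {k. lam k = z}) = zorder (char_fun q) z)"

definition Theta_factor :: "(nat \<Rightarrow> complex) \<Rightarrow> complex \<Rightarrow> nat \<Rightarrow> complex" where
  "Theta_factor lam z k = (if lam k = 0 then 1 else 1 - z / lam k)"

(* A spectrum is an unordered collection (with multiplicities), and the product runs over the
   unordered index set {k. lam k \<noteq> 0}; so it is required to converge however the
   indices are enumerated. Convergence at every z for one particular enumeration would be a
   property of that enumeration, and a pointwise limit would not even determine the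
   multiplicities of the lam k. *)
definition Theta_convergent :: "(nat \<Rightarrow> complex) \<Rightarrow> complex \<Rightarrow> bool" where
  "Theta_convergent lam z \<longleftrightarrow>
     (\<forall>p :: nat \<Rightarrow> nat. bij p \<longrightarrow> convergent_prod (\<lambda>k. Theta_factor lam z (p k)))"

definition Theta :: "(nat \<Rightarrow> complex) \<Rightarrow> complex \<Rightarrow> complex" where
  "Theta lam z = z ^ card {k. lam k = 0} * prodinf (Theta_factor lam z)"

end

theory Submission
  imports Defs "HOL-Real_Asymp.Real_Asymp"
begin

text \<open>
  Write \<open>z = r\<^sup>2\<close>. The functions \<open>sin_quot r\<close> and \<open>cos_quot r x = (1 - cos (r x)) / r\<^sup>2\<close>, the antiderivative
  of \<open>sin_quot r\<close>, carry all formulas; the point of dividing is that they are entire in \<open>z\<close>.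

  Every characteristic function is a sine transform. The Wronskian of \<open>S\<close> and \<open>sin_quot r\<close> has
  derivative \<open>- q S sin_quot r\<close>, vanishes at 0 and equals the characteristic function at 1. The
  transformation operator expresses \<open>S\<close> by \<open>sin_quot r\<close> through a kernel \<open>a\<close> that does not depend on
  \<open>r\<close> and solves a Goursat problem with the potential as coefficient (\<open>goursat_solution_exists\<close>). As
  products of sines are differences of cosines, an exchange of integrals gives
  \<open>char_fun q (r\<^sup>2) = - \<integral> \<phi>(\<xi>) cos_quot r (2\<xi>) d\<xi>\<close>, where \<open>\<phi>\<close> is \<open>q / 2\<close> plus a bounded function
  (\<open>char_fun_eq\<close>). So \<open>\<phi>\<close> is square integrable, and one integration by parts turns the cosines into
  the sine transform of a \<open>u\<close> with \<open>u' = \<phi>(x / 2) / 2\<close> and \<open>u(2) = 0\<close> (\<open>char_fun_sine_transform\<close>).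

  Conversely, the nonlinear map \<open>q \<mapsto> \<phi>\<close> has to be inverted for given \<open>u\<close>. It need not be inverted
  globally: the zeros do not notice a constant factor, so \<open>u\<close> may be replaced by a small multiple of
  itself. The difference between \<open>\<phi>\<close> and \<open>q / 2\<close> is quadratic in \<open>q\<close>, so for small data the pair of
  the kernel and the correction \<open>q - 2 \<phi>\<close> is the fixed point of a contraction. This produces a
  potential whose characteristic function is a positive multiple of the prescribed sine transform
  (\<open>sine_transform_realizable\<close>).

  It remains to pass between an entire function and its zeros. A sine transform is entire in \<open>z\<close> and
  bounded by \<open>C exp (2 sqrt \<bar>z\<bar>)\<close>, hence of order at most one half, and Hadamard's factorization has
  no exponential factor: the function is a constant times \<open>Theta\<close> (\<open>hadamard_product\<close>). The constant
  is real because the function is real on the positive half-axis, so dividing \<open>u\<close> by it keeps \<open>u\<close>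
  real. In the other direction, a product that converges in every order converges absolutely, since
  the same holds for series; hence the reciprocals of the \<open>lam k\<close> are absolutely summable, and
  \<open>Theta\<close> vanishes at the \<open>lam k\<close> with exactly the right multiplicities (\<open>Theta_zeros\<close>).
\<close>

section \<open>Absolutely continuous functions\<close>

text \<open>
  The gauge separates the tags. At points of differentiability the increments of \<open>f\<close> over a fine
  interval are close to \<open>g\<close> times its length; the intervals tagged in the exceptional null set lie in
  an open set of small measure, where absolute continuity bounds the sum of the increments.
\<close>
lemma abs_cont_on_FTC:
  fixes f :: "real \<Rightarrow> 'a::banach"
  assumes ac: "abs_cont_on a b f" and ab: "a \<le> b" and N: "negligible N"
    and der: "\<And>x. x \<in> {a<..<b} - N \<Longrightarrow> (f has_vector_derivative g x) (at x)"
  shows "(g has_integral (f b - f a)) {a..b}"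
proof -
  define N' where "N' = N \<union> {a, b}"
  have N': "negligible N'"
    using N by (simp add: N'_def)
  define h where "h = (\<lambda>x. if x \<in> N' then 0 else g x)"
  have "(h has_integral (f b - f a)) {a..b}"
    unfolding has_integral_real
  proof (intro allI impI)
    fix e :: real
    assume e: "e > 0"
    define e1 where "e1 = e / (2 * (b - a + 1))"
    have e1: "e1 > 0"
      using e ab by (simp add: e1_def)
    obtain \<delta> where \<delta>: "\<delta> > 0" and ac\<delta>: "\<And>D. finite D \<Longrightarrow> (\<forall>(s, t)\<in>D. a \<le> s \<and> s \<le> t \<and> t \<le> b) \<Longrightarrow>
        disjoint_family_on (\<lambda>(s, t). {s<..<t}) D \<Longrightarrow> (\<Sum>(s, t)\<in>D. t - s) < \<delta>
        \<Longrightarrow> (\<Sum>(s, t)\<in>D. norm (f t - f s)) < e / 2"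
      using ac[unfolded abs_cont_on_def, rule_format, of "e / 2"] e by auto
    have "N' \<in> sets lebesgue"
      using N' by (simp add: negligible_imp_sets)
    then obtain U where U: "open U" "N' \<subseteq> U" "U - N' \<in> lmeasurable" "emeasure lebesgue (U - N') < ennreal \<delta>"
      using sets_lebesgue_outer_open[of N' \<delta>] \<delta> by metis
    have "U = (U - N') \<union> N'"
      using U by auto
    then have Um: "U \<in> lmeasurable"
      using U(3) N' by (metis fmeasurable.Un negligible_imp_measurable)
    have "measure lebesgue U = measure lebesgue (U - N')"
      using measure_Diff_null_set[of U lebesgue N'] N' Um by (simp add: negligible_iff_null_sets fmeasurableD)
    then have mU: "measure lebesgue U < \<delta>"
      using U(3,4) \<delta> by (simp add: emeasure_eq_measure2 ennreal_less_iff)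
    (* The two kinds of tags get their own gauge radii. *)
    have "\<exists>d>0. (x \<in> N' \<longrightarrow> ball x d \<subseteq> U) \<and>
       (x \<in> {a..b} - N' \<longrightarrow> (\<forall>y. \<bar>y - x\<bar> < d \<longrightarrow> norm (f y - f x - (y - x) *\<^sub>R g x) \<le> e1 * \<bar>y - x\<bar>))" for x
    proof (cases "x \<in> N'")
      case True
      then show ?thesis
        using U(1,2) by (meson DiffD2 open_contains_ball subsetD)
    next
      case False
      show ?thesis
      proof (cases "x \<in> {a..b}")
        case True
        then have "x \<in> {a<..<b} - N"
          using False by (auto simp: N'_def)
        then have "(f has_derivative (\<lambda>y. y *\<^sub>R g x)) (at x)"
          using der by (auto simp: has_vector_derivative_def)
        then obtain d where "d > 0" "\<forall>y. norm (y - x) < d \<longrightarrow> norm (f y - f x - (y - x) *\<^sub>R g x) \<le> e1 * norm (y - x)"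
          using e1 unfolding has_derivative_at_alt by blast
        then show ?thesis
          using False by auto
      qed (use False zero_less_one in blast)
    qed
    then obtain d where d: "\<And>x. d x > 0" "\<And>x. x \<in> N' \<Longrightarrow> ball x (d x) \<subseteq> U"
      "\<And>x y. x \<in> {a..b} - N' \<Longrightarrow> \<bar>y - x\<bar> < d x \<Longrightarrow> norm (f y - f x - (y - x) *\<^sub>R g x) \<le> e1 * \<bar>y - x\<bar>"
      by metis
    show "\<exists>\<gamma>. gauge \<gamma> \<and> (\<forall>\<D>. \<D> tagged_division_of {a..b} \<and> \<gamma> fine \<D> \<longrightarrow>
        norm ((\<Sum>(x, k)\<in>\<D>. measure lborel k *\<^sub>R h x) - (f b - f a)) < e)"
    proof (intro exI conjI allI impI; (elim conjE)?)
      show "gauge (\<lambda>x. ball x (d x))"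
        using d(1) by (intro gauge_ball_dependent) auto
      fix p
      assume p: "p tagged_division_of {a..b}" and fine: "(\<lambda>x. ball x (d x)) fine p"
      have fp: "finite p"
        using p by blast
      have K: "\<exists>u v. u \<le> v \<and> a \<le> u \<and> v \<le> b \<and> K = {u..v} \<and> Inf K = u \<and> Sup K = v \<and> measure lborel K = v - u \<and> u \<le> x \<and> x \<le> v"
        if xKp: "(x, K) \<in> p" for x K
      proof -
        obtain u v where uv: "K = cbox u v"
          using tagged_division_ofD(4)[OF p xKp] by blast
        have "x \<in> K" "K \<subseteq> {a..b}"
          using p that by (auto dest: tagged_division_ofD)
        then show ?thesis
          using uv by (intro exI[of _ u] exI[of _ v]) auto
      qed
      define P where "P = {xK \<in> p. fst xK \<in> N'}"
      (* Degenerate intervals are left out, so that the end points determine the tagged interval. *)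
      define B where "B = {xK \<in> p. fst xK \<in> N' \<and> measure lborel (snd xK) > 0}"
      define i where "i = (\<lambda>xK :: real \<times> real set. (Inf (snd xK), Sup (snd xK)))"
      define \<Phi> where "\<Phi> = (\<lambda>xK. norm (measure lborel (snd xK) *\<^sub>R h (fst xK) - (f (Sup (snd xK)) - f (Inf (snd xK)))))"
      have fB: "finite B" "finite P" "finite (p - P)" "B \<subseteq> P"
        using fp by (auto simp: B_def P_def)
      have B: "\<exists>x u v. xK = (x, {u..v}) \<and> x \<in> N' \<and> u < v \<and> a \<le> u \<and> v \<le> b \<and> i xK = (u, v) \<and> (x, {u..v}) \<in> p \<and> u \<le> x \<and> x \<le> v"
        if "xK \<in> B" for xK
      proof -
        obtain x K' where xK: "xK = (x, K')" by (cases xK)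
        have "(x, K') \<in> p"
          using that xK by (auto simp: B_def)
        from K[OF this] show ?thesis
          using that xK by (auto simp: B_def i_def)
      qed
      have disj: "{u..v} \<noteq> {u'..v'} \<and> {u<..<v} \<inter> {u'<..<v'} = {}"
        if "(x, {u..v}) \<in> p" "(x', {u'..v'}) \<in> p" "u < v" "(x, {u..v}) \<noteq> (x', {u'..v'})" for x u v x' u' v'
      proof -
        have "interior {u..v} \<inter> interior {u'..v'} = {}"
          using tagged_division_ofD(5)[OF p that(1,2,4)] .
        then have *: "{u<..<v} \<inter> {u'<..<v'} = {}"
          by (simp add: interior_atLeastAtMost_real)
        moreover have "(u + v) / 2 \<in> {u<..<v}"
          using that by auto
        ultimately show ?thesis
          using that(3) by (metis Icc_eq_Icc Int_absorb empty_iff less_eq_real_def)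
      qed
      have inj: "inj_on i B"
      proof (rule inj_onI)
        fix y z assume yz: "y \<in> B" "z \<in> B" "i y = i z"
        obtain x u v where 1: "y = (x, {u..v})" "u < v" "i y = (u, v)" "(x, {u..v}) \<in> p"
          using B[OF yz(1)] by blast
        obtain x' u' v' where 2: "z = (x', {u'..v'})" "u' < v'" "i z = (u', v')" "(x', {u'..v'}) \<in> p"
          using B[OF yz(2)] by blast
        show "y = z"
          using disj[OF 1(4) 2(4) 1(2)] 1 2 yz(3) by auto
      qed
      have D2: "\<forall>(s, t)\<in>i ` B. a \<le> s \<and> s \<le> t \<and> t \<le> b"
        using B by fastforce
      have D3: "disjoint_family_on (\<lambda>(s, t). {s<..<t}) (i ` B)"
        unfolding disjoint_family_on_def
      proof (intro ballI impI)
        fix m n assume mn: "m \<in> i ` B" "n \<in> i ` B" "m \<noteq> n"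
        then obtain y z where yz: "y \<in> B" "z \<in> B" "m = i y" "n = i z" by auto
        obtain x u v where 1: "y = (x, {u..v})" "u < v" "i y = (u, v)" "(x, {u..v}) \<in> p"
          using B[OF yz(1)] by blast
        obtain x' u' v' where 2: "z = (x', {u'..v'})" "u' < v'" "i z = (u', v')" "(x', {u'..v'}) \<in> p"
          using B[OF yz(2)] by blast
        show "(case m of (s, t) \<Rightarrow> {s<..<t}) \<inter> (case n of (s, t) \<Rightarrow> {s<..<t}) = {}"
          using disj[OF 1(4) 2(4) 1(2)] 1 2 yz mn(3) by auto
      qed
      have fiB: "finite (i ` B)" using fB by auto
      have "(\<Sum>(s, t)\<in>i ` B. t - s) = (\<Sum>st\<in>i ` B. measure lebesgue (case st of (s, t) \<Rightarrow> {s<..<t}))"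
        using D2 by (intro sum.cong) (auto split: prod.splits)
      also have "\<dots> = measure lebesgue (\<Union>st\<in>i ` B. case st of (s, t) \<Rightarrow> {s<..<t})"
        by (intro measure_finite_Union[symmetric] fiB D3) (use D2 in \<open>auto split: prod.splits\<close>)
      also have "\<dots> \<le> measure lebesgue U"
      proof (intro measure_mono_fmeasurable Um UN_least sets.finite_UN fiB)
        fix st assume "st \<in> i ` B"
        then obtain y where y: "y \<in> B" "st = i y" by auto
        obtain x u v where 1: "y = (x, {u..v})" "x \<in> N'" "u < v" "i y = (u, v)" "(x, {u..v}) \<in> p"
          using B[OF y(1)] by blast
        have "{u..v} \<subseteq> ball x (d x)"
          using fine 1(5) by (auto simp: fine_def)
        then have "{u..v} \<subseteq> U"
          using d(2)[OF 1(2)] by auto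
        then show "(case st of (s, t) \<Rightarrow> {s<..<t}) \<subseteq> U"
          using 1 y by auto
      qed (auto split: prod.splits)
      finally have "(\<Sum>(s, t)\<in>i ` B. t - s) < \<delta>"
        using mU by linarith
      then have "(\<Sum>(s, t)\<in>i ` B. norm (f t - f s)) < e / 2"
        using ac\<delta> fiB D2 D3 by blast
      also have "(\<Sum>(s, t)\<in>i ` B. norm (f t - f s)) = sum \<Phi> B"
        by (subst sum.reindex[OF inj]) (auto intro!: sum.cong simp: i_def \<Phi>_def B_def h_def norm_minus_commute)
      also have "\<dots> = sum \<Phi> P"
      proof (rule sum.mono_neutral_left)
        show "\<forall>y\<in>P - B. \<Phi> y = 0"
        proof
          fix y assume y: "y \<in> P - B"
          obtain x K' where xK: "y = (x, K')" by (cases y)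
          have "(x, K') \<in> p"
            using y xK by (auto simp: P_def)
          from K[OF this] obtain u v where "u \<le> v" "K' = {u..v}" "Inf K' = u" "Sup K' = v" "measure lborel K' = v - u"
            by blast
          moreover from this have "u = v"
            using y xK by (auto simp: B_def P_def)
          ultimately show "\<Phi> y = 0"
            by (simp add: \<Phi>_def xK)
        qed
      qed (use fB in auto)
      finally have bad: "sum \<Phi> P < e / 2" .
      have "sum \<Phi> (p - P) \<le> (\<Sum>(x,K)\<in>p - P. e1 * measure lborel K)"
      proof (rule sum_mono)
        fix y assume y: "y \<in> p - P"
        obtain x K' where xK: "y = (x, K')" by (cases y)
        have xp: "(x, K') \<in> p"
          using y xK by (auto simp: P_def)
        from K[OF this] obtain u v where uv: "u \<le> v" "a \<le> u" "v \<le> b" "K' = {u..v}" "Inf K' = u" "Sup K' = v" "measure lborel K' = v - u" "u \<le> x" "x \<le> v"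
          by blast
        have x: "x \<in> {a..b} - N'"
          using uv y xK by (auto simp: P_def)
        have "{u..v} \<subseteq> ball x (d x)"
          using fine xp uv by (auto simp: fine_def)
        then have "u \<in> ball x (d x)" "v \<in> ball x (d x)"
          using uv by (auto simp del: mem_ball)
        then have "norm (f u - f x - (u - x) *\<^sub>R g x) \<le> e1 * \<bar>u - x\<bar>" "norm (f v - f x - (v - x) *\<^sub>R g x) \<le> e1 * \<bar>v - x\<bar>"
          using d(3)[OF x] by (auto simp: dist_real_def abs_minus_commute)
        then have "norm ((f u - f x - (u - x) *\<^sub>R g x) - (f v - f x - (v - x) *\<^sub>R g x)) \<le> e1 * \<bar>u - x\<bar> + e1 * \<bar>v - x\<bar>"
          by (smt (verit) norm_triangle_ineq4)
        also have "\<dots> = e1 * (v - u)"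
          using uv by (simp add: algebra_simps)
        also have "(f u - f x - (u - x) *\<^sub>R g x) - (f v - f x - (v - x) *\<^sub>R g x) = (v - u) *\<^sub>R g x - (f v - f u)"
          by (simp add: algebra_simps)
        finally show "\<Phi> y \<le> (case y of (x, K) \<Rightarrow> e1 * measure lborel K)"
          using uv x by (simp add: xK \<Phi>_def h_def)
      qed
      also have "\<dots> \<le> (\<Sum>(x,K)\<in>p. e1 * measure lborel K)"
        using fp e1 by (intro sum_mono2) auto
      also have "\<dots> = e1 * (b - a)"
        using additive_content_tagged_division[of p a b] p ab
        by (simp add: sum_distrib_left[symmetric] case_prod_unfold)
      also have "\<dots> \<le> e / 2"
        using e ab by (simp add: e1_def divide_simps mult_left_mono algebra_simps)
      finally have good: "sum \<Phi> (p - P) \<le> e / 2" .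
      have "(\<Sum>(x, k)\<in>p. measure lborel k *\<^sub>R h x) - (f b - f a) =
          (\<Sum>y\<in>p. measure lborel (snd y) *\<^sub>R h (fst y) - (f (Sup (snd y)) - f (Inf (snd y))))"
        using additive_tagged_division_1[OF ab p, of f] by (simp add: sum_subtractf case_prod_unfold)
      also have "norm \<dots> \<le> sum \<Phi> p"
        unfolding \<Phi>_def by (rule norm_sum)
      also have "\<dots> = sum \<Phi> (p - P) + sum \<Phi> P"
        using fp by (intro sum.subset_diff) (auto simp: P_def)
      also have "\<dots> < e"
        using good bad by linarith
      finally show "norm ((\<Sum>(x, k)\<in>p. measure lborel k *\<^sub>R h x) - (f b - f a)) < e" .
    qed
  qed
  then show ?thesis
    by (rule has_integral_spike[OF N', rotated]) (auto simp: h_def)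
qed

text \<open>
  The Lebesgue differentiation theorem, by the Henstock lemma and a Vitali covering. Where the
  difference quotients stay at distance more than \<open>\<eta>\<close> from \<open>g x\<close>, arbitrarily short witnesses violate
  the estimate of the Henstock lemma, so disjoint ones have small total length; the five times
  enlarged balls still cover the exceptional set.
\<close>
lemma has_vector_derivative_indefinite_integral_ae:
  fixes g :: "real \<Rightarrow> 'a::euclidean_space"
  assumes g: "g integrable_on {a..b}"
  shows "\<exists>N. negligible N \<and> (\<forall>x\<in>{a<..<b} - N. ((\<lambda>x. integral {a..x} g) has_vector_derivative g x) (at x))"
proof -
  define F where "F = (\<lambda>x. integral {a..x} g)"
  define E where "E = (\<lambda>\<eta>::real. {x\<in>{a<..<b}. \<forall>\<delta>>0. \<exists>y\<in>{a<..<b}. \<bar>y - x\<bar> < \<delta> \<and> norm (F y - F x - (y - x) *\<^sub>R g x) > \<eta> * \<bar>y - x\<bar>})"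
  have neg: "negligible (E \<eta>)" if \<eta>: "\<eta> > 0" for \<eta>
    unfolding negligible_outer_le
  proof (intro allI impI)
    fix e :: real assume e: "e > 0"
    (* 10 = 2 * 5: a ball has twice its radius as length, and the radii are enlarged five times. *)
    define e' where "e' = e * \<eta> / 10"
    have e': "e' > 0" using e \<eta> by (simp add: e'_def)
    obtain \<gamma> where \<gamma>: "gauge \<gamma>" and hen: "\<And>p. \<lbrakk>p tagged_partial_division_of (cbox a b); \<gamma> fine p\<rbrakk> \<Longrightarrow>
             sum (\<lambda>(x,k). norm(measure lborel k *\<^sub>R g x - integral k g)) p < e'"
      using Henstock_lemma[of g a b e'] g e' by (auto simp: box_real)
    have "\<exists>y. x \<in> E \<eta> \<longrightarrow> y \<in> {a<..<b} \<and> \<bar>y - x\<bar> < 1 \<and> y \<noteq> x \<and> ball x \<bar>y - x\<bar> \<subseteq> \<gamma> x \<and> {min x y..max x y} \<subseteq> \<gamma> x \<and> norm (F y - F x - (y - x) *\<^sub>R g x) > \<eta> * \<bar>y - x\<bar>" for x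
    proof (cases "x \<in> E \<eta>")
      case True
      obtain d where d: "d > 0" "ball x d \<subseteq> \<gamma> x"
        using \<gamma> by (metis gauge_def open_contains_ball_eq)
      have "min d 1 > 0" using d by auto
      then obtain y where y: "y\<in>{a<..<b}" "\<bar>y - x\<bar> < min d 1" "norm (F y - F x - (y - x) *\<^sub>R g x) > \<eta> * \<bar>y - x\<bar>"
        using True unfolding E_def by blast
      have "{min x y..max x y} \<subseteq> ball x d" "ball x \<bar>y - x\<bar> \<subseteq> ball x d"
        using y(2) by (auto simp: dist_real_def)
      then show ?thesis
        using y d by (intro exI[of _ y]) auto
    qed auto
    then obtain Y where Y: "\<And>x. x \<in> E \<eta> \<Longrightarrow> Y x \<in> {a<..<b}" "\<And>x. x \<in> E \<eta> \<Longrightarrow> \<bar>Y x - x\<bar> < 1" "\<And>x. x \<in> E \<eta> \<Longrightarrow> Y x \<noteq> x"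
       "\<And>x. x \<in> E \<eta> \<Longrightarrow> {min x (Y x)..max x (Y x)} \<subseteq> \<gamma> x" "\<And>x. x \<in> E \<eta> \<Longrightarrow> norm (F (Y x) - F x - (Y x - x) *\<^sub>R g x) > \<eta> * \<bar>Y x - x\<bar>"
      by metis
    define r where "r = (\<lambda>x. \<bar>Y x - x\<bar>)"
    have r: "0 < r x \<and> r x \<le> 1" if "x \<in> E \<eta>" for x
      using Y(2,3)[OF that] by (auto simp: r_def)
    have cov: "E \<eta> \<subseteq> (\<Union>x\<in>E \<eta>. ball x (r x))"
      using r by force
    obtain C where C: "countable C" "C \<subseteq> E \<eta>" "pairwise (\<lambda>i j. disjnt (ball i (r i)) (ball j (r j))) C"
      "E \<eta> \<subseteq> (\<Union>i\<in>C. ball i (5 * r i))"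
      by (rule Vitali_covering_lemma_balls[OF cov, where B=1]) (use r that in blast)+
    have fin: "measure lebesgue (\<Union>i\<in>C'. ball i (5 * r i)) \<le> e" if C': "C' \<subseteq> C" "finite C'" for C'
    proof -
      define p where "p = (\<lambda>x. (x, {min x (Y x)..max x (Y x)})) ` C'"
      have inE: "x \<in> E \<eta>" "x \<in> {a<..<b}" if "x \<in> C'" for x
        using that C' C(2) by (auto simp: E_def)
      have tp: "p tagged_partial_division_of (cbox a b)"
        unfolding tagged_partial_division_of_def
      proof (intro conjI allI impI)
        show "finite p" using C' by (simp add: p_def)
        fix x K assume xK: "(x, K) \<in> p"
        then have x: "x \<in> C'" "K = {min x (Y x)..max x (Y x)}" by (auto simp: p_def)
        show "x \<in> K" using x by auto
        show "K \<subseteq> cbox a b" using x inE[OF x(1)] Y(1)[OF inE(1)[OF x(1)]] by auto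
        show "\<exists>u v. K = cbox u v" using x by auto
      next
        fix x K x' K' assume xK: "(x, K) \<in> p \<and> (x', K') \<in> p \<and> (x, K) \<noteq> (x', K')"
        then have x: "x \<in> C'" "K = {min x (Y x)..max x (Y x)}" and x': "x' \<in> C'" "K' = {min x' (Y x')..max x' (Y x')}"
          by (auto simp: p_def)
        have "x \<noteq> x'" using xK x x' by auto
        then have "disjnt (ball x (r x)) (ball x' (r x'))"
          using C(3) C'(1) x(1) x'(1) by (meson pairwiseD subsetD)
        moreover have "interior K \<subseteq> ball x (r x)" "interior K' \<subseteq> ball x' (r x')"
          using x x' by (auto simp: interior_atLeastAtMost_real r_def dist_real_def)
        ultimately show "interior K \<inter> interior K' = {}"
          by (auto simp: disjnt_def)
      qed
      have "\<gamma> fine p"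
        unfolding fine_def p_def using Y(4) inE by auto
      from hen[OF tp this] have S: "sum (\<lambda>(x,k). norm(measure lborel k *\<^sub>R g x - integral k g)) p < e'" .
      have inj: "inj_on (\<lambda>x. (x, {min x (Y x)..max x (Y x)})) C'"
        by (auto simp: inj_on_def)
      have eq: "norm (measure lborel {min x (Y x)..max x (Y x)} *\<^sub>R g x - integral {min x (Y x)..max x (Y x)} g) = norm (F (Y x) - F x - (Y x - x) *\<^sub>R g x)"
        if "x \<in> C'" for x
      proof -
        have i: "F v - F u = integral {u..v} g" if "a \<le> u" "u \<le> v" "v \<le> b" for u v
        proof -
          have "integral {a..u} g + integral {u..v} g = integral {a..v} g"
            using that g by (intro Henstock_Kurzweil_Integration.integral_combine) (auto intro: integrable_subinterval_real)
          then show ?thesis by (simp add: F_def algebra_simps)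
        qed
        have *: "a < x" "x < b" "a < Y x" "Y x < b"
          using inE[OF that] Y(1)[OF inE(1)[OF that]] by auto
        show ?thesis
        proof (cases "x \<le> Y x")
          case True
          then show ?thesis using i[of x "Y x"] * by (simp add: norm_minus_commute)
        next
          case False
          then show ?thesis using i[of "Y x" x] * by (simp add: norm_minus_commute algebra_simps)
        qed
      qed
      have "\<eta> * (\<Sum>x\<in>C'. r x) \<le> (\<Sum>x\<in>C'. norm (F (Y x) - F x - (Y x - x) *\<^sub>R g x))"
        unfolding sum_distrib_left r_def using Y(5) inE by (intro sum_mono less_imp_le) auto
      also have "\<dots> = sum (\<lambda>(x,k). norm(measure lborel k *\<^sub>R g x - integral k g)) p"
        unfolding p_def by (subst sum.reindex[OF inj]) (auto intro!: sum.cong simp: eq simp del: content_real_if measure_lborel_Icc)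
      also have "\<dots> < e'" by (rule S)
      finally have sr: "(\<Sum>x\<in>C'. r x) < e / 10"
        using \<eta> by (simp add: e'_def field_simps)
      have "measure lebesgue (\<Union>i\<in>C'. ball i (5 * r i)) \<le> (\<Sum>i\<in>C'. measure lebesgue (ball i (5 * r i)))"
        using C' by (intro measure_UNION_le) auto
      also have "\<dots> = (\<Sum>i\<in>C'. 10 * r i)"
      proof (rule sum.cong)
        fix x assume "x \<in> C'"
        then have "r x > 0" using r inE by auto
        then show "measure lebesgue (ball x (5 * r x)) = 10 * r x"
          by (simp add: ball_eq_greaterThanLessThan)
      qed simp
      also have "\<dots> \<le> e" using sr by (simp add: sum_distrib_left[symmetric])
      finally show ?thesis .
    qed
    show "\<exists>T. E \<eta> \<subseteq> T \<and> T \<in> lmeasurable \<and> measure lebesgue T \<le> e"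
    proof (intro exI conjI)
      show "E \<eta> \<subseteq> (\<Union>i\<in>C. ball i (5 * r i))" by fact
      show "(\<Union>i\<in>C. ball i (5 * r i)) \<in> lmeasurable"
        by (rule fmeasurable_UN_bound[OF C(1)]) (use fin in auto)
      show "measure lebesgue (\<Union>i\<in>C. ball i (5 * r i)) \<le> e"
        by (rule measure_UN_bound[OF C(1)]) (use fin in auto)
    qed
  qed
  define N where "N = (\<Union>n. E (inverse (of_nat (Suc n))))"
  have "negligible N"
    unfolding N_def by (intro negligible_countable_Union) (auto intro!: neg)
  moreover have "(F has_vector_derivative g x) (at x)" if x: "x \<in> {a<..<b} - N" for x
    unfolding has_vector_derivative_def has_derivative_at_alt
  proof (intro conjI allI impI)
    show "bounded_linear (\<lambda>xa. xa *\<^sub>R g x)" by (rule bounded_linear_scaleR_left)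
    fix e :: real assume "e > 0"
    then obtain n where n: "inverse (of_nat (Suc n)) < e"
      using reals_Archimedean by blast
    have "x \<notin> E (inverse (of_nat (Suc n)))" using x by (auto simp: N_def)
    then have "\<not> (\<forall>\<delta>>0. \<exists>y\<in>{a<..<b}. \<bar>y - x\<bar> < \<delta> \<and> norm (F y - F x - (y - x) *\<^sub>R g x) > inverse (of_nat (Suc n)) * \<bar>y - x\<bar>)"
      using x unfolding E_def by blast
    then obtain \<delta> where "\<delta> > 0" "\<forall>y\<in>{a<..<b}. \<not> (\<bar>y - x\<bar> < \<delta> \<and> norm (F y - F x - (y - x) *\<^sub>R g x) > inverse (of_nat (Suc n)) * \<bar>y - x\<bar>)"
      by blast
    then have \<delta>: "\<delta> > 0" "\<And>y. y\<in>{a<..<b} \<Longrightarrow> \<bar>y - x\<bar> < \<delta> \<Longrightarrow> norm (F y - F x - (y - x) *\<^sub>R g x) \<le> inverse (of_nat (Suc n)) * \<bar>y - x\<bar>"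
      by (meson not_less)+
    have "\<forall>y. norm (y - x) < min \<delta> (min (x - a) (b - x)) \<longrightarrow> norm (F y - F x - (y - x) *\<^sub>R g x) \<le> e * norm (y - x)"
    proof (intro allI impI)
      fix y assume y: "norm (y - x) < min \<delta> (min (x - a) (b - x))"
      then have "y \<in> {a<..<b}" "\<bar>y - x\<bar> < \<delta>" by (auto simp: abs_if split: if_splits)
      from \<delta>(2)[OF this] have "norm (F y - F x - (y - x) *\<^sub>R g x) \<le> inverse (of_nat (Suc n)) * \<bar>y - x\<bar>" .
      also have "\<dots> \<le> e * norm (y - x)" using n by (auto intro!: mult_right_mono)
      finally show "norm (F y - F x - (y - x) *\<^sub>R g x) \<le> e * norm (y - x)" .
    qed
    then show "\<exists>d>0. \<forall>y. norm (y - x) < d \<longrightarrow> norm (F y - F x - (y - x) *\<^sub>R g x) \<le> e * norm (y - x)"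
      using \<delta>(1) x by (intro exI[of _ "min \<delta> (min (x - a) (b - x))"]) auto
  qed
  ultimately show ?thesis
    unfolding F_def by blast
qed

text \<open>
  An integrable function is a bounded one up to a small error in mean, and both
  parts are harmless on short intervals and against large exponential weights.
\<close>
lemma integral_excess_small:
  fixes g :: "'a \<Rightarrow> 'b::{banach, second_countable_topology}"
  assumes g: "integrable M g" and e: "e > 0"
  shows "\<exists>n::nat. (LINT x|M. max 0 (norm (g x) - real n)) < e"
proof -
  have "(\<lambda>n. LINT x|M. max 0 (norm (g x) - real n)) \<longlonglongrightarrow> (LINT x|M. 0)"
  proof (rule integral_dominated_convergence)
    show "integrable M (\<lambda>x. norm (g x))"
      using g by simp
    show "AE x in M. (\<lambda>n. max 0 (norm (g x) - real n)) \<longlonglongrightarrow> 0"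
    proof (intro AE_I2 tendsto_eventually)
      fix x
      obtain m :: nat where "norm (g x) \<le> real m" using real_arch_simple by blast
      then show "\<forall>\<^sub>F n in sequentially. max 0 (norm (g x) - real n) = 0"
        unfolding eventually_sequentially by (intro exI[of _ m]) auto
    qed
  qed (use g in auto)
  then have "\<forall>\<^sub>F n in sequentially. (LINT x|M. max 0 (norm (g x) - real n)) < e"
    using e order_tendstoD(2)[of _ 0 sequentially e] by simp
  then show ?thesis
    by (meson eventually_happens trivial_limit_sequentially)
qed

lemma abs_cont_on_indefinite_integral:
  fixes g :: "real \<Rightarrow> 'a::{banach, second_countable_topology}"
  assumes g: "integrable lborel g"
  shows "abs_cont_on a b (\<lambda>x. LINT t:{..x}|lborel. g t)"
  unfolding abs_cont_on_def
proof (intro allI impI)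
  fix e :: real assume e: "e > 0"
  obtain n :: nat where n: "(LINT x|lborel. max 0 (norm (g x) - real n)) < e / 2"
    using integral_excess_small[OF g, of "e / 2"] e by auto
  define h where "h = (\<lambda>x. max 0 (norm (g x) - real n))"
  have h: "integrable lborel h" "\<And>x. 0 \<le> h x" "\<And>x. norm (g x) \<le> real n + h x"
    using g by (auto simp: h_def intro!: Bochner_Integration.integrable_bound[where f=g and g=h, unfolded h_def])
  have gs: "set_integrable lborel A g" "set_integrable lborel A h" if "A \<in> sets borel" for A
    unfolding set_integrable_def by (rule integrable_mult_indicator; use that g h(1) in simp)+
  define \<delta> where "\<delta> = e / (2 * (real n + 1))"
  show "\<exists>\<delta>>0. \<forall>D. finite D \<and> (\<forall>(s, t)\<in>D. a \<le> s \<and> s \<le> t \<and> t \<le> b) \<and> disjoint_family_on (\<lambda>(s, t). {s<..<t}) D \<and>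
      (\<Sum>(s, t)\<in>D. t - s) < \<delta> \<longrightarrow> (\<Sum>(s, t)\<in>D. norm ((LINT x:{..t}|lborel. g x) - (LINT x:{..s}|lborel. g x))) < e"
  proof (intro exI[of _ \<delta>] conjI allI impI; (elim conjE)?)
    show "\<delta> > 0" using e by (simp add: \<delta>_def)
    fix D :: "(real \<times> real) set"
    assume D: "finite D" "\<forall>(s, t)\<in>D. a \<le> s \<and> s \<le> t \<and> t \<le> b" "disjoint_family_on (\<lambda>(s, t). {s<..<t}) D"
      "(\<Sum>(s, t)\<in>D. t - s) < \<delta>"
    have one: "norm ((LINT x:{..t}|lborel. g x) - (LINT x:{..s}|lborel. g x)) \<le> n * (t - s) + (LINT x:{s<..<t}|lborel. h x)" if st: "s \<le> t" for s t :: real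
    proof -
      have "(LINT x:{..t}|lborel. g x) = (LINT x:{..s} \<union> {s<..t}|lborel. g x)"
        using st by (simp add: ivl_disj_un_one)
      also have "\<dots> = (LINT x:{..s}|lborel. g x) + (LINT x:{s<..t}|lborel. g x)"
        by (rule set_integral_Un) (auto intro!: gs)
      finally have "(LINT x:{..t}|lborel. g x) - (LINT x:{..s}|lborel. g x) = (LINT x:{s<..t}|lborel. g x)"
        by simp
      also have "norm \<dots> \<le> (LINT x:{s<..t}|lborel. norm (g x))"
        by (rule set_integral_norm_bound) (auto intro!: gs)
      also have "\<dots> \<le> (LINT x:{s<..t}|lborel. real n + h x)"
        using h(3) st gs by (intro set_integral_mono set_integrable_norm set_integral_add) (auto simp: set_integrable_def)
      also have "\<dots> = (LINT x:{s<..t}|lborel. real n) + (LINT x:{s<..t}|lborel. h x)"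
        using st gs by (intro set_integral_add) (auto simp: set_integrable_def)
      also have "(LINT x:{s<..t}|lborel. h x) = (LINT x:{s<..<t}|lborel. h x)"
        unfolding set_lebesgue_integral_def
      proof (rule integral_cong_AE)
        show "AE x in lborel. indicat_real {s<..t} x *\<^sub>R h x = indicat_real {s<..<t} x *\<^sub>R h x"
          using AE_lborel_singleton[of t] by eventually_elim (auto simp: indicator_def)
      qed (use borel_measurable_integrable[OF h(1)] in measurable)
      also have "(LINT x:{s<..t}|lborel. real n) = n * (t - s)"
        using st by (simp add: set_lebesgue_integral_def)
      finally show ?thesis .
    qed
    have "(\<Sum>(s, t)\<in>D. norm ((LINT x:{..t}|lborel. g x) - (LINT x:{..s}|lborel. g x)))
        \<le> (\<Sum>(s, t)\<in>D. n * (t - s) + (LINT x:{s<..<t}|lborel. h x))"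
    proof (rule sum_mono)
      fix st assume "st \<in> D"
      then show "(case st of (s, t) \<Rightarrow> norm ((LINT x:{..t}|lborel. g x) - (LINT x:{..s}|lborel. g x)))
          \<le> (case st of (s, t) \<Rightarrow> n * (t - s) + (LINT x:{s<..<t}|lborel. h x))"
        using D(2) one[of "fst st" "snd st"] by (auto simp: case_prod_unfold)
    qed
    also have "\<dots> = n * (\<Sum>(s, t)\<in>D. t - s) + (\<Sum>(s, t)\<in>D. LINT x:{s<..<t}|lborel. h x)"
      by (simp add: case_prod_unfold sum.distrib sum_distrib_left)
    also have "(\<Sum>(s, t)\<in>D. LINT x:{s<..<t}|lborel. h x) = (LINT x|lborel. (\<Sum>st\<in>D. indicat_real (case st of (s, t) \<Rightarrow> {s<..<t}) x *\<^sub>R h x))"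
      unfolding set_lebesgue_integral_def case_prod_unfold
      using gs(2) by (subst Bochner_Integration.integral_sum) (auto simp: set_integrable_def)
    also have "\<dots> \<le> (LINT x|lborel. h x)"
    proof (rule integral_mono)
      fix x
      have "(\<Sum>st\<in>D. indicat_real (case st of (s, t) \<Rightarrow> {s<..<t}) x *\<^sub>R h x) = indicat_real (\<Union>st\<in>D. case st of (s, t) \<Rightarrow> {s<..<t}) x * h x"
        by (simp add: indicator_UN_disjoint[OF D(1,3)] sum_distrib_right)
      also have "\<dots> \<le> h x"
        using h(2)[of x] by (simp add: indicator_def)
      finally show "(\<Sum>st\<in>D. indicat_real (case st of (s, t) \<Rightarrow> {s<..<t}) x *\<^sub>R h x) \<le> h x" .
    qed (use gs(2) h in \<open>auto simp: set_integrable_def case_prod_unfold\<close>)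
    finally have "(\<Sum>(s, t)\<in>D. norm ((LINT x:{..t}|lborel. g x) - (LINT x:{..s}|lborel. g x)))
        \<le> n * (\<Sum>(s, t)\<in>D. t - s) + (LINT x|lborel. h x)" by simp
    also have "\<dots> \<le> n * \<delta> + (LINT x|lborel. h x)"
      using D(4) by (intro add_right_mono mult_left_mono) auto
    also have "n * \<delta> \<le> e / 2"
      using e by (simp add: \<delta>_def field_simps)
    also have "e / 2 + (LINT x|lborel. h x) < e"
      using n by (simp add: h_def)
    finally show "(\<Sum>(s, t)\<in>D. norm ((LINT x:{..t}|lborel. g x) - (LINT x:{..s}|lborel. g x))) < e"
      by simp
  qed
qed

lemma abs_cont_on_imp_continuous_on:
  fixes f :: "real \<Rightarrow> 'a::real_normed_vector"
  assumes ac: "abs_cont_on a b f"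
  shows "continuous_on {a..b} f"
  unfolding continuous_on_iff
proof (intro ballI allI impI)
  fix x e :: real assume x: "x \<in> {a..b}" and e: "e > 0"
  obtain \<delta> where \<delta>: "\<delta> > 0" and D: "\<And>D. finite D \<Longrightarrow> (\<forall>(s, t)\<in>D. a \<le> s \<and> s \<le> t \<and> t \<le> b) \<Longrightarrow>
        disjoint_family_on (\<lambda>(s, t). {s<..<t}) D \<Longrightarrow> (\<Sum>(s, t)\<in>D. t - s) < \<delta>
        \<Longrightarrow> (\<Sum>(s, t)\<in>D. norm (f t - f s)) < e"
    using ac[unfolded abs_cont_on_def, rule_format, OF e] by auto
  have "dist (f y) (f x) < e" if y: "y \<in> {a..b}" "dist y x < \<delta>" for y
  proof (cases "x \<le> y")
    case True
    then show ?thesis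
      using D[of "{(x, y)}"] x y by (auto simp: disjoint_family_on_def dist_norm)
  next
    case False
    then show ?thesis
      using D[of "{(y, x)}"] x y by (auto simp: disjoint_family_on_def dist_norm norm_minus_commute)
  qed
  then show "\<exists>d>0. \<forall>x'\<in>{a..b}. dist x' x < d \<longrightarrow> dist (f x') (f x) < e"
    using \<delta> by blast
qed

lemma abs_cont_on_lipschitz:
  fixes f :: "real \<Rightarrow> 'a::real_normed_vector"
  assumes L: "\<And>s t. a \<le> s \<Longrightarrow> s \<le> t \<Longrightarrow> t \<le> b \<Longrightarrow> norm (f t - f s) \<le> L * (t - s)"
  shows "abs_cont_on a b f"
  unfolding abs_cont_on_def
proof (intro allI impI)
  fix e :: real assume e: "e > 0"
  show "\<exists>\<delta>>0. \<forall>D. finite D \<and> (\<forall>(s, t)\<in>D. a \<le> s \<and> s \<le> t \<and> t \<le> b) \<and> disjoint_family_on (\<lambda>(s, t). {s<..<t}) D \<and>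
      (\<Sum>(s, t)\<in>D. t - s) < \<delta> \<longrightarrow> (\<Sum>(s, t)\<in>D. norm (f t - f s)) < e"
  proof (intro exI[of _ "e / (\<bar>L\<bar> + 1)"] conjI allI impI; (elim conjE)?)
    show "e / (\<bar>L\<bar> + 1) > 0" using e by simp
    fix D :: "(real \<times> real) set"
    assume D: "finite D" "\<forall>(s, t)\<in>D. a \<le> s \<and> s \<le> t \<and> t \<le> b" "(\<Sum>(s, t)\<in>D. t - s) < e / (\<bar>L\<bar> + 1)"
    have "(\<Sum>(s, t)\<in>D. norm (f t - f s)) \<le> (\<Sum>(s, t)\<in>D. (\<bar>L\<bar> + 1) * (t - s))"
    proof (rule sum_mono, clarify)
      fix s t assume "(s, t) \<in> D"
      then have "norm (f t - f s) \<le> L * (t - s)" "s \<le> t" using L D(2) by auto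
      moreover have "L * (t - s) \<le> (\<bar>L\<bar> + 1) * (t - s)" using \<open>s \<le> t\<close> by (intro mult_right_mono) auto
      ultimately show "norm (f t - f s) \<le> (\<bar>L\<bar> + 1) * (t - s)" by linarith
    qed
    also have "\<dots> = (\<bar>L\<bar> + 1) * (\<Sum>(s, t)\<in>D. t - s)"
      by (simp add: sum_distrib_left case_prod_unfold)
    also have "\<dots> < e"
      using D(3) by (simp add: field_simps)
    finally show "(\<Sum>(s, t)\<in>D. norm (f t - f s)) < e" .
  qed
qed

lemma abs_cont_on_add:
  fixes f g :: "real \<Rightarrow> 'a::real_normed_vector"
  assumes f: "abs_cont_on a b f" and g: "abs_cont_on a b g"
  shows "abs_cont_on a b (\<lambda>x. f x + g x)"
  unfolding abs_cont_on_def
proof (intro allI impI)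
  fix e :: real assume e: "e > 0"
  obtain \<delta>1 where 1: "\<delta>1 > 0" "\<And>D. finite D \<Longrightarrow> (\<forall>(s, t)\<in>D. a \<le> s \<and> s \<le> t \<and> t \<le> b) \<Longrightarrow>
        disjoint_family_on (\<lambda>(s, t). {s<..<t}) D \<Longrightarrow> (\<Sum>(s, t)\<in>D. t - s) < \<delta>1
        \<Longrightarrow> (\<Sum>(s, t)\<in>D. norm (f t - f s)) < e / 2"
    using f[unfolded abs_cont_on_def, rule_format, of "e / 2"] e by auto
  obtain \<delta>2 where 2: "\<delta>2 > 0" "\<And>D. finite D \<Longrightarrow> (\<forall>(s, t)\<in>D. a \<le> s \<and> s \<le> t \<and> t \<le> b) \<Longrightarrow>
        disjoint_family_on (\<lambda>(s, t). {s<..<t}) D \<Longrightarrow> (\<Sum>(s, t)\<in>D. t - s) < \<delta>2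
        \<Longrightarrow> (\<Sum>(s, t)\<in>D. norm (g t - g s)) < e / 2"
    using g[unfolded abs_cont_on_def, rule_format, of "e / 2"] e by auto
  show "\<exists>\<delta>>0. \<forall>D. finite D \<and> (\<forall>(s, t)\<in>D. a \<le> s \<and> s \<le> t \<and> t \<le> b) \<and> disjoint_family_on (\<lambda>(s, t). {s<..<t}) D \<and>
      (\<Sum>(s, t)\<in>D. t - s) < \<delta> \<longrightarrow> (\<Sum>(s, t)\<in>D. norm (f t + g t - (f s + g s))) < e"
  proof (intro exI[of _ "min \<delta>1 \<delta>2"] conjI allI impI; (elim conjE)?)
    show "min \<delta>1 \<delta>2 > 0" using 1 2 by simp
    fix D :: "(real \<times> real) set"
    assume D: "finite D" "\<forall>(s, t)\<in>D. a \<le> s \<and> s \<le> t \<and> t \<le> b" "disjoint_family_on (\<lambda>(s, t). {s<..<t}) D"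
      "(\<Sum>(s, t)\<in>D. t - s) < min \<delta>1 \<delta>2"
    have "(\<Sum>(s, t)\<in>D. norm (f t + g t - (f s + g s))) \<le> (\<Sum>(s, t)\<in>D. norm (f t - f s) + norm (g t - g s))"
      by (intro sum_mono) (auto simp: norm_diff_triangle_ineq)
    also have "\<dots> = (\<Sum>(s, t)\<in>D. norm (f t - f s)) + (\<Sum>(s, t)\<in>D. norm (g t - g s))"
      by (simp add: case_prod_unfold sum.distrib)
    also have "\<dots> < e"
      using 1(2)[OF D(1-3)] 2(2)[OF D(1-3)] D(4) by simp
    finally show "(\<Sum>(s, t)\<in>D. norm (f t + g t - (f s + g s))) < e" .
  qed
qed

lemma abs_cont_on_mult:
  fixes f g :: "real \<Rightarrow> 'a::real_normed_algebra"
  assumes f: "abs_cont_on a b f" and g: "abs_cont_on a b g"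
  shows "abs_cont_on a b (\<lambda>x. f x * g x)"
  unfolding abs_cont_on_def
proof (intro allI impI)
  fix e :: real assume e: "e > 0"
  have "bounded (f ` {a..b} \<union> g ` {a..b})"
    using f g by (intro bounded_Un[THEN iffD2] conjI compact_imp_bounded compact_continuous_image abs_cont_on_imp_continuous_on) auto
  then obtain B where B: "B > 0" "\<And>x. x \<in> {a..b} \<Longrightarrow> norm (f x) \<le> B" "\<And>x. x \<in> {a..b} \<Longrightarrow> norm (g x) \<le> B"
    unfolding bounded_pos by (auto simp: Un_iff)
  have eB: "e / (2 * B) > 0" using e B by simp
  obtain \<delta>1 where 1: "\<delta>1 > 0" "\<And>D. finite D \<Longrightarrow> (\<forall>(s, t)\<in>D. a \<le> s \<and> s \<le> t \<and> t \<le> b) \<Longrightarrow>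
        disjoint_family_on (\<lambda>(s, t). {s<..<t}) D \<Longrightarrow> (\<Sum>(s, t)\<in>D. t - s) < \<delta>1
        \<Longrightarrow> (\<Sum>(s, t)\<in>D. norm (f t - f s)) < e / (2 * B)"
    using f[unfolded abs_cont_on_def, rule_format, OF eB] by auto
  obtain \<delta>2 where 2: "\<delta>2 > 0" "\<And>D. finite D \<Longrightarrow> (\<forall>(s, t)\<in>D. a \<le> s \<and> s \<le> t \<and> t \<le> b) \<Longrightarrow>
        disjoint_family_on (\<lambda>(s, t). {s<..<t}) D \<Longrightarrow> (\<Sum>(s, t)\<in>D. t - s) < \<delta>2
        \<Longrightarrow> (\<Sum>(s, t)\<in>D. norm (g t - g s)) < e / (2 * B)"
    using g[unfolded abs_cont_on_def, rule_format, OF eB] by auto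
  show "\<exists>\<delta>>0. \<forall>D. finite D \<and> (\<forall>(s, t)\<in>D. a \<le> s \<and> s \<le> t \<and> t \<le> b) \<and> disjoint_family_on (\<lambda>(s, t). {s<..<t}) D \<and>
      (\<Sum>(s, t)\<in>D. t - s) < \<delta> \<longrightarrow> (\<Sum>(s, t)\<in>D. norm (f t * g t - f s * g s)) < e"
  proof (intro exI[of _ "min \<delta>1 \<delta>2"] conjI allI impI; (elim conjE)?)
    show "min \<delta>1 \<delta>2 > 0" using 1 2 by simp
    fix D :: "(real \<times> real) set"
    assume D: "finite D" "\<forall>(s, t)\<in>D. a \<le> s \<and> s \<le> t \<and> t \<le> b" "disjoint_family_on (\<lambda>(s, t). {s<..<t}) D"
      "(\<Sum>(s, t)\<in>D. t - s) < min \<delta>1 \<delta>2"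
    have "(\<Sum>(s, t)\<in>D. norm (f t * g t - f s * g s)) \<le> (\<Sum>(s, t)\<in>D. B * norm (f t - f s) + B * norm (g t - g s))"
    proof (rule sum_mono, clarify)
      fix s t assume "(s, t) \<in> D"
      then have st: "s \<in> {a..b}" "t \<in> {a..b}" using D(2) by auto
      have "f t * g t - f s * g s = (f t - f s) * g t + f s * (g t - g s)" by (simp add: algebra_simps)
      also have "norm \<dots> \<le> norm ((f t - f s) * g t) + norm (f s * (g t - g s))" by (rule norm_triangle_ineq)
      also have "\<dots> \<le> norm (f t - f s) * norm (g t) + norm (f s) * norm (g t - g s)"
        by (intro add_mono norm_mult_ineq)
      also have "\<dots> \<le> norm (f t - f s) * B + B * norm (g t - g s)"
        using B st by (intro add_mono mult_left_mono mult_right_mono) auto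
      finally show "norm (f t * g t - f s * g s) \<le> B * norm (f t - f s) + B * norm (g t - g s)" by (simp add: mult.commute)
    qed
    also have "\<dots> = B * (\<Sum>(s, t)\<in>D. norm (f t - f s)) + B * (\<Sum>(s, t)\<in>D. norm (g t - g s))"
      by (simp add: case_prod_unfold sum.distrib sum_distrib_left)
    also have "\<dots> < B * (e / (2 * B)) + B * (e / (2 * B))"
      using 1(2)[OF D(1-3)] 2(2)[OF D(1-3)] D(4) B(1) by (intro add_strict_mono mult_strict_left_mono) auto
    also have "\<dots> = e" using B(1) by simp
    finally show "(\<Sum>(s, t)\<in>D. norm (f t * g t - f s * g s)) < e" .
  qed
qed

lemma AE_indefinite_integral_has_vector_derivative:
  fixes g :: "real \<Rightarrow> 'a::euclidean_space"
  assumes g: "integrable lborel g"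
  shows "AE x in lebesgue. x \<in> {a<..<b} \<longrightarrow> ((\<lambda>x. LINT t:{..x}|lborel. g t) has_vector_derivative g x) (at x)"
proof -
  have gs: "set_integrable lborel A g" if "A \<in> sets borel" for A
    using g that unfolding set_integrable_def by (auto intro: integrable_mult_indicator)
  have "g integrable_on {a..b}"
    by (rule set_borel_integral_eq_integral(1)[OF gs]) simp
  then obtain N where N: "negligible N" "\<And>x. x\<in>{a<..<b} - N \<Longrightarrow> ((\<lambda>x. integral {a..x} g) has_vector_derivative g x) (at x)"
    using has_vector_derivative_indefinite_integral_ae[of g a b] by auto
  have "((\<lambda>x. LINT t:{..x}|lborel. g t) has_vector_derivative g x) (at x)" if x: "x\<in>{a<..<b} - N" for x
  proof -
    have "((\<lambda>x. (LINT t:{..a}|lborel. g t) + integral {a..x} g) has_vector_derivative 0 + g x) (at x)"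
      using N(2)[OF x] by (intro has_vector_derivative_add has_vector_derivative_const)
    moreover have "(LINT t:{..a}|lborel. g t) + integral {a..y} g = (LINT t:{..y}|lborel. g t)" if "y \<in> {a<..}" for y
    proof -
      have "integral {a..y} g = (LINT t:{a..y}|lborel. g t)"
        by (rule set_borel_integral_eq_integral(2)[OF gs, symmetric]) simp
      also have "\<dots> = (LINT t:{a<..y}|lborel. g t)"
        unfolding set_lebesgue_integral_def
      proof (rule integral_cong_AE)
        show "AE x in lborel. indicat_real {a..y} x *\<^sub>R g x = indicat_real {a<..y} x *\<^sub>R g x"
          using AE_lborel_singleton[of a] by eventually_elim (auto simp: indicator_def)
      qed (use borel_measurable_integrable[OF g] in measurable)
      finally have "(LINT t:{..a}|lborel. g t) + integral {a..y} g = (LINT t:{..a} \<union> {a<..y}|lborel. g t)"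
        by (subst set_integral_Un) (auto intro!: gs)
      also have "{..a} \<union> {a<..y} = {..y}"
        using that by auto
      finally show ?thesis .
    qed
    ultimately show ?thesis
      using x by (subst has_vector_derivative_transform_within_open[where S="{a<..}" and f="\<lambda>x. (LINT t:{..a}|lborel. g t) + integral {a..x} g"]) auto
  qed
  then have "{x. \<not> (x \<in> {a<..<b} \<longrightarrow> ((\<lambda>x. LINT t:{..x}|lborel. g t) has_vector_derivative g x) (at x))} \<subseteq> N"
    by auto
  then show ?thesis
    using N(1) by (intro AE_I'[of N]) (auto simp: negligible_iff_null_sets)
qed

section \<open>Fixed points in weighted supremum norms\<close>
text \<open>
  The contraction principle for functions on an arbitrary index set, with norm
  \<open>sup \<bar>f i\<bar> / w i\<close> and an invariant set \<open>P\<close> that is only required to be closed under pointwise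
  limits. Bounds of the form \<open>d * w i\<close> replace the norm, so no function space has to be constructed and
  \<open>P\<close> may contain measurability.
\<close>
lemma weighted_fixed_point:
  fixes T :: "('i \<Rightarrow> 'b::banach) \<Rightarrow> 'i \<Rightarrow> 'b" and w :: "'i \<Rightarrow> real"
  assumes P0: "P f0" and PT: "\<And>f. P f \<Longrightarrow> P (T f)"
    and Plim: "\<And>F f. (\<And>n. P (F n)) \<Longrightarrow> (\<And>i. (\<lambda>n. F n i) \<longlonglongrightarrow> f i) \<Longrightarrow> P f"
    and contr: "\<And>f g d i. P f \<Longrightarrow> P g \<Longrightarrow> 0 \<le> d \<Longrightarrow> (\<And>i. norm (f i - g i) \<le> d * w i) \<Longrightarrow>
      norm (T f i - T g i) \<le> c * d * w i"
    and c: "0 \<le> c" "c < 1" and w: "\<And>i. 0 \<le> w i"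
    and d0: "0 \<le> d0" "\<And>i. norm (T f0 i - f0 i) \<le> d0 * w i"
  shows "\<exists>f. P f \<and> (\<forall>i. T f i = f i)"
proof -
  define F where "F = (\<lambda>n. (T ^^ n) f0)"
  have PF: "P (F n)" for n
    by (induction n) (auto simp: F_def P0 PT)
  have FS: "F (Suc n) = T (F n)" for n
    by (simp add: F_def)
  have step: "norm (F (Suc n) i - F n i) \<le> c ^ n * d0 * w i" for n i
  proof (induction n arbitrary: i)
    case 0
    then show ?case using d0 by (simp add: F_def)
  next
    case (Suc n)
    have "norm (T (F (Suc n)) i - T (F n) i) \<le> c * (c ^ n * d0) * w i"
      using Suc c d0 by (intro contr PF) auto
    then show ?case by (simp add: FS mult.assoc)
  qed
  have tail: "norm (F (n + k) i - F n i) \<le> c ^ n * (1 - c ^ k) / (1 - c) * d0 * w i" for n k i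
  proof (induction k)
    case (Suc k)
    have "norm (F (n + Suc k) i - F n i) \<le> norm (F (Suc (n + k)) i - F (n + k) i) + norm (F (n + k) i - F n i)"
      using norm_triangle_ineq[of "F (Suc (n + k)) i - F (n + k) i" "F (n + k) i - F n i"] by simp
    also have "\<dots> \<le> c ^ (n + k) * d0 * w i + c ^ n * (1 - c ^ k) / (1 - c) * d0 * w i"
      by (intro add_mono step Suc)
    also have "\<dots> = c ^ n * (1 - c ^ Suc k) / (1 - c) * d0 * w i"
      using c by (simp add: field_simps power_add)
    finally show ?case .
  qed auto
  have tail': "norm (F (n + k) i - F n i) \<le> c ^ n / (1 - c) * d0 * w i" for n k i
  proof -
    have "c ^ n * (1 - c ^ k) / (1 - c) * d0 * w i \<le> c ^ n * 1 / (1 - c) * d0 * w i"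
      using c d0 w by (intro mult_right_mono divide_right_mono mult_left_mono) auto
    then show ?thesis using tail[where n=n and k=k and i=i] by simp
  qed
  have conv: "convergent (\<lambda>n. F n i)" for i
  proof -
    have "summable (\<lambda>n. c ^ n * (d0 * w i))"
      using c by (intro summable_mult2 summable_geometric) auto
    then have "summable (\<lambda>n. F (Suc n) i - F n i)"
      by (rule summable_comparison_test'[where N=0]) (use step in \<open>simp add: mult.assoc\<close>)
    then have "convergent (\<lambda>n. \<Sum>k<n. F (Suc k) i - F k i)"
      by (simp add: summable_iff_convergent)
    then have "convergent (\<lambda>n. F n i - F 0 i)"
      unfolding sum_lessThan_telescope[of "\<lambda>k. F k i"] .
    from convergent_add[OF this convergent_const[of "F 0 i"]] show ?thesis
      by simp
  qed
  define f where "f = (\<lambda>i. lim (\<lambda>n. F n i))"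
  have lim: "(\<lambda>n. F n i) \<longlonglongrightarrow> f i" for i
    using conv unfolding f_def by (simp add: convergent_LIMSEQ_iff)
  have Pf: "P f"
    by (rule Plim[OF PF lim])
  have fF: "norm (f i - F n i) \<le> c ^ n / (1 - c) * d0 * w i" for n i
  proof (rule tendsto_upperbound)
    show "(\<lambda>k. norm (F (n + k) i - F n i)) \<longlonglongrightarrow> norm (f i - F n i)"
      using LIMSEQ_ignore_initial_segment[OF lim[of i], of n] by (intro tendsto_intros) (simp add: add.commute)
  qed (use tail' in auto)
  have "T f i = f i" for i
  proof (rule LIMSEQ_unique)
    show "(\<lambda>n. F (Suc n) i) \<longlonglongrightarrow> f i"
      using lim[of i] by (rule LIMSEQ_Suc)
    have "norm (F (Suc n) i - T f i) \<le> c ^ n * (c * d0 * w i / (1 - c))" for n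
    proof -
      have "norm (T f i - T (F n) i) \<le> c * (c ^ n / (1 - c) * d0) * w i"
        using c d0 fF by (intro contr Pf PF) auto
      then show ?thesis
        by (simp add: FS norm_minus_commute field_simps)
    qed
    moreover have "(\<lambda>n. c ^ n * (c * d0 * w i / (1 - c))) \<longlonglongrightarrow> 0"
      by (rule tendsto_mult_left_zero, rule LIMSEQ_power_zero) (use c in simp)
    ultimately have "(\<lambda>n. F (Suc n) i - T f i) \<longlonglongrightarrow> 0"
      by (rule Lim_null_comparison[OF always_eventually[OF allI]])
    then show "(\<lambda>n. F (Suc n) i) \<longlonglongrightarrow> T f i"
      by (rule LIM_zero_cancel)
  qed
  then show ?thesis
    using Pf by (intro exI[of _ f] conjI allI)
qed

lemma weighted_fixed_point_unique:
  fixes T :: "('i \<Rightarrow> 'b::real_normed_vector) \<Rightarrow> 'i \<Rightarrow> 'b" and w :: "'i \<Rightarrow> real"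
  assumes contr: "\<And>d i. 0 \<le> d \<Longrightarrow> (\<And>i. norm (f i - g i) \<le> d * w i) \<Longrightarrow> norm (f i - g i) \<le> c * d * w i"
    and c: "0 \<le> c" "c < 1" and d: "0 \<le> d" "\<And>i. norm (f i - g i) \<le> d * w i"
  shows "f i = g i"
proof -
  have "norm (f i - g i) \<le> c ^ n * d * w i" for n i
  proof (induction n arbitrary: i)
    case (Suc n)
    have "norm (f i - g i) \<le> c * (c ^ n * d) * w i"
      using Suc c d by (intro contr) auto
    then show ?case by (simp add: mult.assoc)
  qed (use d in simp)
  moreover have "(\<lambda>n. c ^ n * d * w i) \<longlonglongrightarrow> 0"
    using c by (auto simp: mult.assoc intro!: tendsto_mult_left_zero LIMSEQ_power_zero)
  ultimately have "norm (f i - g i) \<le> 0"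
    by (intro tendsto_lowerbound[of _ 0 sequentially]) auto
  then show ?thesis by simp
qed

lemma integral_exp_Icc:
  fixes M x y :: real
  assumes "M > 0" "x \<le> y"
  shows "(LINT t:{x..y}|lborel. exp (M * t)) = (exp (M * y) - exp (M * x)) / M"
proof -
  have "(LINT t|lborel. indicator {x..y} t *\<^sub>R exp (M * t)) = exp (M * y) / M - exp (M * x) / M"
    by (rule integral_FTC_Icc) (use assms in \<open>auto intro!: derivative_eq_intros continuous_intros simp: has_real_derivative_iff_has_vector_derivative[symmetric]\<close>)
  then show ?thesis
    by (simp add: set_lebesgue_integral_def diff_divide_distrib)
qed

text \<open>
  Against the weight \<open>exp (M x)\<close> with large \<open>M\<close>, integration with the density \<open>\<bar>q\<bar>\<close> is an operator of
  small norm, so that Volterra equations are contractions without a smallness assumption on \<open>q\<close>. For the bounded part of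
  \<open>q\<close> the factor \<open>1 / M\<close> makes it small, and the rest is small in mean.
\<close>
lemma exp_weight:
  fixes q :: "real \<Rightarrow> real"
  assumes q: "integrable lborel q" and e: "e > 0"
  shows "\<exists>M\<ge>1. \<forall>x. (LINT t:{0..x}|lborel. \<bar>q t\<bar> * exp (M * t)) \<le> e * exp (M * x)"
proof -
  obtain n :: nat where n: "(LINT x|lborel. max 0 (norm (q x) - real n)) < e / 2"
    using integral_excess_small[OF q, of "e / 2"] e by auto
  define h where "h = (\<lambda>x. max 0 (\<bar>q x\<bar> - real n))"
  have h: "integrable lborel h" "\<And>x. 0 \<le> h x" "\<And>x. \<bar>q x\<bar> \<le> real n + h x"
    using q by (auto simp: h_def intro!: Bochner_Integration.integrable_bound[where f=q and g=h, unfolded h_def])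
  define M where "M = 2 * real n / e + 1"
  have M: "M \<ge> 1" "real n / M \<le> e / 2"
    using e by (auto simp: M_def field_simps)
  have "(LINT t:{0..x}|lborel. \<bar>q t\<bar> * exp (M * t)) \<le> e * exp (M * x)" for x
  proof (cases "0 \<le> x")
    case True
    have i1: "set_integrable lborel {0..x} (\<lambda>t. exp (M * t))"
      by (rule borel_integrable_atLeastAtMost') (intro continuous_intros)
    have i2: "set_integrable lborel {0..x} h"
      unfolding set_integrable_def by (rule integrable_mult_indicator) (use h in auto)
    have "(LINT t:{0..x}|lborel. \<bar>q t\<bar> * exp (M * t)) \<le> (LINT t:{0..x}|lborel. real n * exp (M * t) + exp (M * x) * h t)"
    proof (rule set_integral_mono)
      show "set_integrable lborel {0..x} (\<lambda>t. \<bar>q t\<bar> * exp (M * t))"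
      proof (rule set_integrable_bound)
        show "set_integrable lborel {0..x} (\<lambda>t. exp (M * x) * q t)"
          unfolding set_integrable_def by (rule integrable_mult_indicator) (use q in auto)
        show "set_borel_measurable lborel {0..x} (\<lambda>t. \<bar>q t\<bar> * exp (M * t))"
          unfolding set_borel_measurable_def using borel_measurable_integrable[OF q] by measurable
        show "AE t in lborel. t \<in> {0..x} \<longrightarrow> norm (\<bar>q t\<bar> * exp (M * t)) \<le> norm (exp (M * x) * q t)"
        proof (intro AE_I2 impI)
          fix t assume "t \<in> {0..x}"
          then have "exp (M * t) \<le> exp (M * x)"
            using M by simp
          then have "\<bar>q t\<bar> * exp (M * t) \<le> \<bar>q t\<bar> * exp (M * x)"
            by (rule mult_left_mono) simp
          then show "norm (\<bar>q t\<bar> * exp (M * t)) \<le> norm (exp (M * x) * q t)"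
            by (simp add: abs_mult mult.commute)
        qed
      qed
      show "set_integrable lborel {0..x} (\<lambda>t. real n * exp (M * t) + exp (M * x) * h t)"
        using i1 i2 by (intro set_integral_add set_integrable_mult_right) auto
      fix t assume t: "t \<in> {0..x}"
      have "\<bar>q t\<bar> * exp (M * t) \<le> (real n + h t) * exp (M * t)"
        using h by (intro mult_right_mono) auto
      also have "\<dots> = real n * exp (M * t) + h t * exp (M * t)"
        by (simp add: algebra_simps)
      also have "\<dots> \<le> real n * exp (M * t) + h t * exp (M * x)"
        using t M h by (intro add_left_mono mult_left_mono) auto
      finally show "\<bar>q t\<bar> * exp (M * t) \<le> real n * exp (M * t) + exp (M * x) * h t"
        by (simp add: mult.commute)
    qed
    also have "\<dots> = real n * (LINT t:{0..x}|lborel. exp (M * t)) + exp (M * x) * (LINT t:{0..x}|lborel. h t)"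
      using i1 i2 by (subst set_integral_add) auto
    also have "\<dots> \<le> real n * (exp (M * x) / M) + exp (M * x) * (e / 2)"
    proof (intro add_mono mult_left_mono)
      show "(LINT t:{0..x}|lborel. exp (M * t)) \<le> exp (M * x) / M"
        using M True by (subst integral_exp_Icc) (auto simp: divide_right_mono)
      have "(LINT t:{0..x}|lborel. h t) \<le> (LINT t|lborel. h t)"
        unfolding set_lebesgue_integral_def using i2 h
        by (intro integral_mono) (auto simp: set_integrable_def indicator_def)
      then show "(LINT t:{0..x}|lborel. h t) \<le> e / 2"
        using n by (simp add: h_def)
    qed auto
    also have "\<dots> = (real n / M + e / 2) * exp (M * x)"
      by (simp add: algebra_simps)
    also have "\<dots> \<le> e * exp (M * x)"
      using M(2) by (intro mult_right_mono) (linarith, simp)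
    finally show ?thesis .
  qed (use e in \<open>simp add: set_lebesgue_integral_def\<close>)
  then show ?thesis
    using M by blast
qed

section \<open>The Goursat problem of the transformation kernel\<close>
lemma integrable_product_lborel:
  fixes f :: "'a::euclidean_space \<Rightarrow> real" and g :: "'b::euclidean_space \<Rightarrow> real"
  assumes f: "integrable lborel f" and g: "integrable lborel g"
  shows "integrable lborel (\<lambda>p. f (fst p) * g (snd p))"
proof -
  have [measurable]: "f \<in> borel_measurable borel" "g \<in> borel_measurable borel"
    using f g borel_measurable_integrable by auto
  have "integrable (lborel \<Otimes>\<^sub>M lborel) (\<lambda>p. f (fst p) * g (snd p))"
  proof (rule lborel_pair.Fubini_integrable)
    show "integrable lborel (\<lambda>x. LINT y|lborel. norm (f (fst (x, y)) * g (snd (x, y))))"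
      using f g by (simp add: abs_mult)
    show "AE x in lborel. integrable lborel (\<lambda>y. f (fst (x, y)) * g (snd (x, y)))"
      using g by auto
  qed measurable
  then show ?thesis by (simp add: lborel_prod)
qed

text \<open>
  The potential in the characteristic coordinates \<open>\<xi> = (x + t) / 2\<close>, \<open>\<eta> = (x - t) / 2\<close>, cut off to the
  quadrant. For \<open>q\<close> supported in \<open>[0, 1]\<close> it lives on the triangle \<open>0 \<le> \<xi>\<close>, \<open>0 \<le> \<eta>\<close>, \<open>\<xi> + \<eta> \<le> 1\<close>.
\<close>
definition triangle_kernel :: "(real \<Rightarrow> real) \<Rightarrow> real \<times> real \<Rightarrow> real" where
  "triangle_kernel q p = indicator ({0..} \<times> {0..}) p * q (fst p + snd p)"

lemma triangle_kernel_eq: "triangle_kernel q (\<xi>, \<eta>) = indicator {0..} \<xi> * indicator {0..} \<eta> * q (\<xi> + \<eta>)"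
  by (simp add: triangle_kernel_def indicator_times)

lemma borel_measurable_triangle_kernel [measurable]:
  assumes [measurable]: "q \<in> borel_measurable borel"
  shows "triangle_kernel q \<in> borel_measurable borel"
proof -
  have "triangle_kernel q \<in> borel_measurable (borel \<Otimes>\<^sub>M borel)"
    unfolding triangle_kernel_def indicator_times by measurable
  then show ?thesis by (simp add: borel_prod)
qed

lemma integrable_triangle_kernel:
  assumes q: "integrable lborel q" and q0: "\<And>t. t \<notin> {0..1} \<Longrightarrow> q t = 0"
  shows "integrable lborel (triangle_kernel q)"
    and "(LINT p|lborel. \<bar>triangle_kernel q p\<bar>) \<le> (LINT t|lborel. \<bar>q t\<bar>)"
proof -
  have [measurable]: "q \<in> borel_measurable borel"
    using q borel_measurable_integrable by auto
  have meas: "triangle_kernel q \<in> borel_measurable (lborel \<Otimes>\<^sub>M lborel)"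
    by (simp add: lborel_prod)
  have sh: "integrable lborel (\<lambda>y. q (x + y))" for x
    using lborel_integrable_real_affine[OF q, of 1 x] by simp
  have shi: "(LINT y|lborel. \<bar>q (x + y)\<bar>) = (LINT t|lborel. \<bar>q t\<bar>)" for x
    using lborel_integral_real_affine[of 1 "\<lambda>t. \<bar>q t\<bar>" x] by simp
  have ib: "integrable lborel (\<lambda>y. triangle_kernel q (x, y))" for x
    by (rule Bochner_Integration.integrable_bound[OF sh[of x]])
       (auto simp: triangle_kernel_eq indicator_def)
  have ile: "(LINT y|lborel. \<bar>triangle_kernel q (x, y)\<bar>) \<le> indicator {0..1} x * (LINT t|lborel. \<bar>q t\<bar>)" for x
  proof (cases "x \<in> {0..1}")
    case True
    have "(LINT y|lborel. \<bar>triangle_kernel q (x, y)\<bar>) \<le> (LINT y|lborel. \<bar>q (x + y)\<bar>)"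
    proof (rule integral_mono)
      show "integrable lborel (\<lambda>y. \<bar>triangle_kernel q (x, y)\<bar>)" "integrable lborel (\<lambda>y. \<bar>q (x + y)\<bar>)"
        by (rule integrable_abs[OF ib] integrable_abs[OF sh])+
      show "\<bar>triangle_kernel q (x, y)\<bar> \<le> \<bar>q (x + y)\<bar>" for y
        by (simp add: triangle_kernel_eq indicator_def)
    qed
    then show ?thesis using True shi by simp
  next
    case False
    then have "triangle_kernel q (x, y) = 0" for y
      using q0[of "x + y"] by (cases "x + y \<in> {0..1}") (auto simp: triangle_kernel_eq indicator_def)
    then show ?thesis using False by simp
  qed
  have nonneg: "0 \<le> (LINT y|lborel. \<bar>triangle_kernel q (x, y)\<bar>)" for x
    by (rule Bochner_Integration.integral_nonneg) (rule abs_ge_zero)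
  have out: "integrable lborel (\<lambda>x. LINT y|lborel. \<bar>triangle_kernel q (x, y)\<bar>)"
  proof (rule Bochner_Integration.integrable_bound)
    show "integrable lborel (\<lambda>x::real. indicator {0..1} x * (LINT t|lborel. \<bar>q t\<bar>))"
      by (intro integrable_mult_left integrable_real_indicator) auto
    show "(\<lambda>x. LINT y|lborel. \<bar>triangle_kernel q (x, y)\<bar>) \<in> borel_measurable lborel"
      using meas by (intro lborel.borel_measurable_lebesgue_integral) (simp add: case_prod_unfold)
    show "AE x in lborel. norm (LINT y|lborel. \<bar>triangle_kernel q (x, y)\<bar>) \<le> norm (indicator {0..1} x * (LINT t|lborel. \<bar>q t\<bar>))"
    proof (rule AE_I2)
      fix x show "norm (LINT y|lborel. \<bar>triangle_kernel q (x, y)\<bar>) \<le> norm (indicator {0..1} x * (LINT t|lborel. \<bar>q t\<bar>))"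
        using ile[of x] nonneg[of x] unfolding real_norm_def by linarith
    qed
  qed
  have int: "integrable (lborel \<Otimes>\<^sub>M lborel) (triangle_kernel q)"
  proof (rule lborel_pair.Fubini_integrable[OF meas])
    show "integrable lborel (\<lambda>x. LINT y|lborel. norm (triangle_kernel q (x, y)))"
      using out by simp
    show "AE x in lborel. integrable lborel (\<lambda>y. triangle_kernel q (x, y))"
      by (rule AE_I2) (rule ib)
  qed
  then show "integrable lborel (triangle_kernel q)"
    by (simp add: lborel_prod)
  have "(LINT p|lborel. \<bar>triangle_kernel q p\<bar>) = (LINT x|lborel. LINT y|lborel. \<bar>triangle_kernel q (x, y)\<bar>)"
    unfolding lborel_prod[symmetric] by (rule lborel_pair.integral_fst'[symmetric]) (rule integrable_abs[OF int])
  also have "\<dots> \<le> (LINT x|lborel. indicator {0..1::real} x * (LINT t|lborel. \<bar>q t\<bar>))"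
  proof (rule integral_mono[OF out _ ile])
    show "integrable lborel (\<lambda>x::real. indicator {0..1} x * (LINT t|lborel. \<bar>q t\<bar>))"
      by (intro integrable_mult_left integrable_real_indicator) auto
  qed
  also have "\<dots> = (LINT x|lborel. indicat_real {0..1::real} x) * (LINT t|lborel. \<bar>q t\<bar>)"
    by (rule integral_mult_left_zero)
  also have "\<dots> = (LINT t|lborel. \<bar>q t\<bar>)"
    by simp
  finally show "(LINT p|lborel. \<bar>triangle_kernel q p\<bar>) \<le> (LINT t|lborel. \<bar>q t\<bar>)" .
qed

text \<open>
  A fixed point solves \<open>a\<^sub>\<xi>\<^sub>\<eta> = q(\<xi> + \<eta>) a\<close> in integrated form; for \<open>q\<close> supported in \<open>[0, 1]\<close>, the boundary terms are such that
  \<open>a(\<xi>, 0)\<close> and \<open>- a(0, \<xi>)\<close> are half the integral of \<open>q\<close> up to \<open>\<xi>\<close>.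
\<close>
definition goursat_map :: "(real \<Rightarrow> real) \<Rightarrow> (real \<times> real \<Rightarrow> real) \<Rightarrow> real \<times> real \<Rightarrow> real" where
  "goursat_map q a p = ((LINT t:{..fst p}|lborel. q t) - (LINT t:{..snd p}|lborel. q t)) / 2 +
     (LINT s|lborel. indicator ({..fst p} \<times> {..snd p}) s * (triangle_kernel q s * a s))"

lemma borel_measurable_goursat_map:
  assumes [measurable]: "q \<in> borel_measurable borel" "a \<in> borel_measurable borel"
  shows "goursat_map q a \<in> borel_measurable borel"
proof -
  define S where "S = {x :: (real \<times> real) \<times> real \<times> real. fst (snd x) \<le> fst (fst x) \<and> snd (snd x) \<le> snd (fst x)}"
  have "closed S"
    unfolding S_def by (rule closed_Collect_conj; rule closed_Collect_le; rule continuous_on_fst continuous_on_snd; rule continuous_on_fst continuous_on_snd; rule continuous_on_id)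
  then have "S \<in> sets ((borel :: (real \<times> real) measure) \<Otimes>\<^sub>M borel)"
    unfolding borel_prod by (rule borel_closed)
  then have [measurable]: "S \<in> sets ((borel :: (real \<times> real) measure) \<Otimes>\<^sub>M lborel)"
    by (simp add: sets_pair_measure_cong[OF refl sets_lborel])
  have *: "(\<lambda>(p, s). indicator ({..fst p} \<times> {..snd p}) s * (triangle_kernel q s * a s)) =
     (\<lambda>x. indicator S x * (triangle_kernel q (snd x) * a (snd x)))"
    by (auto simp: indicator_def fun_eq_iff S_def)
  have "(\<lambda>(p, s). indicator ({..fst p} \<times> {..snd p}) s * (triangle_kernel q s * a s))
      \<in> borel_measurable ((borel :: (real \<times> real) measure) \<Otimes>\<^sub>M lborel)"
    unfolding * by measurable
  then have 1: "(\<lambda>p :: real \<times> real. LINT s|lborel. indicator ({..fst p} \<times> {..snd p}) s * (triangle_kernel q s * a s)) \<in> borel_measurable borel"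
    by (rule lborel.borel_measurable_lebesgue_integral)
  have **: "(\<lambda>(x, t). indicat_real {..x} t *\<^sub>R q t) = (\<lambda>(x, t). indicator {(x, t). t \<le> x} (x, t) * q t)"
    by (auto simp: indicator_def fun_eq_iff)
  have "(\<lambda>(x, t). indicat_real {..x} t *\<^sub>R q t) \<in> borel_measurable ((borel :: real measure) \<Otimes>\<^sub>M lborel)"
    unfolding ** by measurable
  then have 2: "(\<lambda>x. LINT t:{..x}|lborel. q t) \<in> borel_measurable borel"
    unfolding set_lebesgue_integral_def by (rule lborel.borel_measurable_lebesgue_integral)
  have 3: "(\<lambda>p :: real \<times> real. LINT t:{..fst p}|lborel. q t) \<in> borel_measurable borel"
    "(\<lambda>p :: real \<times> real. LINT t:{..snd p}|lborel. q t) \<in> borel_measurable borel"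
    by (rule measurable_compose[OF _ 2]; simp add: borel_prod[symmetric])+
  show ?thesis
    unfolding goursat_map_def
    by (intro borel_measurable_add borel_measurable_divide borel_measurable_diff borel_measurable_const 1 3)
qed

lemma triangle_kernel_nonzeroD:
  assumes "triangle_kernel q s \<noteq> 0" and q0: "\<And>t. t \<notin> {0..1} \<Longrightarrow> q t = 0"
  shows "0 \<le> fst s" "0 \<le> snd s" "fst s + snd s \<le> 1"
proof -
  show 1: "0 \<le> fst s" "0 \<le> snd s"
    using assms(1) by (auto simp: triangle_kernel_def indicator_def split: if_splits)
  have "q (fst s + snd s) \<noteq> 0"
    using assms(1) by (auto simp: triangle_kernel_def)
  then show "fst s + snd s \<le> 1"
    using q0[of "fst s + snd s"] by force
qed

lemma integrable_triangle_kernel_scaleR: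
  fixes \<phi> :: "real \<times> real \<Rightarrow> 'b::{banach, second_countable_topology}"
  assumes q: "integrable lborel q" and q0: "\<And>t. t \<notin> {0..1} \<Longrightarrow> q t = 0"
    and [measurable]: "\<phi> \<in> borel_measurable borel"
    and B: "\<And>\<xi> \<eta>. 0 \<le> \<xi> \<Longrightarrow> 0 \<le> \<eta> \<Longrightarrow> \<xi> + \<eta> \<le> 1 \<Longrightarrow> norm (\<phi> (\<xi>, \<eta>)) \<le> B"
  shows "integrable lborel (\<lambda>s. triangle_kernel q s *\<^sub>R \<phi> s)"
proof (rule Bochner_Integration.integrable_bound)
  have [measurable]: "q \<in> borel_measurable borel"
    using q borel_measurable_integrable by auto
  show "integrable lborel (\<lambda>s. B * triangle_kernel q s)"
    using integrable_triangle_kernel(1)[OF q q0] by simp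
  show "(\<lambda>s. triangle_kernel q s *\<^sub>R \<phi> s) \<in> borel_measurable lborel"
    by measurable
  show "AE s in lborel. norm (triangle_kernel q s *\<^sub>R \<phi> s) \<le> norm (B * triangle_kernel q s)"
  proof (rule AE_I2)
    fix s
    show "norm (triangle_kernel q s *\<^sub>R \<phi> s) \<le> norm (B * triangle_kernel q s)"
    proof (cases "triangle_kernel q s = 0")
      case False
      from triangle_kernel_nonzeroD[OF this q0] have "norm (\<phi> s) \<le> B"
        using B[of "fst s" "snd s"] by simp
      then have "norm (\<phi> s) \<le> \<bar>B\<bar>" by simp
      then have "\<bar>triangle_kernel q s\<bar> * norm (\<phi> s) \<le> \<bar>triangle_kernel q s\<bar> * \<bar>B\<bar>"
        by (rule mult_left_mono) simp
      then show ?thesis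
        by (simp add: abs_mult mult.commute)
    qed simp
  qed
qed

text \<open>
  The two-dimensional analogue of the exponential weight, which reduces to it along each line
  \<open>\<xi> = const\<close> because \<open>triangle_kernel\<close> depends on \<open>\<xi> + \<eta>\<close> alone there. The outer
  integration costs nothing, as \<open>M \<ge> 1\<close>.
\<close>
lemma triangle_kernel_exp_weight:
  assumes q: "integrable lborel q" and q0: "\<And>t. t \<notin> {0..1} \<Longrightarrow> q t = 0"
  shows "\<exists>M\<ge>1. \<forall>\<alpha> \<beta>. (LINT s|lborel. \<bar>triangle_kernel q s\<bar> * (indicator ({..\<alpha>} \<times> {..\<beta>}) s * exp (M * (\<bar>fst s\<bar> + \<bar>snd s\<bar>))))
     \<le> exp (M * (\<bar>\<alpha>\<bar> + \<bar>\<beta>\<bar>)) / 2"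
proof -
  have [measurable]: "q \<in> borel_measurable borel"
    using q borel_measurable_integrable by auto
  obtain M where M: "M \<ge> 1" "\<And>x. (LINT t:{0..x}|lborel. \<bar>q t\<bar> * exp (M * t)) \<le> 1 / 2 * exp (M * x)"
    using exp_weight[OF q, of "1/2"] by auto
  have "(LINT s|lborel. \<bar>triangle_kernel q s\<bar> * (indicator ({..\<alpha>} \<times> {..\<beta>}) s * exp (M * (\<bar>fst s\<bar> + \<bar>snd s\<bar>))))
     \<le> exp (M * (\<bar>\<alpha>\<bar> + \<bar>\<beta>\<bar>)) / 2" for \<alpha> \<beta>
  proof -
    define f where "f = (\<lambda>s. \<bar>triangle_kernel q s\<bar> * (indicator ({..\<alpha>} \<times> {..\<beta>}) s * exp (M * (\<bar>fst s\<bar> + \<bar>snd s\<bar>))))"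
    have ai: "integrable lborel (\<lambda>t. \<bar>q t\<bar>)" "\<And>t. t \<notin> {0..1} \<Longrightarrow> \<bar>q t\<bar> = 0"
      using q q0 by auto
    have ak: "\<bar>triangle_kernel q s\<bar> = triangle_kernel (\<lambda>t. \<bar>q t\<bar>) s" for s
      by (simp add: triangle_kernel_def abs_mult)
    have indm: "indicat_real ({..\<alpha>} \<times> {..\<beta>}) \<in> borel_measurable borel"
      by (intro borel_measurable_indicator borel_closed closed_Times) auto
    have expm: "(\<lambda>s::real \<times> real. exp (M * (\<bar>fst s\<bar> + \<bar>snd s\<bar>))) \<in> borel_measurable borel"
      by (intro borel_measurable_continuous_onI continuous_intros)
    have fi: "integrable lborel f"
      unfolding f_def ak real_scaleR_def[symmetric, of "triangle_kernel _ _"]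
    proof (rule integrable_triangle_kernel_scaleR[OF ai, where B = "exp (2 * M)"])
      show "(\<lambda>s. indicat_real ({..\<alpha>} \<times> {..\<beta>}) s * exp (M * (\<bar>fst s\<bar> + \<bar>snd s\<bar>))) \<in> borel_measurable borel"
        by (rule borel_measurable_times[OF indm expm])
      fix \<xi> \<eta> :: real assume "0 \<le> \<xi>" "0 \<le> \<eta>" "\<xi> + \<eta> \<le> 1"
      then have "M * (\<xi> + \<eta>) \<le> M * 2"
        using M by (intro mult_left_mono) auto
      then show "norm (indicat_real ({..\<alpha>} \<times> {..\<beta>}) (\<xi>, \<eta>) * exp (M * (\<bar>fst (\<xi>, \<eta>)\<bar> + \<bar>snd (\<xi>, \<eta>)\<bar>))) \<le> exp (2 * M)"
        using \<open>0 \<le> \<xi>\<close> \<open>0 \<le> \<eta>\<close> by (auto simp: indicator_def mult.commute)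
    qed
    then have fi': "integrable (lborel \<Otimes>\<^sub>M lborel) f"
      by (simp add: lborel_prod)
    have inner: "(LINT \<eta>|lborel. f (\<xi>, \<eta>)) \<le> indicator {0..\<alpha>} \<xi> * (exp (M * \<xi>) * (exp (M * \<bar>\<beta>\<bar>) / 2))" for \<xi>
    proof (cases "\<xi> \<in> {0..\<alpha>}")
      case True
      define g where "g = (\<lambda>t. indicator {\<xi>..\<xi> + \<beta>} t * (\<bar>q t\<bar> * exp (M * t)))"
      have f_g: "f (\<xi>, \<eta>) = g (\<xi> + 1 * \<eta>)" for \<eta>
        using True by (auto simp: f_def g_def triangle_kernel_eq indicator_def abs_mult)
      have si: "set_integrable lborel {0..y} (\<lambda>t. \<bar>q t\<bar> * exp (M * t))" for y
      proof (rule set_integrable_bound)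
        show "set_integrable lborel {0..y} (\<lambda>t. exp (M * y) * q t)"
          unfolding set_integrable_def by (rule integrable_mult_indicator) (use q in auto)
        show "set_borel_measurable lborel {0..y} (\<lambda>t. \<bar>q t\<bar> * exp (M * t))"
          unfolding set_borel_measurable_def by measurable
        show "AE t in lborel. t \<in> {0..y} \<longrightarrow> norm (\<bar>q t\<bar> * exp (M * t)) \<le> norm (exp (M * y) * q t)"
        proof (intro AE_I2 impI)
          fix t assume "t \<in> {0..y}"
          then have "exp (M * t) \<le> exp (M * y)"
            using M by simp
          then have "\<bar>q t\<bar> * exp (M * t) \<le> \<bar>q t\<bar> * exp (M * y)"
            by (rule mult_left_mono) simp
          then show "norm (\<bar>q t\<bar> * exp (M * t)) \<le> norm (exp (M * y) * q t)"
            by (simp add: abs_mult mult.commute)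
        qed
      qed
      have "(LINT \<eta>|lborel. f (\<xi>, \<eta>)) = (LINT t|lborel. g t)"
        unfolding f_g using lborel_integral_real_affine[of 1 g \<xi>] by simp
      also have "\<dots> \<le> (LINT t:{0..\<xi> + \<beta>}|lborel. \<bar>q t\<bar> * exp (M * t))"
        unfolding set_lebesgue_integral_def
      proof (rule integral_mono)
        have "set_integrable lborel {\<xi>..\<xi> + \<beta>} (\<lambda>t. \<bar>q t\<bar> * exp (M * t))"
          by (rule set_integrable_subset[OF si[of "\<xi> + \<beta>"]]) (use True in auto)
        then show "integrable lborel g"
          by (simp add: set_integrable_def g_def)
        show "integrable lborel (\<lambda>t. indicat_real {0..\<xi> + \<beta>} t *\<^sub>R (\<bar>q t\<bar> * exp (M * t)))"
          using si[of "\<xi> + \<beta>"] by (simp add: set_integrable_def)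
        show "g t \<le> indicat_real {0..\<xi> + \<beta>} t *\<^sub>R (\<bar>q t\<bar> * exp (M * t))" for t
          using True by (auto simp: g_def indicator_def)
      qed
      also have "\<dots> \<le> 1 / 2 * exp (M * (\<xi> + \<beta>))"
        by (rule M(2))
      also have "\<dots> \<le> 1 / 2 * exp (M * (\<xi> + \<bar>\<beta>\<bar>))"
        using M(1) by (intro mult_left_mono) (auto intro!: mult_left_mono)
      also have "\<dots> = indicator {0..\<alpha>} \<xi> * (exp (M * \<xi>) * (exp (M * \<bar>\<beta>\<bar>) / 2))"
        using True by (simp add: distrib_left exp_add)
      finally show ?thesis .
    next
      case False
      then have "f (\<xi>, \<eta>) = 0" for \<eta>
        by (auto simp: f_def triangle_kernel_eq indicator_def)
      then show ?thesis
        using False by simp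
    qed
    have outi: "set_integrable lborel {0..\<alpha>} (\<lambda>\<xi>. exp (M * \<xi>))"
      by (rule borel_integrable_atLeastAtMost') (intro continuous_intros)
    have "(LINT s|lborel. f s) = (LINT \<xi>|lborel. LINT \<eta>|lborel. f (\<xi>, \<eta>))"
      using lborel_pair.integral_fst'[OF fi'] by (simp add: lborel_prod)
    also have "\<dots> \<le> (LINT \<xi>|lborel. indicator {0..\<alpha>} \<xi> * (exp (M * \<xi>) * (exp (M * \<bar>\<beta>\<bar>) / 2)))"
    proof (rule integral_mono[OF _ _ inner])
      show "integrable lborel (\<lambda>\<xi>. LINT \<eta>|lborel. f (\<xi>, \<eta>))"
        by (rule lborel_pair.integrable_fst'[OF fi'])
      show "integrable lborel (\<lambda>\<xi>. indicator {0..\<alpha>} \<xi> * (exp (M * \<xi>) * (exp (M * \<bar>\<beta>\<bar>) / 2)))"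
        unfolding mult.assoc[symmetric] by (rule integrable_mult_left) (use outi in \<open>simp add: set_integrable_def\<close>)
    qed
    also have "\<dots> = (LINT \<xi>:{0..\<alpha>}|lborel. exp (M * \<xi>)) * (exp (M * \<bar>\<beta>\<bar>) / 2)"
      unfolding set_lebesgue_integral_def mult.assoc[symmetric] by simp
    also have "\<dots> \<le> exp (M * \<bar>\<alpha>\<bar>) * (exp (M * \<bar>\<beta>\<bar>) / 2)"
    proof (rule mult_right_mono)
      show "(LINT \<xi>:{0..\<alpha>}|lborel. exp (M * \<xi>)) \<le> exp (M * \<bar>\<alpha>\<bar>)"
      proof (cases "0 \<le> \<alpha>")
        case True
        have "(LINT \<xi>:{0..\<alpha>}|lborel. exp (M * \<xi>)) = (exp (M * \<alpha>) - 1) / M"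
          using integral_exp_Icc[of M 0 \<alpha>] M True by simp
        also have "\<dots> \<le> (exp (M * \<alpha>) - 1) / 1"
          using M True by (intro divide_left_mono) auto
        finally show ?thesis using True by simp
      qed (simp add: set_lebesgue_integral_def)
    qed simp
    also have "\<dots> = exp (M * (\<bar>\<alpha>\<bar> + \<bar>\<beta>\<bar>)) / 2"
      by (simp add: distrib_left exp_add)
    finally show ?thesis
      by (simp add: f_def)
  qed
  then show ?thesis
    using M(1) by blast
qed

lemma indicator_quadrant_measurable: "indicat_real ({..\<alpha>::real} \<times> {..\<beta>::real}) \<in> borel_measurable borel"
  by (intro borel_measurable_indicator borel_closed closed_Times) auto

lemma abs_integral_le_atMost:
  fixes q :: "real \<Rightarrow> real"
  assumes q: "integrable lborel q"
  shows "\<bar>(LINT t:{..x}|lborel. q t) - (LINT t:{..y}|lborel. q t)\<bar> \<le> (LINT t|lborel. \<bar>q t\<bar>)"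
proof -
  have i: "integrable lborel (\<lambda>t. indicat_real {..z} t *\<^sub>R q t)" for z
    by (rule integrable_mult_indicator) (use q in auto)
  have "(LINT t:{..x}|lborel. q t) - (LINT t:{..y}|lborel. q t) = (LINT t|lborel. indicat_real {..x} t *\<^sub>R q t - indicat_real {..y} t *\<^sub>R q t)"
    unfolding set_lebesgue_integral_def by (rule Bochner_Integration.integral_diff[symmetric, OF i i])
  also have "norm \<dots> \<le> (LINT t|lborel. norm (indicat_real {..x} t *\<^sub>R q t - indicat_real {..y} t *\<^sub>R q t))"
    by (rule integral_norm_bound)
  also have "\<dots> \<le> (LINT t|lborel. \<bar>q t\<bar>)"
  proof (rule integral_mono)
    show "integrable lborel (\<lambda>t. norm (indicat_real {..x} t *\<^sub>R q t - indicat_real {..y} t *\<^sub>R q t))"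
      by (intro integrable_norm Bochner_Integration.integrable_diff i)
    show "integrable lborel (\<lambda>t. \<bar>q t\<bar>)" using q by simp
    show "norm (indicat_real {..x} t *\<^sub>R q t - indicat_real {..y} t *\<^sub>R q t) \<le> \<bar>q t\<bar>" for t
      by (simp add: indicator_def)
  qed
  finally show ?thesis by simp
qed

text \<open>
  With the exponential weight the integral part of the map has norm one half. The invariant set
  asks for the bound \<open>C w\<close> with \<open>C\<close> the \<open>L\<^sup>1\<close> norm of \<open>q\<close>: half of it pays for the boundary terms.
\<close>
theorem goursat_solution_exists:
  assumes q: "integrable lborel q" and q0: "\<And>t. t \<notin> {0..1} \<Longrightarrow> q t = 0"
  shows "\<exists>a B. a \<in> borel_measurable borel \<and> (\<forall>p. a p = goursat_map q a p) \<and>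
     (\<forall>\<xi> \<eta>. 0 \<le> \<xi> \<longrightarrow> 0 \<le> \<eta> \<longrightarrow> \<xi> + \<eta> \<le> 1 \<longrightarrow> \<bar>a (\<xi>, \<eta>)\<bar> \<le> B)"
proof -
  have qm: "q \<in> borel_measurable borel"
    using q borel_measurable_integrable by auto
  obtain M where M: "M \<ge> 1" "\<And>\<alpha> \<beta>. (LINT s|lborel. \<bar>triangle_kernel q s\<bar> * (indicator ({..\<alpha>} \<times> {..\<beta>}) s * exp (M * (\<bar>fst s\<bar> + \<bar>snd s\<bar>))))
     \<le> exp (M * (\<bar>\<alpha>\<bar> + \<bar>\<beta>\<bar>)) / 2"
    using triangle_kernel_exp_weight[OF q q0] by blast
  define w where "w = (\<lambda>p::real \<times> real. exp (M * (\<bar>fst p\<bar> + \<bar>snd p\<bar>)))"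
  have w: "w p \<ge> 1" "w p \<ge> 0" for p
    using M(1) by (auto simp: w_def)
  have wm: "w \<in> borel_measurable borel"
    unfolding w_def by (intro borel_measurable_continuous_onI continuous_intros)
  define C where "C = (LINT t|lborel. \<bar>q t\<bar>)"
  have C: "C \<ge> 0" by (simp add: C_def)
  define P where "P = (\<lambda>a. a \<in> borel_measurable borel \<and> (\<forall>p. \<bar>a p\<bar> \<le> C * w p))"
  have PD: "b \<in> borel_measurable borel" "\<bar>b p\<bar> \<le> C * w p" if "P b" for b p
    using that unfolding P_def by blast+
  have wtri: "w (\<xi>, \<eta>) \<le> exp (2 * M)" if "0 \<le> \<xi>" "0 \<le> \<eta>" "\<xi> + \<eta> \<le> 1" for \<xi> \<eta>
  proof -
    have "M * (\<xi> + \<eta>) \<le> M * 2"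
      using M that by (intro mult_left_mono) auto
    then show ?thesis using that by (simp add: w_def mult.commute)
  qed
  have int: "integrable lborel (\<lambda>s. indicator ({..\<alpha>} \<times> {..\<beta>}) s * (triangle_kernel q s * b s))"
    if b: "b \<in> borel_measurable borel" "\<And>p. \<bar>b p\<bar> \<le> d * w p" "0 \<le> d" for b d \<alpha> \<beta>
  proof -
    have "integrable lborel (\<lambda>s. triangle_kernel q s *\<^sub>R (indicator ({..\<alpha>} \<times> {..\<beta>}) s * b s))"
    proof (rule integrable_triangle_kernel_scaleR[OF q q0, where B = "d * exp (2 * M)"])
      show "(\<lambda>s. indicator ({..\<alpha>} \<times> {..\<beta>}) s * b s) \<in> borel_measurable borel"
        by (rule borel_measurable_times[OF indicator_quadrant_measurable b(1)])
      fix \<xi> \<eta> :: real assume "0 \<le> \<xi>" "0 \<le> \<eta>" "\<xi> + \<eta> \<le> 1"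
      from wtri[OF this] have "d * w (\<xi>, \<eta>) \<le> d * exp (2 * M)"
        using b(3) by (rule mult_left_mono)
      then have "\<bar>b (\<xi>, \<eta>)\<bar> \<le> d * exp (2 * M)"
        using b(2)[of "(\<xi>, \<eta>)"] by linarith
      then show "norm (indicator ({..\<alpha>} \<times> {..\<beta>}) (\<xi>, \<eta>) * b (\<xi>, \<eta>)) \<le> d * exp (2 * M)"
        using b(3) by (auto simp: indicator_def abs_mult)
    qed auto
    then show ?thesis by (simp add: mult_ac)
  qed
  have bound: "\<bar>LINT s|lborel. indicator ({..\<alpha>} \<times> {..\<beta>}) s * (triangle_kernel q s * b s)\<bar> \<le> d * w (\<alpha>, \<beta>) / 2"
    if b: "b \<in> borel_measurable borel" "\<And>p. \<bar>b p\<bar> \<le> d * w p" "0 \<le> d" for b d \<alpha> \<beta>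
  proof -
    have "norm (LINT s|lborel. indicator ({..\<alpha>} \<times> {..\<beta>}) s * (triangle_kernel q s * b s))
        \<le> (LINT s|lborel. norm (indicat_real ({..\<alpha>} \<times> {..\<beta>}) s * (triangle_kernel q s * b s)))"
      by (rule integral_norm_bound)
    also have "\<dots> \<le> (LINT s|lborel. d * norm (indicat_real ({..\<alpha>} \<times> {..\<beta>}) s * (triangle_kernel q s * w s)))"
    proof (rule integral_mono)
      show "integrable lborel (\<lambda>s. norm (indicat_real ({..\<alpha>} \<times> {..\<beta>}) s * (triangle_kernel q s * b s)))"
        by (rule integrable_norm) (rule int[OF b])
      show "integrable lborel (\<lambda>s. d * norm (indicat_real ({..\<alpha>} \<times> {..\<beta>}) s * (triangle_kernel q s * w s)))"
        by (rule integrable_mult_right, rule integrable_norm, rule int[OF wm, of 1]) (use w in auto)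
      fix s
      have "(indicat_real ({..\<alpha>} \<times> {..\<beta>}) s * \<bar>triangle_kernel q s\<bar>) * \<bar>b s\<bar> \<le> (indicat_real ({..\<alpha>} \<times> {..\<beta>}) s * \<bar>triangle_kernel q s\<bar>) * (d * w s)"
        by (rule mult_left_mono[OF b(2)]) simp
      then show "norm (indicat_real ({..\<alpha>} \<times> {..\<beta>}) s * (triangle_kernel q s * b s)) \<le> d * norm (indicat_real ({..\<alpha>} \<times> {..\<beta>}) s * (triangle_kernel q s * w s))"
        using w(2)[of s] by (simp add: abs_mult mult_ac)
    qed
    also have "\<dots> = d * (LINT s|lborel. \<bar>triangle_kernel q s\<bar> * (indicator ({..\<alpha>} \<times> {..\<beta>}) s * exp (M * (\<bar>fst s\<bar> + \<bar>snd s\<bar>))))"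
      by (simp add: abs_mult mult_ac w_def)
    also have "\<dots> \<le> d * (w (\<alpha>, \<beta>) / 2)"
      using M(2)[of \<alpha> \<beta>] b(3) by (intro mult_left_mono) (auto simp: w_def)
    finally show ?thesis by simp
  qed
  have Pint: "integrable lborel (\<lambda>s. indicator ({..\<alpha>} \<times> {..\<beta>}) s * (triangle_kernel q s * b s))" if "P b" for b \<alpha> \<beta>
    by (rule int[where d = C]) (use that C in \<open>unfold P_def, blast+\<close>)
  have "\<exists>a. P a \<and> (\<forall>p. goursat_map q a p = a p)"
  proof (rule weighted_fixed_point[where P = P and w = w and c = "1/2" and ?d0.0 = "C / 2" and ?f0.0 = "\<lambda>_. 0"])
    show "P (\<lambda>_. 0)" using C w by (simp add: P_def)
    show "P (goursat_map q a)" if a: "P a" for a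
    proof -
      have "\<bar>goursat_map q a p\<bar> \<le> C * w p" for p
      proof -
        have "\<bar>LINT s|lborel. indicator ({..fst p} \<times> {..snd p}) s * (triangle_kernel q s * a s)\<bar> \<le> C * w p / 2"
          using bound[OF PD[OF a] C, of "fst p" "snd p"] by simp
        moreover have "\<bar>((LINT t:{..fst p}|lborel. q t) - (LINT t:{..snd p}|lborel. q t)) / 2\<bar> \<le> C / 2"
          using abs_integral_le_atMost[OF q, of "fst p" "snd p"] by (simp add: C_def)
        moreover have "C / 2 \<le> C * w p / 2"
          using mult_left_mono[OF w(1) C, of p] by simp
        ultimately show ?thesis
          unfolding goursat_map_def by linarith
      qed
      then show ?thesis
        using a borel_measurable_goursat_map[OF qm, of a] by (simp add: P_def)
    qed
    show "P f" if F: "\<And>n. P (F n)" "\<And>i. (\<lambda>n. F n i) \<longlonglongrightarrow> f i" for F f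
    proof -
      have "f \<in> borel_measurable borel"
        by (rule borel_measurable_LIMSEQ_real[OF F(2)]) (use F(1) in \<open>auto simp: P_def\<close>)
      moreover have "\<bar>f p\<bar> \<le> C * w p" for p
        by (rule tendsto_upperbound[OF tendsto_rabs[OF F(2)[of p]]]) (use PD(2)[OF F(1)] in auto)
      ultimately show ?thesis by (simp add: P_def)
    qed
    show "norm (goursat_map q f i - goursat_map q g i) \<le> 1 / 2 * d * w i"
      if fg: "P f" "P g" "0 \<le> d" "\<And>i. norm (f i - g i) \<le> d * w i" for f g d i
    proof -
      have "goursat_map q f i - goursat_map q g i = (LINT s|lborel. indicator ({..fst i} \<times> {..snd i}) s * (triangle_kernel q s * f s)) - (LINT s|lborel. indicator ({..fst i} \<times> {..snd i}) s * (triangle_kernel q s * g s))"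
        by (simp add: goursat_map_def)
      also have "\<dots> = (LINT s|lborel. indicator ({..fst i} \<times> {..snd i}) s * (triangle_kernel q s * (f s - g s)))"
        by (subst Bochner_Integration.integral_diff[symmetric, OF Pint[OF fg(1)] Pint[OF fg(2)]]) (simp add: algebra_simps)
      also have "\<bar>\<dots>\<bar> \<le> d * w (fst i, snd i) / 2"
        using fg by (intro bound) (auto simp: P_def)
      finally show ?thesis by simp
    qed
    show "norm (goursat_map q (\<lambda>_. 0) i - 0) \<le> C / 2 * w i" for i
    proof -
      have "\<bar>((LINT t:{..fst i}|lborel. q t) - (LINT t:{..snd i}|lborel. q t)) / 2\<bar> \<le> C / 2"
        using abs_integral_le_atMost[OF q, of "fst i" "snd i"] by (simp add: C_def)
      moreover have "C / 2 \<le> C / 2 * w i"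
        using mult_left_mono[OF w(1) C, of i] by simp
      ultimately show ?thesis
        by (simp add: goursat_map_def)
    qed
  qed (use C w in auto)
  then obtain a where a: "P a" "\<And>p. goursat_map q a p = a p" by blast
  have "\<bar>a (\<xi>, \<eta>)\<bar> \<le> C * exp (2 * M)" if "0 \<le> \<xi>" "0 \<le> \<eta>" "\<xi> + \<eta> \<le> 1" for \<xi> \<eta>
  proof -
    have "\<bar>a (\<xi>, \<eta>)\<bar> \<le> C * w (\<xi>, \<eta>)" using a(1) by (simp add: P_def)
    also have "\<dots> \<le> C * exp (2 * M)" using wtri[OF that] C by (rule mult_left_mono)
    finally show ?thesis .
  qed
  then show ?thesis
    using a unfolding P_def by (intro exI[of _ a] exI[of _ "C * exp (2 * M)"] conjI allI impI) simp_all
qed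

section \<open>The transformation operator\<close>
definition cos_quot :: "complex \<Rightarrow> real \<Rightarrow> complex" where
  "cos_quot r x = (if r = 0 then complex_of_real (x\<^sup>2 / 2) else (1 - cos (r * complex_of_real x)) / r\<^sup>2)"

lemma cos_quot_minus [simp]: "cos_quot r (- x) = cos_quot r x"
  by (simp add: cos_quot_def)

lemma cos_quot_0 [simp]: "cos_quot r 0 = 0"
  by (simp add: cos_quot_def)

lemma sin_quot_0 [simp]: "sin_quot r 0 = 0"
  by (simp add: sin_quot_def)

lemma sin_quot_minus_left [simp]: "sin_quot (- r) x = sin_quot r x"
  by (simp add: sin_quot_def)

lemma sin_quot_mult: "sin_quot r a * sin_quot r b = (cos_quot r (a + b) - cos_quot r (a - b)) / 2"
proof (cases "r = 0")
  case True
  have "a * b = ((a + b)\<^sup>2 / 2 - (a - b)\<^sup>2 / 2) / 2"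
    by (simp add: power2_eq_square field_simps)
  from arg_cong[OF this, of complex_of_real] show ?thesis
    unfolding sin_quot_def cos_quot_def
    by (simp only: True simp_thms if_True of_real_mult of_real_diff of_real_divide of_real_numeral)
next
  case False
  have "sin_quot r a * sin_quot r b = sin (r * complex_of_real a) * sin (r * complex_of_real b) / r\<^sup>2"
    using False by (simp add: sin_quot_def power2_eq_square)
  also have "sin (r * complex_of_real a) * sin (r * complex_of_real b) =
      (cos (r * complex_of_real (a - b)) - cos (r * complex_of_real (a + b))) / 2"
    by (simp add: sin_times_sin ring_distribs)
  also have "\<dots> / r\<^sup>2 = (cos_quot r (a + b) - cos_quot r (a - b)) / 2"
    using False by (simp add: cos_quot_def flip: diff_divide_distrib)
  finally show ?thesis .
qed

lemma cos_has_vector_derivative: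
  "((\<lambda>x. cos (r * complex_of_real x)) has_vector_derivative - (r\<^sup>2 * sin_quot r x)) (at x within A)"
proof -
  have "((\<lambda>x. cos (r * x)) has_field_derivative - (r\<^sup>2 * sin_quot r x)) (at (complex_of_real x))"
    by (auto intro!: derivative_eq_intros simp: sin_quot_def power2_eq_square)
  then show ?thesis
    by (rule has_vector_derivative_real_field)
qed

lemma sin_quot_has_vector_derivative:
  "(sin_quot r has_vector_derivative cos (r * complex_of_real x)) (at x within A)"
proof -
  have "((\<lambda>x. if r = 0 then x else sin (r * x) / r) has_field_derivative cos (r * complex_of_real x)) (at (complex_of_real x))"
    by (cases "r = 0") (auto intro!: derivative_eq_intros)
  then have "((\<lambda>x. if r = 0 then complex_of_real x else sin (r * complex_of_real x) / r) has_vector_derivative cos (r * complex_of_real x)) (at x within A)"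
    by (rule has_vector_derivative_real_field)
  then show ?thesis
    by (simp add: sin_quot_def[abs_def])
qed

lemma cos_quot_has_vector_derivative:
  "(cos_quot r has_vector_derivative sin_quot r x) (at x within A)"
proof -
  have "((\<lambda>x. if r = 0 then x\<^sup>2 / 2 else (1 - cos (r * x)) / r\<^sup>2) has_field_derivative sin_quot r x) (at (complex_of_real x))"
    by (cases "r = 0") (auto intro!: derivative_eq_intros simp: sin_quot_def power2_eq_square)
  then have "((\<lambda>x. if r = 0 then (complex_of_real x)\<^sup>2 / 2 else (1 - cos (r * complex_of_real x)) / r\<^sup>2) has_vector_derivative sin_quot r x) (at x within A)"
    by (rule has_vector_derivative_real_field)
  moreover have "cos_quot r = (\<lambda>x. if r = 0 then (complex_of_real x)\<^sup>2 / 2 else (1 - cos (r * complex_of_real x)) / r\<^sup>2)"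
    by (simp add: fun_eq_iff cos_quot_def)
  ultimately show ?thesis
    by simp
qed

lemma continuous_on_sin_quot: "continuous_on A (sin_quot r)"
  by (rule continuous_on_vector_derivative) (rule sin_quot_has_vector_derivative)

lemma continuous_on_cos_quot: "continuous_on A (cos_quot r)"
  by (rule continuous_on_vector_derivative) (rule cos_quot_has_vector_derivative)

lemma borel_measurable_sin_quot [measurable]: "sin_quot r \<in> borel_measurable borel"
  by (rule borel_measurable_continuous_onI) (rule continuous_on_sin_quot)

lemma borel_measurable_cos_quot [measurable]: "cos_quot r \<in> borel_measurable borel"
  by (rule borel_measurable_continuous_onI) (rule continuous_on_cos_quot)

lemma continuous_bounded_Icc:
  fixes f :: "real \<Rightarrow> 'a::real_normed_vector"
  assumes "continuous_on UNIV f"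
  shows "\<exists>B\<ge>0. \<forall>x\<in>{a..b}. norm (f x) \<le> B"
proof -
  have "compact (f ` {a..b})"
    by (rule compact_continuous_image[OF continuous_on_subset[OF assms]]) auto
  then obtain B where "B > 0" "\<forall>y\<in>f ` {a..b}. norm y \<le> B"
    using compact_imp_bounded bounded_pos by blast
  then show ?thesis
    by (intro exI[of _ B]) auto
qed

lemma sin_quot_bounded: "\<exists>B\<ge>0. \<forall>x\<in>{-2..2}. norm (sin_quot r x) \<le> B"
  by (rule continuous_bounded_Icc) (rule continuous_on_sin_quot)

lemma integrable_sin_quot_affine:
  "integrable lborel (\<lambda>\<gamma>. indicat_real {u..v} \<gamma> *\<^sub>R sin_quot r (2 * \<gamma> - x))"
proof -
  have "continuous_on {u..v} (\<lambda>\<gamma>. sin_quot r (2 * \<gamma> - x))"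
    by (rule continuous_on_compose2[OF continuous_on_sin_quot[of UNIV]]) (auto intro!: continuous_intros)
  then show ?thesis
    using borel_integrable_atLeastAtMost' by (auto simp: set_integrable_def)
qed

lemma integral_sin_quot_affine:
  assumes "u \<le> v"
  shows "(LINT \<gamma>:{u..v}|lborel. sin_quot r (2 * \<gamma> - x)) = (cos_quot r (2 * v - x) - cos_quot r (2 * u - x)) / 2"
proof -
  have "(LINT \<gamma>|lborel. indicator {u..v} \<gamma> *\<^sub>R sin_quot r (2 * \<gamma> - x)) = cos_quot r (2 * v - x) / 2 - cos_quot r (2 * u - x) / 2"
  proof (rule integral_FTC_Icc[OF assms])
    fix y
    have "((\<lambda>y. 2 * y - x) has_vector_derivative 2) (at y within {u..v})"
      by (auto intro!: derivative_eq_intros simp: has_real_derivative_iff_has_vector_derivative[symmetric])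
    from vector_diff_chain_within[OF this cos_quot_has_vector_derivative]
    have "((\<lambda>y. cos_quot r (2 * y - x)) has_vector_derivative 2 *\<^sub>R sin_quot r (2 * y - x)) (at y within {u..v})"
      by (simp add: o_def)
    from has_vector_derivative_divide[OF this, of 2]
    show "((\<lambda>y. cos_quot r (2 * y - x) / 2) has_vector_derivative sin_quot r (2 * y - x)) (at y within {u..v})"
      by (simp add: scaleR_conv_of_real)
  next
    show "continuous_on {u..v} (\<lambda>y. sin_quot r (2 * y - x))"
      by (rule continuous_on_compose2[OF continuous_on_sin_quot[of UNIV]]) (auto intro!: continuous_intros)
  qed
  then show ?thesis
    by (simp add: set_lebesgue_integral_def diff_divide_distrib)
qed

text \<open>
  The kernel enters only through its integral equation and a bound on the triangle, so that it may
  come either from \<open>goursat_solution_exists\<close> or from the fixed point that also constructs the potential.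
\<close>
locale goursat_kernel =
  fixes q :: "real \<Rightarrow> real" and a :: "real \<times> real \<Rightarrow> real" and B :: real
  assumes q_int: "integrable lborel q" and q_supp: "\<And>t. t \<notin> {0..1} \<Longrightarrow> q t = 0"
    and a_meas [measurable]: "a \<in> borel_measurable borel"
    and a_eq: "\<And>p. a p = goursat_map q a p"
    and a_bound: "\<And>\<xi> \<eta>. 0 \<le> \<xi> \<Longrightarrow> 0 \<le> \<eta> \<Longrightarrow> \<xi> + \<eta> \<le> 1 \<Longrightarrow> \<bar>a (\<xi>, \<eta>)\<bar> \<le> B"
begin

lemma q_meas [measurable]: "q \<in> borel_measurable borel"
  using q_int borel_measurable_integrable by auto

lemma B_nonneg: "0 \<le> B"
  using a_bound[of 0 0] by simp

lemma a_meas_pair [measurable]: "a \<in> borel_measurable (borel \<Otimes>\<^sub>M borel)"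
  using a_meas by (simp add: borel_prod)

text \<open>
  In the usual notation this is the integral of \<open>K(x, t) sin_quot r t\<close> over \<open>[- x, x]\<close>, where
  \<open>t = 2 \<alpha> - x\<close> and \<open>a (\<alpha>, x - \<alpha>)\<close> is the kernel in characteristic coordinates.
\<close>
definition kernel_term :: "complex \<Rightarrow> real \<Rightarrow> complex" where
  "kernel_term r x = (LINT \<alpha>:{0..x}|lborel. a (\<alpha>, x - \<alpha>) *\<^sub>R sin_quot r (2 * \<alpha> - x))"

definition S :: "complex \<Rightarrow> real \<Rightarrow> complex" where
  "S r x = sin_quot r x + kernel_term r x"

text \<open>
  Substituting \<open>t = \<xi> + \<eta>\<close> with \<open>\<xi> = \<alpha>\<close> makes a double integral over the triangle out of the iterated one.
\<close>
lemma kernel_swap: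
  assumes \<phi>: "continuous_on UNIV \<phi>" and x: "x \<in> {0..1}"
  shows "(LINT t:{0..x}|lborel. q t *\<^sub>R (\<phi> t * (LINT \<alpha>:{0..t}|lborel. a (\<alpha>, t - \<alpha>) *\<^sub>R sin_quot r (2 * \<alpha> - t)))) =
    (LINT s|lborel. triangle_kernel q s *\<^sub>R (indicat_real {..x} (fst s + snd s) *\<^sub>R (a s *\<^sub>R (\<phi> (fst s + snd s) * sin_quot r (fst s - snd s)))))"
proof -
  have \<phi>m [measurable]: "\<phi> \<in> borel_measurable borel"
    by (rule borel_measurable_continuous_onI[OF \<phi>])
  obtain B1 where B1: "B1 \<ge> 0" "\<And>t. t \<in> {0..1} \<Longrightarrow> norm (\<phi> t) \<le> B1"
    using continuous_bounded_Icc[OF \<phi>, of 0 1] by blast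
  obtain B2 where B2: "B2 \<ge> 0" "\<And>t. t \<in> {-2..2} \<Longrightarrow> norm (sin_quot r t) \<le> B2"
    using sin_quot_bounded by blast
  define G where "G = (\<lambda>t \<alpha>. (indicat_real {0..x} t * indicat_real {0..t} \<alpha> * q t * a (\<alpha>, t - \<alpha>)) *\<^sub>R (\<phi> t * sin_quot r (2 * \<alpha> - t)))"
  define H where "H = (\<lambda>s. triangle_kernel q s *\<^sub>R (indicat_real {..x} (fst s + snd s) *\<^sub>R (a s *\<^sub>R (\<phi> (fst s + snd s) * sin_quot r (fst s - snd s)))))"
  have Gm: "(\<lambda>(t, \<alpha>). G t \<alpha>) \<in> borel_measurable (lborel \<Otimes>\<^sub>M lborel)"
  proof -
    have *: "(\<lambda>(t, \<alpha>). G t \<alpha>) = (\<lambda>p. (indicat_real {0..x} (fst p) * indicat_real {p. 0 \<le> snd p \<and> snd p \<le> fst p} p * q (fst p) * a (snd p, fst p - snd p)) *\<^sub>R (\<phi> (fst p) * sin_quot r (2 * snd p - fst p)))"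
      by (auto simp: G_def indicator_def fun_eq_iff)
    show ?thesis unfolding * by measurable
  qed
  have G_bound: "norm (G t \<alpha>) \<le> B * B1 * B2 * (\<bar>q t\<bar> * indicat_real {0..1} \<alpha>)" for t \<alpha>
  proof (cases "t \<in> {0..x} \<and> \<alpha> \<in> {0..t}")
    case True
    then have 1: "\<bar>a (\<alpha>, t - \<alpha>)\<bar> \<le> B" "norm (\<phi> t) \<le> B1" "norm (sin_quot r (2 * \<alpha> - t)) \<le> B2"
      using a_bound[of \<alpha> "t - \<alpha>"] B1(2)[of t] B2(2)[of "2 * \<alpha> - t"] x by auto
    then have "\<bar>a (\<alpha>, t - \<alpha>)\<bar> * (norm (\<phi> t) * norm (sin_quot r (2 * \<alpha> - t))) \<le> B * (B1 * B2)"
      using B_nonneg B1(1) B2(1) by (intro mult_mono) auto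
    then have "\<bar>q t\<bar> * (\<bar>a (\<alpha>, t - \<alpha>)\<bar> * (norm (\<phi> t) * norm (sin_quot r (2 * \<alpha> - t)))) \<le> \<bar>q t\<bar> * (B * (B1 * B2))"
      by (rule mult_left_mono) simp
    then show ?thesis
      using True x by (simp add: G_def abs_mult norm_mult mult_ac)
  next
    case False
    then have "G t \<alpha> = 0" by (auto simp: G_def indicator_def)
    then show ?thesis using B_nonneg B1(1) B2(1) by (simp add: indicator_def)
  qed
  have Gi: "integrable (lborel \<Otimes>\<^sub>M lborel) (\<lambda>(t, \<alpha>). G t \<alpha>)"
  proof (rule Bochner_Integration.integrable_bound)
    have "integrable lborel (\<lambda>t. \<bar>q t\<bar>)" "integrable lborel (indicat_real {0..1::real})"
      using q_int by auto
    from integrable_product_lborel[OF this]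
    show "integrable (lborel \<Otimes>\<^sub>M lborel) (\<lambda>p :: real \<times> real. B * B1 * B2 * (\<bar>q (fst p)\<bar> * indicat_real {0..1} (snd p)))"
      by (simp add: lborel_prod)
    show "AE p in lborel \<Otimes>\<^sub>M lborel. norm (case p of (t, \<alpha>) \<Rightarrow> G t \<alpha>) \<le> norm (B * B1 * B2 * (\<bar>q (fst p)\<bar> * indicat_real {0..1} (snd p)))"
    proof (rule AE_I2)
      fix p :: "real \<times> real"
      show "norm (case p of (t, \<alpha>) \<Rightarrow> G t \<alpha>) \<le> norm (B * B1 * B2 * (\<bar>q (fst p)\<bar> * indicat_real {0..1} (snd p)))"
        using G_bound[of "fst p" "snd p"] abs_ge_self order_trans unfolding case_prod_unfold real_norm_def by blast
    qed
  qed (rule Gm)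
  have Hm: "H \<in> borel_measurable borel"
  proof -
    have "H \<in> borel_measurable (borel \<Otimes>\<^sub>M borel)"
    proof -
      have [measurable]: "triangle_kernel q \<in> borel_measurable (borel \<Otimes>\<^sub>M borel)"
        using borel_measurable_triangle_kernel[OF q_meas] by (simp add: borel_prod)
      show ?thesis unfolding H_def by measurable
    qed
    then show ?thesis by (simp add: borel_prod)
  qed
  have Hi: "integrable lborel H"
    unfolding H_def
  proof (rule integrable_triangle_kernel_scaleR[OF q_int q_supp, where B = "B * (B1 * B2)"])
    show "(\<lambda>s. indicat_real {..x} (fst s + snd s) *\<^sub>R (a s *\<^sub>R (\<phi> (fst s + snd s) * sin_quot r (fst s - snd s)))) \<in> borel_measurable borel"
      unfolding borel_prod[symmetric] by measurable
    fix \<xi> \<eta> :: real assume \<xi>\<eta>: "0 \<le> \<xi>" "0 \<le> \<eta>" "\<xi> + \<eta> \<le> 1"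
    have "\<bar>a (\<xi>, \<eta>)\<bar> * (norm (\<phi> (\<xi> + \<eta>)) * norm (sin_quot r (\<xi> - \<eta>))) \<le> B * (B1 * B2)"
      using a_bound[OF \<xi>\<eta>] B1(2)[of "\<xi> + \<eta>"] B2(2)[of "\<xi> - \<eta>"] \<xi>\<eta> B_nonneg B1(1) B2(1) by (intro mult_mono) auto
    then show "norm (indicat_real {..x} (fst (\<xi>, \<eta>) + snd (\<xi>, \<eta>)) *\<^sub>R (a (\<xi>, \<eta>) *\<^sub>R (\<phi> (fst (\<xi>, \<eta>) + snd (\<xi>, \<eta>)) * sin_quot r (fst (\<xi>, \<eta>) - snd (\<xi>, \<eta>))))) \<le> B * (B1 * B2)"
      using B_nonneg B1(1) B2(1) by (auto simp: norm_mult indicator_def)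
  qed auto
  have GH: "G (\<alpha> + 1 * \<beta>) \<alpha> = H (\<alpha>, \<beta>)" for \<alpha> \<beta>
    using x by (auto simp: G_def H_def triangle_kernel_eq indicator_def)
  have "(LINT t:{0..x}|lborel. q t *\<^sub>R (\<phi> t * (LINT \<alpha>:{0..t}|lborel. a (\<alpha>, t - \<alpha>) *\<^sub>R sin_quot r (2 * \<alpha> - t)))) = (LINT t|lborel. LINT \<alpha>|lborel. G t \<alpha>)"
  proof -
    have "(LINT \<alpha>|lborel. G t \<alpha>) = indicat_real {0..x} t *\<^sub>R (q t *\<^sub>R (\<phi> t * (LINT \<alpha>:{0..t}|lborel. a (\<alpha>, t - \<alpha>) *\<^sub>R sin_quot r (2 * \<alpha> - t))))" for t
    proof -
      have "(LINT \<alpha>|lborel. G t \<alpha>) = (LINT \<alpha>|lborel. ((indicat_real {0..x} t * q t) *\<^sub>R \<phi> t) * (indicat_real {0..t} \<alpha> *\<^sub>R (a (\<alpha>, t - \<alpha>) *\<^sub>R sin_quot r (2 * \<alpha> - t))))"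
        by (rule Bochner_Integration.integral_cong) (auto simp: G_def scaleR_conv_of_real mult_ac)
      also have "\<dots> = ((indicat_real {0..x} t * q t) *\<^sub>R \<phi> t) * (LINT \<alpha>:{0..t}|lborel. a (\<alpha>, t - \<alpha>) *\<^sub>R sin_quot r (2 * \<alpha> - t))"
        unfolding set_lebesgue_integral_def by (rule integral_mult_right_zero)
      finally show ?thesis by (simp add: scaleR_conv_of_real mult_ac)
    qed
    then show ?thesis
      unfolding set_lebesgue_integral_def by simp
  qed
  also have "\<dots> = (LINT \<alpha>|lborel. LINT t|lborel. G t \<alpha>)"
    by (rule lborel_pair.Fubini_integral[OF Gi, symmetric])
  also have "\<dots> = (LINT \<alpha>|lborel. LINT \<beta>|lborel. H (\<alpha>, \<beta>))"
  proof (rule Bochner_Integration.integral_cong[OF refl])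
    fix \<alpha>
    have "(LINT t|lborel. G t \<alpha>) = (LINT \<beta>|lborel. G (\<alpha> + 1 * \<beta>) \<alpha>)"
      using lborel_integral_real_affine[of 1 "\<lambda>t. G t \<alpha>" \<alpha>] by simp
    then show "(LINT t|lborel. G t \<alpha>) = (LINT \<beta>|lborel. H (\<alpha>, \<beta>))"
      unfolding GH .
  qed
  also have "\<dots> = (LINT s|lborel. H s)"
    using lborel_pair.integral_fst'[of H] Hi by (simp add: lborel_prod)
  finally show ?thesis
    by (simp add: H_def)
qed

text \<open>
  Fubini: for fixed \<open>s\<close> in the triangle, \<open>\<gamma>\<close> runs from \<open>fst s\<close> to \<open>x - snd s\<close>, and \<open>cos_quot r\<close> is an
  antiderivative of \<open>sin_quot r\<close>.
\<close>
lemma kernel_part: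
  assumes x: "x \<in> {0..1}"
  shows "(LINT \<gamma>:{0..x}|lborel. (LINT s|lborel. indicator ({..\<gamma>} \<times> {..x - \<gamma>}) s * (triangle_kernel q s * a s)) *\<^sub>R sin_quot r (2 * \<gamma> - x)) =
    (LINT s|lborel. triangle_kernel q s *\<^sub>R (indicat_real {..x} (fst s + snd s) *\<^sub>R (a s *\<^sub>R ((cos_quot r (x - 2 * snd s) - cos_quot r (2 * fst s - x)) / 2))))"
proof -
  obtain B2 where B2: "B2 \<ge> 0" "\<And>t. t \<in> {-2..2} \<Longrightarrow> norm (sin_quot r t) \<le> B2"
    using sin_quot_bounded by blast
  define J where "J = (\<lambda>\<gamma> s. (indicat_real {0..x} \<gamma> * indicat_real ({..\<gamma>} \<times> {..x - \<gamma>}) s * (triangle_kernel q s * a s)) *\<^sub>R sin_quot r (2 * \<gamma> - x))"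
  define U where "U = {p :: real \<times> real \<times> real. fst (snd p) \<le> fst p \<and> snd (snd p) \<le> x - fst p}"
  have "closed U"
    unfolding U_def by (intro closed_Collect_conj closed_Collect_le continuous_on_fst continuous_on_snd continuous_on_diff continuous_on_const continuous_on_id)
  then have "U \<in> sets ((borel :: real measure) \<Otimes>\<^sub>M (borel :: (real \<times> real) measure))"
    unfolding borel_prod by (rule borel_closed)
  then have Um [measurable]: "U \<in> sets ((lborel :: real measure) \<Otimes>\<^sub>M (lborel :: (real \<times> real) measure))"
    by (simp add: sets_pair_measure_cong[OF sets_lborel sets_lborel])
  have Jm: "(\<lambda>(\<gamma>, s). J \<gamma> s) \<in> borel_measurable (lborel \<Otimes>\<^sub>M lborel)"
  proof -
    have *: "(\<lambda>(\<gamma>, s). J \<gamma> s) = (\<lambda>p. (indicat_real {0..x} (fst p) * indicat_real U p * (triangle_kernel q (snd p) * a (snd p))) *\<^sub>R sin_quot r (2 * fst p - x))"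
      by (auto simp: J_def U_def indicator_def fun_eq_iff)
    show ?thesis unfolding * by measurable
  qed
  have J_bound: "norm (J \<gamma> s) \<le> B * B2 * (indicat_real {0..1} \<gamma> * \<bar>triangle_kernel q s\<bar>)" for \<gamma> s
  proof (cases "\<gamma> \<in> {0..x} \<and> triangle_kernel q s \<noteq> 0")
    case True
    from triangle_kernel_nonzeroD[OF conjunct2[OF True] q_supp] have "\<bar>a s\<bar> \<le> B"
      using a_bound[of "fst s" "snd s"] by simp
    moreover have "norm (sin_quot r (2 * \<gamma> - x)) \<le> B2"
      using B2(2)[of "2 * \<gamma> - x"] True x by auto
    ultimately have "\<bar>a s\<bar> * norm (sin_quot r (2 * \<gamma> - x)) \<le> B * B2"
      using B_nonneg B2(1) by (intro mult_mono) auto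
    then have *: "\<bar>triangle_kernel q s\<bar> * (\<bar>a s\<bar> * norm (sin_quot r (2 * \<gamma> - x))) \<le> \<bar>triangle_kernel q s\<bar> * (B * B2)"
      by (rule mult_left_mono) simp
    have "norm (J \<gamma> s) \<le> \<bar>triangle_kernel q s\<bar> * (\<bar>a s\<bar> * norm (sin_quot r (2 * \<gamma> - x)))"
      by (auto simp: J_def abs_mult indicator_def)
    also note *
    finally show ?thesis
      using True x by (simp add: mult_ac)
  next
    case False
    then have "J \<gamma> s = 0" by (auto simp: J_def indicator_def)
    then show ?thesis using B_nonneg B2(1) by (simp add: indicator_def)
  qed
  have Ji: "integrable (lborel \<Otimes>\<^sub>M lborel) (\<lambda>(\<gamma>, s). J \<gamma> s)"
  proof (rule Bochner_Integration.integrable_bound)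
    have "integrable lborel (indicat_real {0..1::real})" "integrable lborel (\<lambda>s. \<bar>triangle_kernel q s\<bar>)"
      using integrable_triangle_kernel(1)[OF q_int q_supp] by auto
    from integrable_product_lborel[OF this]
    show "integrable (lborel \<Otimes>\<^sub>M lborel) (\<lambda>p :: real \<times> real \<times> real. B * B2 * (indicat_real {0..1} (fst p) * \<bar>triangle_kernel q (snd p)\<bar>))"
      by (simp add: lborel_prod)
    show "AE p in lborel \<Otimes>\<^sub>M lborel. norm (case p of (\<gamma>, s) \<Rightarrow> J \<gamma> s) \<le> norm (B * B2 * (indicat_real {0..1} (fst p) * \<bar>triangle_kernel q (snd p)\<bar>))"
    proof (rule AE_I2)
      fix p :: "real \<times> real \<times> real"
      show "norm (case p of (\<gamma>, s) \<Rightarrow> J \<gamma> s) \<le> norm (B * B2 * (indicat_real {0..1} (fst p) * \<bar>triangle_kernel q (snd p)\<bar>))"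
        using J_bound[of "fst p" "snd p"] abs_ge_self order_trans unfolding case_prod_unfold real_norm_def by blast
    qed
  qed (rule Jm)
  have "(LINT \<gamma>:{0..x}|lborel. (LINT s|lborel. indicator ({..\<gamma>} \<times> {..x - \<gamma>}) s * (triangle_kernel q s * a s)) *\<^sub>R sin_quot r (2 * \<gamma> - x)) = (LINT \<gamma>|lborel. LINT s|lborel. J \<gamma> s)"
    unfolding set_lebesgue_integral_def
  proof (rule Bochner_Integration.integral_cong[OF refl])
    fix \<gamma>
    have "(LINT s|lborel. J \<gamma> s) = (LINT s|lborel. indicat_real {0..x} \<gamma> * (indicat_real ({..\<gamma>} \<times> {..x - \<gamma>}) s * (triangle_kernel q s * a s))) *\<^sub>R sin_quot r (2 * \<gamma> - x)"
      unfolding J_def mult.assoc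
    proof (rule integral_scaleR_left)
      show "integrable lborel (\<lambda>s. indicat_real {0..x} \<gamma> * (indicat_real ({..\<gamma>} \<times> {..x - \<gamma>}) s * (triangle_kernel q s * a s)))"
      proof -
        have "integrable lborel (\<lambda>s. triangle_kernel q s *\<^sub>R (indicat_real ({..\<gamma>} \<times> {..x - \<gamma>}) s * a s))"
          by (rule integrable_triangle_kernel_scaleR[OF q_int q_supp borel_measurable_times[OF indicator_quadrant_measurable a_meas], where B = B])
             (use a_bound B_nonneg in \<open>auto simp: indicator_def\<close>)
        then have "integrable lborel (\<lambda>s. indicat_real ({..\<gamma>} \<times> {..x - \<gamma>}) s * (triangle_kernel q s * a s))"
          by (simp add: mult_ac)
        then show ?thesis by (rule integrable_mult_right)
      qed
    qed
    then show "indicat_real {0..x} \<gamma> *\<^sub>R ((LINT s|lborel. indicator ({..\<gamma>} \<times> {..x - \<gamma>}) s * (triangle_kernel q s * a s)) *\<^sub>R sin_quot r (2 * \<gamma> - x)) = (LINT s|lborel. J \<gamma> s)"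
      by simp
  qed
  also have "\<dots> = (LINT s|lborel. LINT \<gamma>|lborel. J \<gamma> s)"
    by (rule lborel_pair.Fubini_integral[OF Ji, symmetric])
  also have "\<dots> = (LINT s|lborel. triangle_kernel q s *\<^sub>R (indicat_real {..x} (fst s + snd s) *\<^sub>R (a s *\<^sub>R ((cos_quot r (x - 2 * snd s) - cos_quot r (2 * fst s - x)) / 2))))"
  proof (rule Bochner_Integration.integral_cong[OF refl])
    fix s :: "real \<times> real"
    show "(LINT \<gamma>|lborel. J \<gamma> s) = triangle_kernel q s *\<^sub>R (indicat_real {..x} (fst s + snd s) *\<^sub>R (a s *\<^sub>R ((cos_quot r (x - 2 * snd s) - cos_quot r (2 * fst s - x)) / 2)))"
    proof (cases "triangle_kernel q s = 0")
      case False
      from triangle_kernel_nonzeroD[OF this q_supp] have s: "0 \<le> fst s" "0 \<le> snd s" by auto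
      have "J \<gamma> s = (triangle_kernel q s * a s) *\<^sub>R (indicat_real {fst s..x - snd s} \<gamma> *\<^sub>R sin_quot r (2 * \<gamma> - x))" for \<gamma>
        using s by (cases s) (auto simp: J_def indicator_def)
      then have "(LINT \<gamma>|lborel. J \<gamma> s) = (triangle_kernel q s * a s) *\<^sub>R (LINT \<gamma>:{fst s..x - snd s}|lborel. sin_quot r (2 * \<gamma> - x))"
        unfolding set_lebesgue_integral_def using integrable_sin_quot_affine[of "fst s" "x - snd s" r x] by (simp only: integral_scaleR_right)
      also have "(LINT \<gamma>:{fst s..x - snd s}|lborel. sin_quot r (2 * \<gamma> - x)) = indicat_real {..x} (fst s + snd s) *\<^sub>R ((cos_quot r (x - 2 * snd s) - cos_quot r (2 * fst s - x)) / 2)"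
      proof (cases "fst s \<le> x - snd s")
        case True
        then show ?thesis
          using integral_sin_quot_affine[OF True, of r x] by (simp add: algebra_simps)
      next
        case False
        then have "\<not> (fst s + snd s \<le> x)" by simp
        with False show ?thesis by (simp add: set_lebesgue_integral_def)
      qed
      finally show ?thesis by (simp add: mult_ac)
    qed (simp add: J_def)
  qed
  finally show ?thesis .
qed

text \<open>
  Fubini again, for the boundary terms of the Goursat map.
\<close>
lemma potential_part:
  assumes x: "x \<in> {0..1}"
  shows "(LINT \<gamma>:{0..x}|lborel. (((LINT t:{..\<gamma>}|lborel. q t) - (LINT t:{..x - \<gamma>}|lborel. q t)) / 2) *\<^sub>R sin_quot r (2 * \<gamma> - x)) =
    (LINT t:{0..x}|lborel. q t *\<^sub>R ((cos_quot r x - cos_quot r (x - 2 * t)) / 2))"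
proof -
  obtain B2 where B2: "B2 \<ge> 0" "\<And>t. t \<in> {-2..2} \<Longrightarrow> norm (sin_quot r t) \<le> B2"
    using sin_quot_bounded by blast
  define J where "J = (\<lambda>\<gamma> t. (indicat_real {0..x} \<gamma> * ((indicat_real {..\<gamma>} t - indicat_real {..x - \<gamma>} t) * q t / 2)) *\<^sub>R sin_quot r (2 * \<gamma> - x))"
  have Jm: "(\<lambda>(\<gamma>, t). J \<gamma> t) \<in> borel_measurable (lborel \<Otimes>\<^sub>M lborel)"
  proof -
    have *: "(\<lambda>(\<gamma>, t). J \<gamma> t) = (\<lambda>p. (indicat_real {0..x} (fst p) * ((indicat_real {p. snd p \<le> fst p} p - indicat_real {p. snd p \<le> x - fst p} p) * q (snd p) / 2)) *\<^sub>R sin_quot r (2 * fst p - x))"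
      by (auto simp: J_def indicator_def fun_eq_iff)
    show ?thesis unfolding * by measurable
  qed
  have J_bound: "norm (J \<gamma> t) \<le> B2 * (indicat_real {0..1} \<gamma> * \<bar>q t\<bar>)" for \<gamma> t
  proof (cases "\<gamma> \<in> {0..x}")
    case True
    have "norm (sin_quot r (2 * \<gamma> - x)) \<le> B2"
      using B2(2)[of "2 * \<gamma> - x"] True x by auto
    then have *: "\<bar>q t\<bar> * norm (sin_quot r (2 * \<gamma> - x)) \<le> \<bar>q t\<bar> * B2"
      by (rule mult_left_mono) simp
    have "norm (J \<gamma> t) \<le> \<bar>q t\<bar> * norm (sin_quot r (2 * \<gamma> - x))"
    proof -
      have "\<bar>indicat_real {0..x} \<gamma> * ((indicat_real {..\<gamma>} t - indicat_real {..x - \<gamma>} t) * q t / 2)\<bar> \<le> \<bar>q t\<bar>"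
        by (auto simp: indicator_def)
      then show ?thesis unfolding J_def norm_scaleR by (rule mult_right_mono) simp
    qed
    also note *
    finally show ?thesis using True x by (simp add: mult_ac)
  next
    case False
    then have "J \<gamma> t = 0" by (auto simp: J_def)
    then show ?thesis using B2(1) by simp
  qed
  have Ji: "integrable (lborel \<Otimes>\<^sub>M lborel) (\<lambda>(\<gamma>, t). J \<gamma> t)"
  proof (rule Bochner_Integration.integrable_bound)
    have "integrable lborel (indicat_real {0..1::real})" "integrable lborel (\<lambda>s. \<bar>q s\<bar>)"
      using q_int by auto
    from integrable_product_lborel[OF this]
    show "integrable (lborel \<Otimes>\<^sub>M lborel) (\<lambda>p :: real \<times> real. B2 * (indicat_real {0..1} (fst p) * \<bar>q (snd p)\<bar>))"
      by (simp add: lborel_prod)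
    show "AE p in lborel \<Otimes>\<^sub>M lborel. norm (case p of (\<gamma>, s) \<Rightarrow> J \<gamma> s) \<le> norm (B2 * (indicat_real {0..1} (fst p) * \<bar>q (snd p)\<bar>))"
    proof (rule AE_I2)
      fix p :: "real \<times> real"
      show "norm (case p of (\<gamma>, s) \<Rightarrow> J \<gamma> s) \<le> norm (B2 * (indicat_real {0..1} (fst p) * \<bar>q (snd p)\<bar>))"
        using J_bound[of "fst p" "snd p"] abs_ge_self order_trans unfolding case_prod_unfold real_norm_def by blast
    qed
  qed (rule Jm)
  have qi: "integrable lborel (\<lambda>t. indicat_real {..y} t * q t)" for y
    using integrable_mult_indicator[OF _ q_int, of "{..y}"] by simp
  have "(LINT \<gamma>:{0..x}|lborel. (((LINT t:{..\<gamma>}|lborel. q t) - (LINT t:{..x - \<gamma>}|lborel. q t)) / 2) *\<^sub>R sin_quot r (2 * \<gamma> - x)) = (LINT \<gamma>|lborel. LINT t|lborel. J \<gamma> t)"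
    unfolding set_lebesgue_integral_def
  proof (rule Bochner_Integration.integral_cong[OF refl])
    fix \<gamma>
    have i: "integrable lborel (\<lambda>t. (indicat_real {..\<gamma>} t - indicat_real {..x - \<gamma>} t) * q t / 2)"
      using Bochner_Integration.integrable_diff[OF qi[of \<gamma>] qi[of "x - \<gamma>"]] by (intro integrable_divide) (simp add: left_diff_distrib)
    have "(LINT t|lborel. J \<gamma> t) = (LINT t|lborel. indicat_real {0..x} \<gamma> * ((indicat_real {..\<gamma>} t - indicat_real {..x - \<gamma>} t) * q t / 2)) *\<^sub>R sin_quot r (2 * \<gamma> - x)"
      unfolding J_def by (rule integral_scaleR_left) (rule integrable_mult_right[OF i])
    also have "(LINT t|lborel. indicat_real {0..x} \<gamma> * ((indicat_real {..\<gamma>} t - indicat_real {..x - \<gamma>} t) * q t / 2)) = indicat_real {0..x} \<gamma> * ((LINT t|lborel. (indicat_real {..\<gamma>} t - indicat_real {..x - \<gamma>} t) * q t) / 2)"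
      by simp
    also have "(LINT t|lborel. (indicat_real {..\<gamma>} t - indicat_real {..x - \<gamma>} t) * q t) = (LINT t|lborel. indicat_real {..\<gamma>} t * q t) - (LINT t|lborel. indicat_real {..x - \<gamma>} t * q t)"
      unfolding left_diff_distrib by (rule Bochner_Integration.integral_diff[OF qi qi])
    finally show "indicat_real {0..x} \<gamma> *\<^sub>R ((((LINT t|lborel. indicat_real {..\<gamma>} t *\<^sub>R q t) - (LINT t|lborel. indicat_real {..x - \<gamma>} t *\<^sub>R q t)) / 2) *\<^sub>R sin_quot r (2 * \<gamma> - x)) = (LINT t|lborel. J \<gamma> t)"
      by simp
  qed
  also have "\<dots> = (LINT t|lborel. LINT \<gamma>|lborel. J \<gamma> t)"
    by (rule lborel_pair.Fubini_integral[OF Ji, symmetric])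
  also have "\<dots> = (LINT t:{0..x}|lborel. q t *\<^sub>R ((cos_quot r x - cos_quot r (x - 2 * t)) / 2))"
    unfolding set_lebesgue_integral_def
  proof (rule Bochner_Integration.integral_cong[OF refl])
    fix t
    note si = integrable_sin_quot_affine[of _ _ r x]
    show "(LINT \<gamma>|lborel. J \<gamma> t) = indicat_real {0..x} t *\<^sub>R (q t *\<^sub>R ((cos_quot r x - cos_quot r (x - 2 * t)) / 2))"
    proof (cases "t \<in> {0..x}")
      case True
      have "J \<gamma> t = (q t / 2) *\<^sub>R (indicat_real {t..x} \<gamma> *\<^sub>R sin_quot r (2 * \<gamma> - x) - indicat_real {0..x - t} \<gamma> *\<^sub>R sin_quot r (2 * \<gamma> - x))" for \<gamma>
        using True by (auto simp: J_def indicator_def)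
      then have "(LINT \<gamma>|lborel. J \<gamma> t) = (q t / 2) *\<^sub>R ((LINT \<gamma>:{t..x}|lborel. sin_quot r (2 * \<gamma> - x)) - (LINT \<gamma>:{0..x - t}|lborel. sin_quot r (2 * \<gamma> - x)))"
        unfolding set_lebesgue_integral_def using Bochner_Integration.integral_diff[OF si[of t x] si[of 0 "x - t"]] by simp
      also have "(LINT \<gamma>:{t..x}|lborel. sin_quot r (2 * \<gamma> - x)) - (LINT \<gamma>:{0..x - t}|lborel. sin_quot r (2 * \<gamma> - x)) = cos_quot r x - cos_quot r (x - 2 * t)"
      proof -
        have "cos_quot r (2 * t - x) = cos_quot r (x - 2 * t)"
          using cos_quot_minus[of r "x - 2 * t"] by simp
        then have "(LINT \<gamma>:{t..x}|lborel. sin_quot r (2 * \<gamma> - x)) = (cos_quot r x - cos_quot r (x - 2 * t)) / 2"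
          using integral_sin_quot_affine[of t x r x] True by simp
        moreover have "2 * (x - t) - x = x - 2 * t" by simp
        then have "(LINT \<gamma>:{0..x - t}|lborel. sin_quot r (2 * \<gamma> - x)) = (cos_quot r (x - 2 * t) - cos_quot r x) / 2"
          using integral_sin_quot_affine[of 0 "x - t" r x] True by (simp del: diff_conv_add_uminus)
        ultimately show ?thesis by (simp only:) (simp add: diff_divide_distrib)
      qed
      finally show ?thesis
        using True by (simp add: scaleR_conv_of_real)
    next
      case False
      have "J \<gamma> t = 0" for \<gamma>
      proof (cases "t < 0")
        case True
        then show ?thesis using q_supp[of t] by (simp add: J_def)
      next
        case False
        then show ?thesis
          using \<open>t \<notin> {0..x}\<close> by (auto simp: J_def indicator_def)
      qed
      then show ?thesis using False by simp
    qed
  qed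
  finally show ?thesis .
qed

lemma set_integrable_kernel:
  assumes y: "y \<in> {0..1}"
  shows "set_integrable lborel {0..y} (\<lambda>\<gamma>. a (\<gamma>, y - \<gamma>) *\<^sub>R sin_quot r (2 * \<gamma> - y))"
proof -
  obtain B2 where B2: "B2 \<ge> 0" "\<And>t. t \<in> {-2..2} \<Longrightarrow> norm (sin_quot r t) \<le> B2"
    using sin_quot_bounded by blast
  show ?thesis
    unfolding set_integrable_def
  proof (rule Bochner_Integration.integrable_bound)
    show "integrable lborel (\<lambda>\<gamma>. B * B2 * indicat_real {0..y} \<gamma>)"
      by (rule integrable_mult_right, rule integrable_real_indicator) (auto simp: emeasure_lborel_Icc_eq)
    show "(\<lambda>\<gamma>. indicat_real {0..y} \<gamma> *\<^sub>R a (\<gamma>, y - \<gamma>) *\<^sub>R sin_quot r (2 * \<gamma> - y)) \<in> borel_measurable lborel"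
      by measurable
    show "AE \<gamma> in lborel. norm (indicat_real {0..y} \<gamma> *\<^sub>R a (\<gamma>, y - \<gamma>) *\<^sub>R sin_quot r (2 * \<gamma> - y)) \<le> norm (B * B2 * indicat_real {0..y} \<gamma>)"
    proof (rule AE_I2)
      fix \<gamma>
      show "norm (indicat_real {0..y} \<gamma> *\<^sub>R a (\<gamma>, y - \<gamma>) *\<^sub>R sin_quot r (2 * \<gamma> - y)) \<le> norm (B * B2 * indicat_real {0..y} \<gamma>)"
      proof (cases "\<gamma> \<in> {0..y}")
        case True
        then have "\<bar>a (\<gamma>, y - \<gamma>)\<bar> * norm (sin_quot r (2 * \<gamma> - y)) \<le> B * B2"
          using a_bound[of \<gamma> "y - \<gamma>"] B2(2)[of "2 * \<gamma> - y"] y B_nonneg B2(1) by (intro mult_mono) auto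
        then show ?thesis using True B_nonneg B2(1) by simp
      qed simp
    qed
  qed
qed

lemma set_integrable_q:
  fixes g :: "real \<Rightarrow> complex"
  assumes g: "g \<in> borel_measurable borel" "\<And>t. t \<in> {0..x} \<Longrightarrow> norm (g t) \<le> C"
  shows "set_integrable lborel {0..x} (\<lambda>t. q t *\<^sub>R g t)"
  unfolding set_integrable_def
proof (rule Bochner_Integration.integrable_bound)
  show "integrable lborel (\<lambda>t. C * q t)" using q_int by simp
  show "(\<lambda>t. indicat_real {0..x} t *\<^sub>R q t *\<^sub>R g t) \<in> borel_measurable lborel"
    using g(1) by measurable
  show "AE t in lborel. norm (indicat_real {0..x} t *\<^sub>R q t *\<^sub>R g t) \<le> norm (C * q t)"
  proof (rule AE_I2)
    fix t
    show "norm (indicat_real {0..x} t *\<^sub>R q t *\<^sub>R g t) \<le> norm (C * q t)"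
    proof (cases "t \<in> {0..x}")
      case True
      then have "norm (g t) \<le> \<bar>C\<bar>" using g(2)[of t] by simp
      then have "\<bar>q t\<bar> * norm (g t) \<le> \<bar>q t\<bar> * \<bar>C\<bar>" by (rule mult_left_mono) simp
      then show ?thesis using True by (simp add: abs_mult mult_ac)
    qed simp
  qed
qed

lemma kernel_term_meas [measurable]: "kernel_term r \<in> borel_measurable borel"
proof -
  have **: "(\<lambda>(t, \<alpha>). indicat_real {0..t} \<alpha> *\<^sub>R a (\<alpha>, t - \<alpha>) *\<^sub>R sin_quot r (2 * \<alpha> - t)) =
      (\<lambda>p. indicat_real {p. 0 \<le> snd p \<and> snd p \<le> fst p} p *\<^sub>R a (snd p, fst p - snd p) *\<^sub>R sin_quot r (2 * snd p - fst p))"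
    by (auto simp: indicator_def fun_eq_iff)
  have "(\<lambda>(t, \<alpha>). indicat_real {0..t} \<alpha> *\<^sub>R a (\<alpha>, t - \<alpha>) *\<^sub>R sin_quot r (2 * \<alpha> - t)) \<in> borel_measurable ((borel :: real measure) \<Otimes>\<^sub>M lborel)"
    unfolding ** by measurable
  then show ?thesis
    unfolding kernel_term_def[abs_def] set_lebesgue_integral_def by (rule lborel.borel_measurable_lebesgue_integral)
qed

lemma kernel_term_bound:
  assumes B2: "B2 \<ge> 0" "\<And>t. t \<in> {-2..2} \<Longrightarrow> norm (sin_quot r t) \<le> B2" and t: "t \<in> {0..1}"
  shows "norm (kernel_term r t) \<le> B * B2"
proof -
  have "norm (kernel_term r t) \<le> (LINT \<alpha>:{0..t}|lborel. norm (a (\<alpha>, t - \<alpha>) *\<^sub>R sin_quot r (2 * \<alpha> - t)))"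
    unfolding kernel_term_def by (rule set_integral_norm_bound[OF set_integrable_kernel[OF t]])
  also have "\<dots> \<le> (LINT \<alpha>:{0..t}|lborel. B * B2)"
  proof (rule set_integral_mono)
    show "set_integrable lborel {0..t} (\<lambda>\<alpha>. norm (a (\<alpha>, t - \<alpha>) *\<^sub>R sin_quot r (2 * \<alpha> - t)))"
      by (rule set_integrable_norm[OF set_integrable_kernel[OF t]])
    show "set_integrable lborel {0..t} (\<lambda>\<alpha>. B * B2)"
      by (rule borel_integrable_atLeastAtMost') (rule continuous_on_const)
    fix \<alpha> assume "\<alpha> \<in> {0..t}"
    then have "\<bar>a (\<alpha>, t - \<alpha>)\<bar> * norm (sin_quot r (2 * \<alpha> - t)) \<le> B * B2"
      using a_bound[of \<alpha> "t - \<alpha>"] B2(2)[of "2 * \<alpha> - t"] t B_nonneg B2(1) by (intro mult_mono) auto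
    then show "norm (a (\<alpha>, t - \<alpha>) *\<^sub>R sin_quot r (2 * \<alpha> - t)) \<le> B * B2" by simp
  qed
  also have "\<dots> = t * (B * B2)" using t by (simp add: set_lebesgue_integral_def)
  also have "\<dots> \<le> 1 * (B * B2)" using t B_nonneg B2(1) by (intro mult_right_mono) auto
  finally show ?thesis by simp
qed

text \<open>
  The integral equation of \<open>a\<close>, integrated against \<open>sin_quot r (2 \<gamma> - x)\<close>, is the Volterra equation of the
  initial value problem. The differences of \<open>cos_quot\<close> produced by the inner integrals are the
  products \<open>sin_quot r (x - t) * sin_quot r t\<close> and \<open>sin_quot r (x - \<xi> - \<eta>) * sin_quot r (\<xi> - \<eta>)\<close>;
  these are the Volterra kernel applied to the two summands of \<open>S\<close>.
\<close>
lemma S_kernel_integral: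
  assumes x: "x \<in> {0..1}"
  shows "kernel_term r x =
     (LINT t:{0..x}|lborel. q t *\<^sub>R (sin_quot r (x - t) * S r t))"
proof -
  define Q where "Q = (\<lambda>\<gamma>. ((LINT t:{..\<gamma>}|lborel. q t) - (LINT t:{..x - \<gamma>}|lborel. q t)) / 2)"
  define K where "K = (\<lambda>\<gamma>. LINT s|lborel. indicator ({..\<gamma>} \<times> {..x - \<gamma>}) s * (triangle_kernel q s * a s))"
  define R where "R = kernel_term r"
  have aQK: "a (\<gamma>, x - \<gamma>) = Q \<gamma> + K \<gamma>" for \<gamma>
    using a_eq[of "(\<gamma>, x - \<gamma>)"] by (simp add: goursat_map_def Q_def K_def)
  obtain B2 where B2: "B2 \<ge> 0" "\<And>t. t \<in> {-2..2} \<Longrightarrow> norm (sin_quot r t) \<le> B2"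
    using sin_quot_bounded by blast
  have Qi: "set_integrable lborel {0..x} (\<lambda>\<gamma>. Q \<gamma> *\<^sub>R sin_quot r (2 * \<gamma> - x))"
    unfolding set_integrable_def
  proof (rule Bochner_Integration.integrable_bound)
    let ?C = "LINT t|lborel. \<bar>q t\<bar>"
    show "integrable lborel (\<lambda>\<gamma>. ?C * B2 * indicat_real {0..x} \<gamma>)"
      by (rule integrable_mult_right, rule integrable_real_indicator) (auto simp: emeasure_lborel_Icc_eq)
    have m: "(\<lambda>y. LINT t:{..y}|lborel. q t) \<in> borel_measurable borel"
    proof -
      have **: "(\<lambda>(x, t). indicat_real {..x} t *\<^sub>R q t) = (\<lambda>p. indicator {p. snd p \<le> fst p} p * q (snd p))"
        by (auto simp: indicator_def fun_eq_iff)
      have "(\<lambda>(x, t). indicat_real {..x} t *\<^sub>R q t) \<in> borel_measurable ((borel :: real measure) \<Otimes>\<^sub>M lborel)"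
        unfolding ** by measurable
      then show ?thesis
        unfolding set_lebesgue_integral_def by (rule lborel.borel_measurable_lebesgue_integral)
    qed
    have "(\<lambda>\<gamma>. LINT t:{..x - \<gamma>}|lborel. q t) \<in> borel_measurable borel"
      by (rule measurable_compose[OF _ m]) simp
    with m have [measurable]: "Q \<in> borel_measurable borel"
      unfolding Q_def by (intro borel_measurable_divide borel_measurable_diff borel_measurable_const)
    show "(\<lambda>\<gamma>. indicat_real {0..x} \<gamma> *\<^sub>R Q \<gamma> *\<^sub>R sin_quot r (2 * \<gamma> - x)) \<in> borel_measurable lborel"
      by measurable
    show "AE \<gamma> in lborel. norm (indicat_real {0..x} \<gamma> *\<^sub>R Q \<gamma> *\<^sub>R sin_quot r (2 * \<gamma> - x)) \<le> norm (?C * B2 * indicat_real {0..x} \<gamma>)"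
    proof (rule AE_I2)
      fix \<gamma>
      show "norm (indicat_real {0..x} \<gamma> *\<^sub>R Q \<gamma> *\<^sub>R sin_quot r (2 * \<gamma> - x)) \<le> norm (?C * B2 * indicat_real {0..x} \<gamma>)"
      proof (cases "\<gamma> \<in> {0..x}")
        case True
        have "\<bar>Q \<gamma>\<bar> \<le> ?C"
          using abs_integral_le_atMost[OF q_int, of \<gamma> "x - \<gamma>"] unfolding Q_def by simp
        then have "\<bar>Q \<gamma>\<bar> * norm (sin_quot r (2 * \<gamma> - x)) \<le> ?C * B2"
          using B2(2)[of "2 * \<gamma> - x"] x True B2(1) by (intro mult_mono) auto
        then show ?thesis using True B2(1) by (simp add: abs_mult)
      qed simp
    qed
  qed
  have Ki: "set_integrable lborel {0..x} (\<lambda>\<gamma>. K \<gamma> *\<^sub>R sin_quot r (2 * \<gamma> - x))"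
    using set_integral_diff(1)[OF set_integrable_kernel[OF x, of r] Qi] by (simp add: aQK scaleR_left_distrib)
  have "kernel_term r x =
     (LINT \<gamma>:{0..x}|lborel. Q \<gamma> *\<^sub>R sin_quot r (2 * \<gamma> - x)) + (LINT \<gamma>:{0..x}|lborel. K \<gamma> *\<^sub>R sin_quot r (2 * \<gamma> - x))"
    unfolding kernel_term_def aQK scaleR_left_distrib by (rule set_integral_add(2)[OF Qi Ki])
  also have "(LINT \<gamma>:{0..x}|lborel. Q \<gamma> *\<^sub>R sin_quot r (2 * \<gamma> - x)) = (LINT t:{0..x}|lborel. q t *\<^sub>R (sin_quot r (x - t) * sin_quot r t))"
    unfolding Q_def potential_part[OF x] sin_quot_mult by (simp add: algebra_simps)
  also have "(LINT \<gamma>:{0..x}|lborel. K \<gamma> *\<^sub>R sin_quot r (2 * \<gamma> - x)) = (LINT t:{0..x}|lborel. q t *\<^sub>R (sin_quot r (x - t) * R t))"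
  proof -
    have c: "continuous_on UNIV (\<lambda>t. sin_quot r (x - t))"
      by (rule continuous_on_compose2[OF continuous_on_sin_quot[of UNIV]]) (auto intro!: continuous_intros)
    have "(cos_quot r (x - 2 * snd s) - cos_quot r (2 * fst s - x)) / 2 = sin_quot r (x - (fst s + snd s)) * sin_quot r (fst s - snd s)" for s :: "real \<times> real"
      using cos_quot_minus[of r "2 * fst s - x"] unfolding sin_quot_mult by (simp add: algebra_simps)
    then show ?thesis
      unfolding K_def kernel_part[OF x] R_def kernel_term_def kernel_swap[OF c x] by simp
  qed
  also have "(LINT t:{0..x}|lborel. q t *\<^sub>R (sin_quot r (x - t) * sin_quot r t)) + (LINT t:{0..x}|lborel. q t *\<^sub>R (sin_quot r (x - t) * R t)) =
     (LINT t:{0..x}|lborel. q t *\<^sub>R (sin_quot r (x - t) * S r t))"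
  proof -
    have s1: "norm (sin_quot r (x - t)) \<le> B2" "norm (sin_quot r t) \<le> B2" if "t \<in> {0..x}" for t
      using B2(2) x that by auto
    have i1: "set_integrable lborel {0..x} (\<lambda>t. q t *\<^sub>R (sin_quot r (x - t) * sin_quot r t))"
    proof (rule set_integrable_q[where C = "B2 * B2"])
      show "norm (sin_quot r (x - t) * sin_quot r t) \<le> B2 * B2" if "t \<in> {0..x}" for t
        unfolding norm_mult using s1[OF that] B2(1) by (intro mult_mono) auto
    qed measurable
    have i2: "set_integrable lborel {0..x} (\<lambda>t. q t *\<^sub>R (sin_quot r (x - t) * R t))"
    proof (rule set_integrable_q[where C = "B2 * (B * B2)"])
      show "norm (sin_quot r (x - t) * R t) \<le> B2 * (B * B2)" if "t \<in> {0..x}" for t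
        unfolding norm_mult R_def using s1[OF that] kernel_term_bound[OF B2, of t] that x B2(1) by (intro mult_mono) auto
    qed (unfold R_def, measurable)
    have "S r t = sin_quot r t + R t" for t
      by (simp add: S_def R_def)
    then show ?thesis
      using set_integral_add(2)[OF i1 i2] by (simp add: algebra_simps)
  qed
  finally show ?thesis .
qed

end

section \<open>Solutions of the differential equation\<close>
lemma abs_cont_on_subset:
  assumes "abs_cont_on a b f" "a \<le> c" "d \<le> b"
  shows "abs_cont_on c d f"
  unfolding abs_cont_on_def
proof (intro allI impI)
  fix e :: real assume "e > 0"
  then obtain \<delta> where \<delta>: "\<delta> > 0" "\<And>D. finite D \<and> (\<forall>(s, t)\<in>D. a \<le> s \<and> s \<le> t \<and> t \<le> b) \<and>
        disjoint_family_on (\<lambda>(s, t). {s<..<t}) D \<and> (\<Sum>(s, t)\<in>D. t - s) < \<delta>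
        \<longrightarrow> (\<Sum>(s, t)\<in>D. norm (f t - f s)) < e"
    using assms(1)[unfolded abs_cont_on_def, rule_format, of e] by auto
  show "\<exists>\<delta>>0. \<forall>D. finite D \<and> (\<forall>(s, t)\<in>D. c \<le> s \<and> s \<le> t \<and> t \<le> d) \<and>
        disjoint_family_on (\<lambda>(s, t). {s<..<t}) D \<and> (\<Sum>(s, t)\<in>D. t - s) < \<delta>
        \<longrightarrow> (\<Sum>(s, t)\<in>D. norm (f t - f s)) < e"
  proof (intro exI[of _ \<delta>] conjI allI impI \<delta>(1))
    fix D :: "(real \<times> real) set"
    assume D: "finite D \<and> (\<forall>(s, t)\<in>D. c \<le> s \<and> s \<le> t \<and> t \<le> d) \<and>
        disjoint_family_on (\<lambda>(s, t). {s<..<t}) D \<and> (\<Sum>(s, t)\<in>D. t - s) < \<delta>"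
    then have "\<forall>(s, t)\<in>D. a \<le> s \<and> s \<le> t \<and> t \<le> b"
      using assms(2,3) by fastforce
    then show "(\<Sum>(s, t)\<in>D. norm (f t - f s)) < e"
      using \<delta>(2)[of D] D by blast
  qed
qed

lemma abs_cont_on_C1:
  fixes f :: "real \<Rightarrow> 'a::banach"
  assumes d: "\<And>x. x \<in> {a..b} \<Longrightarrow> (f has_vector_derivative f' x) (at x within {a..b})"
    and c: "continuous_on {a..b} f'"
  shows "abs_cont_on a b f"
proof -
  have "compact (f' ` {a..b})"
    by (rule compact_continuous_image[OF c]) auto
  then obtain L where L: "L > 0" "\<forall>y\<in>f' ` {a..b}. norm y \<le> L"
    using compact_imp_bounded bounded_pos by blast
  show ?thesis
  proof (rule abs_cont_on_lipschitz)
    fix s t assume st: "a \<le> s" "s \<le> t" "t \<le> b"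
    have "(f' has_integral (f t - f s)) {s..t}"
      using st by (intro fundamental_theorem_of_calculus has_vector_derivative_within_subset[OF d]) auto
    then have "norm (f t - f s) \<le> L * measure lborel (cbox s t)"
      using L st by (intro has_integral_bound[where f = f']) auto
    then show "norm (f t - f s) \<le> L * (t - s)"
      using st by simp
  qed
qed

lemma AE_lebesgueE:
  assumes "AE x in lebesgue. P x"
  obtains N where "N \<in> null_sets lebesgue" "\<And>x. x \<notin> N \<Longrightarrow> P x"
  using AE_E3[OF assms] by auto

text \<open>
  The derivative of \<open>y w' - y' w\<close> is \<open>- q y w\<close>, as both functions solve the equation with the same \<open>z\<close>, \<open>w\<close> with
  potential zero. With \<open>w = sin_quot r (x - t)\<close> this is the Volterra equation, with
  \<open>w = sin_quot r\<close> it computes the characteristic function.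
\<close>
lemma wronskian_identity:
  fixes q :: "real \<Rightarrow> real" and y y' w w' :: "real \<Rightarrow> complex"
  assumes dy: "\<forall>x\<in>{0..1}. (y has_vector_derivative y' x) (at x within {0..1})"
    and ac: "abs_cont_on 0 1 y'"
    and ode: "AE x in lebesgue. x \<in> {0<..<1} \<longrightarrow>
           (\<exists>y''. (y' has_vector_derivative y'') (at x) \<and> - y'' + complex_of_real (q x) * y x = z * y x)"
    and dw: "\<And>t. (w has_vector_derivative w' t) (at t)"
    and dw': "\<And>t. (w' has_vector_derivative - (z * w t)) (at t)"
    and x: "x \<in> {0..1}"
  shows "((\<lambda>t. - (q t *\<^sub>R (y t * w t))) has_integral
     (y x * w' x - y' x * w x) - (y 0 * w' 0 - y' 0 * w 0)) {0..x}"
proof -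
  obtain N where N: "N \<in> null_sets lebesgue" "\<And>t. t \<notin> N \<Longrightarrow> t \<in> {0<..<1} \<longrightarrow>
      (\<exists>y''. (y' has_vector_derivative y'') (at t) \<and> - y'' + complex_of_real (q t) * y t = z * y t)"
    by (rule AE_lebesgueE[OF ode]) (rule that; assumption)
  have acy: "abs_cont_on 0 1 y"
    by (rule abs_cont_on_C1[OF bspec[OF dy] abs_cont_on_imp_continuous_on[OF ac]])
  have cw: "continuous_on A w" for A
    by (rule continuous_on_vector_derivative[OF has_vector_derivative_at_within[OF dw]])
  have cw': "continuous_on A w'" for A
    by (rule continuous_on_vector_derivative[OF has_vector_derivative_at_within[OF dw']])
  have acw: "abs_cont_on 0 1 w"
    by (rule abs_cont_on_C1[OF has_vector_derivative_at_within[OF dw] cw'])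
  have acw': "abs_cont_on 0 1 w'"
    by (rule abs_cont_on_C1[OF has_vector_derivative_at_within[OF dw']]) (intro continuous_intros cw)
  have acm: "abs_cont_on 0 1 (\<lambda>t. - y' t)"
    using abs_cont_on_mult[OF abs_cont_on_lipschitz[of 0 1 "\<lambda>_. -1::complex" 0] ac] by simp
  have "abs_cont_on 0 1 (\<lambda>t. y t * w' t + (- y' t) * w t)"
    by (intro abs_cont_on_add abs_cont_on_mult acy acw acw' acm)
  then have "abs_cont_on 0 x (\<lambda>t. y t * w' t + (- y' t) * w t)"
    by (rule abs_cont_on_subset) (use x in auto)
  then have "((\<lambda>t. - (q t *\<^sub>R (y t * w t))) has_integral
     (y x * w' x + (- y' x) * w x) - (y 0 * w' 0 + (- y' 0) * w 0)) {0..x}"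
  proof (rule abs_cont_on_FTC)
    show "0 \<le> x" using x by simp
    show "negligible N" using N(1) by (simp add: negligible_iff_null_sets)
    fix t assume t: "t \<in> {0<..<x} - N"
    then have t1: "t \<in> {0<..<1}" using x by auto
    obtain y'' where y'': "(y' has_vector_derivative y'') (at t)" "- y'' + complex_of_real (q t) * y t = z * y t"
    proof -
      have "t \<notin> N" using t by simp
      from mp[OF N(2)[OF this] t1] show thesis by (elim exE conjE) (rule that)
    qed
    have "(y has_vector_derivative y' t) (at t within {0<..<1})"
      by (rule has_vector_derivative_within_subset[OF bspec[OF dy]]) (use t1 in auto)
    then have yt: "(y has_vector_derivative y' t) (at t)"
      unfolding at_within_open[OF t1 open_greaterThanLessThan] .
    have "((\<lambda>t. y t * w' t + (- y' t) * w t) has_vector_derivative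
       (y t * (- (z * w t)) + y' t * w' t) + ((- y' t) * w' t + (- y'') * w t)) (at t)"
      by (intro has_vector_derivative_add has_vector_derivative_mult has_vector_derivative_minus yt y''(1) dw dw')
    moreover have "(y t * (- (z * w t)) + y' t * w' t) + ((- y' t) * w' t + (- y'') * w t) = - (q t *\<^sub>R (y t * w t))"
    proof -
      have e: "y'' = complex_of_real (q t) * y t - z * y t"
        using y''(2) by (simp add: algebra_simps)
      show ?thesis unfolding e by (simp add: scaleR_conv_of_real algebra_simps)
    qed
    ultimately show "((\<lambda>t. y t * w' t + (- y' t) * w t) has_vector_derivative - (q t *\<^sub>R (y t * w t))) (at t)"
      by simp
  qed
  then show ?thesis by simp
qed

context goursat_kernel begin

lemma S_meas [measurable]: "S r \<in> borel_measurable borel"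
  unfolding S_def[abs_def] by measurable

lemma S_bounded: "\<exists>C\<ge>0. \<forall>t\<in>{0..1}. norm (S r t) \<le> C"
proof -
  obtain B2 where B2: "B2 \<ge> 0" "\<And>t. t \<in> {-2..2} \<Longrightarrow> norm (sin_quot r t) \<le> B2"
    using sin_quot_bounded by blast
  have "norm (S r t) \<le> B2 + B * B2" if "t \<in> {0..1}" for t
    unfolding S_def using B2(2)[of t] kernel_term_bound[OF B2 that] that norm_triangle_ineq[of "sin_quot r t" "kernel_term r t"] by auto
  then show ?thesis
    using B2(1) B_nonneg by (intro exI[of _ "B2 + B * B2"]) auto
qed

lemma S_volterra:
  assumes "x \<in> {0..1}"
  shows "S r x = sin_quot r x + (LINT t:{0..x}|lborel. q t *\<^sub>R (sin_quot r (x - t) * S r t))"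
  unfolding S_def[of r x] S_kernel_integral[OF assms] ..

text \<open>
  The difference of two solutions is a fixed point of a contraction, for the exponential weight
  adapted to the bound of \<open>sin_quot r\<close>.
\<close>
lemma volterra_unique:
  assumes y: "continuous_on {0..1} y"
    and v: "\<And>x. x \<in> {0..1} \<Longrightarrow> y x = sin_quot r x + (LINT t:{0..x}|lborel. q t *\<^sub>R (sin_quot r (x - t) * y t))"
    and x: "x \<in> {0..1}"
  shows "y x = S r x"
proof -
  define f where "f = (\<lambda>x. indicat_real {0..1} x *\<^sub>R y x)"
  define g where "g = (\<lambda>x. indicat_real {0..1} x *\<^sub>R S r x)"
  have fm [measurable]: "f \<in> borel_measurable borel" "g \<in> borel_measurable borel"
  proof -
    show "f \<in> borel_measurable borel"
      unfolding f_def by (rule borel_measurable_continuous_on_indicator[OF _ y]) simp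
    show "g \<in> borel_measurable borel"
      unfolding g_def by measurable
  qed
  obtain B2 where B2: "B2 \<ge> 0" "\<And>t. t \<in> {-2..2} \<Longrightarrow> norm (sin_quot r t) \<le> B2"
    using sin_quot_bounded by blast
  have "1 / (2 * (B2 + 1)) > 0" using B2(1) by simp
  from exp_weight[OF q_int this] obtain M where M: "M \<ge> 1"
    "\<And>x. (LINT t:{0..x}|lborel. \<bar>q t\<bar> * exp (M * t)) \<le> 1 / (2 * (B2 + 1)) * exp (M * x)" by blast
  define w where "w = (\<lambda>x. if x \<in> {0..1} then exp (M * x) else 0)"
  obtain C1 where C1: "C1 \<ge> 0" "\<And>t. t \<in> {0..1} \<Longrightarrow> norm (S r t) \<le> C1" using S_bounded by blast
  have "compact (y ` {0..1})"
    by (rule compact_continuous_image[OF y]) auto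
  then obtain C2 where C2: "C2 > 0" "\<forall>x\<in>y ` {0..1}. norm x \<le> C2"
    using compact_imp_bounded bounded_pos by blast
  have bd: "norm (f t - g t) \<le> (C1 + C2) * w t" for t
  proof (cases "t \<in> {0..1}")
    case True
    have "norm (f t - g t) \<le> norm (y t) + norm (S r t)"
      using True by (simp add: f_def g_def norm_triangle_ineq4)
    also have "\<dots> \<le> (C1 + C2) * 1"
    proof -
      have "norm (y t) \<le> C2" using C2(2) True by blast
      then show ?thesis using C1(2)[OF True] by simp
    qed
    also have "\<dots> \<le> (C1 + C2) * w t"
      using True M(1) C1(1) C2(1) by (intro mult_left_mono) (auto simp: w_def)
    finally show ?thesis .
  next
    case False
    then show ?thesis by (simp add: f_def g_def w_def del: atLeastAtMost_iff)
  qed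
  have "f x = g x"
  proof (rule weighted_fixed_point_unique[where w = w and c = "1/2" and d = "C1 + C2"])
    fix d i assume d: "0 \<le> d" and le: "\<And>t. norm (f t - g t) \<le> d * w t"
    show "norm (f i - g i) \<le> 1 / 2 * d * w i"
    proof (cases "i \<in> {0..1}")
      case True
      have qbd: "set_integrable lborel {0..i} (\<lambda>t. q t *\<^sub>R (sin_quot r (i - t) * h t))"
        if h: "h \<in> borel_measurable borel" "\<And>t. t \<in> {0..1} \<Longrightarrow> norm (h t) \<le> C" for h C
      proof (rule set_integrable_q[where C = "B2 * C"])
        show "norm (sin_quot r (i - t) * h t) \<le> B2 * C" if t: "t \<in> {0..i}" for t
          unfolding norm_mult using B2(1) B2(2)[of "i - t"] h(2)[of t] t True by (intro mult_mono) auto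
      qed (use h(1) in measurable)
      have i1: "set_integrable lborel {0..i} (\<lambda>t. q t *\<^sub>R (sin_quot r (i - t) * f t))"
        by (rule qbd[where C = C2]) (use C2 fm in \<open>auto simp: f_def\<close>)
      have i2: "set_integrable lborel {0..i} (\<lambda>t. q t *\<^sub>R (sin_quot r (i - t) * g t))"
        by (rule qbd[where C = C1]) (use C1 fm in \<open>auto simp: g_def\<close>)
      have i3: "set_integrable lborel {0..i} (\<lambda>t. \<bar>q t\<bar> * exp (M * t))"
      proof (rule set_integrable_bound)
        show "set_integrable lborel {0..i} (\<lambda>t. exp M * q t)"
          unfolding set_integrable_def by (rule integrable_mult_indicator) (use q_int in auto)
        show "set_borel_measurable lborel {0..i} (\<lambda>t. \<bar>q t\<bar> * exp (M * t))"
          unfolding set_borel_measurable_def by measurable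
        show "AE t in lborel. t \<in> {0..i} \<longrightarrow> norm (\<bar>q t\<bar> * exp (M * t)) \<le> norm (exp M * q t)"
        proof (intro AE_I2 impI)
          fix t assume t: "t \<in> {0..i}"
          then have "M * t \<le> M * 1"
            using M(1) True by (intro mult_left_mono) auto
          then have "\<bar>q t\<bar> * exp (M * t) \<le> \<bar>q t\<bar> * exp M"
            by (intro mult_left_mono) auto
          then show "norm (\<bar>q t\<bar> * exp (M * t)) \<le> norm (exp M * q t)"
            by (simp add: abs_mult mult.commute)
        qed
      qed
      have "f i - g i = y i - S r i" using True by (simp add: f_def g_def)
      also have "\<dots> = (LINT t:{0..i}|lborel. q t *\<^sub>R (sin_quot r (i - t) * y t)) - (LINT t:{0..i}|lborel. q t *\<^sub>R (sin_quot r (i - t) * S r t))"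
        using v[OF True] S_volterra[OF True, of r] by simp
      also have "(LINT t:{0..i}|lborel. q t *\<^sub>R (sin_quot r (i - t) * y t)) = (LINT t:{0..i}|lborel. q t *\<^sub>R (sin_quot r (i - t) * f t))"
        by (rule set_lebesgue_integral_cong) (use True in \<open>auto simp: f_def\<close>)
      also have "(LINT t:{0..i}|lborel. q t *\<^sub>R (sin_quot r (i - t) * S r t)) = (LINT t:{0..i}|lborel. q t *\<^sub>R (sin_quot r (i - t) * g t))"
        by (rule set_lebesgue_integral_cong) (use True in \<open>auto simp: g_def\<close>)
      also have "(LINT t:{0..i}|lborel. q t *\<^sub>R (sin_quot r (i - t) * f t)) - (LINT t:{0..i}|lborel. q t *\<^sub>R (sin_quot r (i - t) * g t))
          = (LINT t:{0..i}|lborel. q t *\<^sub>R (sin_quot r (i - t) * f t) - q t *\<^sub>R (sin_quot r (i - t) * g t))"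
        by (rule set_integral_diff(2)[OF i1 i2, symmetric])
      also have "norm \<dots> \<le> (LINT t:{0..i}|lborel. norm (q t *\<^sub>R (sin_quot r (i - t) * f t) - q t *\<^sub>R (sin_quot r (i - t) * g t)))"
        by (rule set_integral_norm_bound) (rule set_integral_diff(1)[OF i1 i2])
      also have "\<dots> \<le> (LINT t:{0..i}|lborel. B2 * d * (\<bar>q t\<bar> * exp (M * t)))"
      proof (rule set_integral_mono)
        show "set_integrable lborel {0..i} (\<lambda>t. norm (q t *\<^sub>R (sin_quot r (i - t) * f t) - q t *\<^sub>R (sin_quot r (i - t) * g t)))"
          by (intro set_integrable_norm set_integral_diff(1) i1 i2)
        show "set_integrable lborel {0..i} (\<lambda>t. B2 * d * (\<bar>q t\<bar> * exp (M * t)))"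
          using i3 by simp
        fix t assume t: "t \<in> {0..i}"
        have "q t *\<^sub>R (sin_quot r (i - t) * f t) - q t *\<^sub>R (sin_quot r (i - t) * g t) = q t *\<^sub>R (sin_quot r (i - t) * (f t - g t))"
          by (simp add: algebra_simps)
        also have "norm \<dots> = \<bar>q t\<bar> * (norm (sin_quot r (i - t)) * norm (f t - g t))"
          by (simp add: norm_mult)
        also have "\<dots> \<le> \<bar>q t\<bar> * (B2 * (d * exp (M * t)))"
          using B2(2)[of "i - t"] le[of t] t True B2(1) by (intro mult_left_mono mult_mono) (auto simp: w_def)
        finally show "norm (q t *\<^sub>R (sin_quot r (i - t) * f t) - q t *\<^sub>R (sin_quot r (i - t) * g t)) \<le> B2 * d * (\<bar>q t\<bar> * exp (M * t))"
          by (simp add: mult_ac)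
      qed
      also have "\<dots> = B2 * d * (LINT t:{0..i}|lborel. \<bar>q t\<bar> * exp (M * t))" by simp
      also have "\<dots> \<le> B2 * d * (1 / (2 * (B2 + 1)) * exp (M * i))"
        using B2(1) d by (intro mult_left_mono M(2)) auto
      also have "\<dots> = B2 / (B2 + 1) * (1 / 2 * d * w i)"
        using True B2(1) by (simp add: w_def divide_simps)
      also have "\<dots> \<le> 1 * (1 / 2 * d * w i)"
        using B2(1) d True by (intro mult_right_mono) (auto simp: w_def)
      finally show ?thesis by simp
    next
      case False
      then show ?thesis by (simp add: f_def g_def w_def del: atLeastAtMost_iff)
    qed
  qed (use C1(1) C2(1) bd in auto)
  then show ?thesis
    using x by (simp add: f_def g_def)
qed

text \<open>
  The addition theorem splits \<open>sin_quot r (x - t)\<close>, so the Volterra integral is a combination of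
  indefinite integrals in \<open>x\<close> with smooth coefficients, which can be differentiated twice almost everywhere.
\<close>
lemma S_is_solution:
  "SL_solution q (r\<^sup>2) (S r)" "S r 0 = 0" "deriv01 (S r) 0 = 1"
proof -
  define h where "h = (\<lambda>t. q t *\<^sub>R S r t)"
  define C where "C = (\<lambda>x. LINT t:{..x}|lborel. h t * cos (r * complex_of_real t))"
  define D where "D = (\<lambda>x. LINT t:{..x}|lborel. h t * sin_quot r t)"
  define c where "c = (\<lambda>x. cos (r * complex_of_real x))"
  obtain C1 where C1: "C1 \<ge> 0" "\<And>t. t \<in> {0..1} \<Longrightarrow> norm (S r t) \<le> C1" using S_bounded by blast
  have cc: "continuous_on A c" for A
    unfolding c_def by (intro continuous_intros)
  have cm [measurable]: "c \<in> borel_measurable borel"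
    by (rule borel_measurable_continuous_onI) (rule cc)
  have hi: "integrable lborel (\<lambda>t. h t * g t)" if g: "continuous_on UNIV g" for g
  proof -
    have gm: "g \<in> borel_measurable borel" by (rule borel_measurable_continuous_onI[OF g])
    obtain G where G: "G \<ge> 0" "\<forall>t\<in>{0..1}. norm (g t) \<le> G" using continuous_bounded_Icc[OF g] by blast
    have "set_integrable lborel {0..1} (\<lambda>t. q t *\<^sub>R (S r t * g t))"
    proof (rule set_integrable_q[where C = "C1 * G"])
      show "norm (S r t * g t) \<le> C1 * G" if "t \<in> {0..1}" for t
        unfolding norm_mult using C1 G that by (intro mult_mono) auto
    qed (use gm in measurable)
    moreover have "indicat_real {0..1} t *\<^sub>R (q t *\<^sub>R (S r t * g t)) = h t * g t" for t
      using q_supp[of t] by (cases "t \<in> {0..1}") (auto simp: h_def)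
    ultimately show ?thesis by (simp add: set_integrable_def)
  qed
  have hC: "integrable lborel (\<lambda>t. h t * c t)" and hD: "integrable lborel (\<lambda>t. h t * sin_quot r t)"
    by (rule hi, rule cc, rule hi, rule continuous_on_sin_quot)
  have acC: "abs_cont_on 0 1 C" and acD: "abs_cont_on 0 1 D"
    unfolding C_def D_def using abs_cont_on_indefinite_integral[OF hC] abs_cont_on_indefinite_integral[OF hD] by (simp_all add: c_def)
  have dC: "AE x in lebesgue. x \<in> {0<..<1} \<longrightarrow> (C has_vector_derivative h x * c x) (at x)"
    and dD: "AE x in lebesgue. x \<in> {0<..<1} \<longrightarrow> (D has_vector_derivative h x * sin_quot r x) (at x)"
    unfolding C_def D_def using AE_indefinite_integral_has_vector_derivative[OF hC] AE_indefinite_integral_has_vector_derivative[OF hD] by (simp_all add: c_def)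
  have ds: "(sin_quot r has_vector_derivative c x) (at x within A)" for x A
    unfolding c_def by (rule sin_quot_has_vector_derivative)
  have dc: "(c has_vector_derivative - (r\<^sup>2 * sin_quot r x)) (at x within A)" for x A
    unfolding c_def by (rule cos_has_vector_derivative)
  have acs: "abs_cont_on 0 1 (sin_quot r)"
    by (rule abs_cont_on_C1[OF ds cc])
  have acc: "abs_cont_on 0 1 c"
    by (rule abs_cont_on_C1[OF dc]) (intro continuous_intros continuous_on_sin_quot)
  have ack: "abs_cont_on 0 1 (\<lambda>_. k)" for k :: complex
    by (rule abs_cont_on_lipschitz[where L = 0]) simp
  define F where "F = (\<lambda>x. sin_quot r x * (1 + C x) + (- 1) * (c x * D x))"
  define F' where "F' = (\<lambda>x. c x * (1 + C x) + r\<^sup>2 * (sin_quot r x * D x))"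
  have acF: "abs_cont_on 0 1 F" and acF': "abs_cont_on 0 1 F'"
    unfolding F_def F'_def by (intro abs_cont_on_add abs_cont_on_mult acs acc acC acD ack)+
  have id: "c x * c x + r\<^sup>2 * (sin_quot r x * sin_quot r x) = 1" for x
  proof -
    have "r\<^sup>2 * (sin_quot r x * sin_quot r x) = (sin (r * complex_of_real x))\<^sup>2"
      by (simp add: sin_quot_def power2_eq_square)
    then show ?thesis
      using sin_cos_squared_add[of "r * complex_of_real x"] by (simp add: c_def power2_eq_square)
  qed
  have dF: "AE x in lebesgue. x \<in> {0<..<1} \<longrightarrow> (F has_vector_derivative F' x) (at x)"
    using dC dD
  proof eventually_elim
    case (elim x)
    show ?case
    proof
      assume "x \<in> {0<..<1}"
      with elim have e: "(C has_vector_derivative h x * c x) (at x)" "(D has_vector_derivative h x * sin_quot r x) (at x)" by auto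
      have "(F has_vector_derivative (sin_quot r x * (0 + h x * c x) + c x * (1 + C x)) +
          (- 1) * (c x * (h x * sin_quot r x) + - (r\<^sup>2 * sin_quot r x) * D x)) (at x)"
        unfolding F_def
        by (intro has_vector_derivative_add has_vector_derivative_mult has_vector_derivative_mult_right e ds dc has_vector_derivative_const)
      moreover have "(sin_quot r x * (0 + h x * c x) + c x * (1 + C x)) +
          (- 1) * (c x * (h x * sin_quot r x) + - (r\<^sup>2 * sin_quot r x) * D x) = F' x"
        by (simp add: F'_def algebra_simps)
      ultimately show "(F has_vector_derivative F' x) (at x)" by simp
    qed
  qed
  have dF': "AE x in lebesgue. x \<in> {0<..<1} \<longrightarrow> (F' has_vector_derivative h x - r\<^sup>2 * F x) (at x)"
    using dC dD
  proof eventually_elim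
    case (elim x)
    show ?case
    proof
      assume "x \<in> {0<..<1}"
      with elim have e: "(C has_vector_derivative h x * c x) (at x)" "(D has_vector_derivative h x * sin_quot r x) (at x)" by auto
      have "(F' has_vector_derivative (c x * (0 + h x * c x) + - (r\<^sup>2 * sin_quot r x) * (1 + C x)) +
          r\<^sup>2 * (sin_quot r x * (h x * sin_quot r x) + c x * D x)) (at x)"
        unfolding F'_def
        by (intro has_vector_derivative_add has_vector_derivative_mult has_vector_derivative_mult_right e ds dc has_vector_derivative_const)
      moreover have "(c x * (0 + h x * c x) + - (r\<^sup>2 * sin_quot r x) * (1 + C x)) +
          r\<^sup>2 * (sin_quot r x * (h x * sin_quot r x) + c x * D x) =
          h x * (c x * c x + r\<^sup>2 * (sin_quot r x * sin_quot r x)) - r\<^sup>2 * F x"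
        by (simp add: F_def algebra_simps)
      ultimately show "(F' has_vector_derivative h x - r\<^sup>2 * F x) (at x)" by (simp add: id)
    qed
  qed
  have h0: "(LINT t:{..x}|lborel. h t * g t) = (LINT t:{0..x}|lborel. h t * g t)" if "x \<ge> 0" for x and g :: "real \<Rightarrow> complex"
    unfolding set_lebesgue_integral_def
  proof (rule Bochner_Integration.integral_cong[OF refl])
    fix t show "indicat_real {..x} t *\<^sub>R (h t * g t) = indicat_real {0..x} t *\<^sub>R (h t * g t)"
      using q_supp[of t] by (auto simp: indicator_def h_def)
  qed
  have SF: "S r x = F x" if x: "x \<in> {0..1}" for x
  proof -
    have si: "set_integrable lborel {0..x} (\<lambda>t. h t * c t)" "set_integrable lborel {0..x} (\<lambda>t. h t * sin_quot r t)"
      unfolding set_integrable_def using hC hD by (auto intro!: integrable_mult_indicator)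
    have add: "sin_quot r (x - t) = sin_quot r x * c t - c x * sin_quot r t" for t
      by (simp add: sin_quot_def c_def right_diff_distrib sin_diff diff_divide_distrib)
    have "S r x = sin_quot r x + (LINT t:{0..x}|lborel. sin_quot r x * (h t * c t) - c x * (h t * sin_quot r t))"
      unfolding S_volterra[OF x, of r] add by (simp add: h_def algebra_simps scaleR_conv_of_real)
    also have "(LINT t:{0..x}|lborel. sin_quot r x * (h t * c t) - c x * (h t * sin_quot r t)) =
        sin_quot r x * (LINT t:{0..x}|lborel. h t * c t) - c x * (LINT t:{0..x}|lborel. h t * sin_quot r t)"
      using si by (subst set_integral_diff(2)) auto
    also have "(LINT t:{0..x}|lborel. h t * c t) = C x"
      unfolding C_def using h0[of x c] x by (simp add: c_def)
    also have "(LINT t:{0..x}|lborel. h t * sin_quot r t) = D x"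
      unfolding D_def using h0[of x "sin_quot r"] x by simp
    finally show ?thesis by (simp add: F_def algebra_simps)
  qed
  have null0: "(LINT t:{..0}|lborel. h t * g t) = 0" for g
    unfolding set_lebesgue_integral_def
  proof (rule integral_eq_zero_AE)
    show "AE t in lborel. indicat_real {..0} t *\<^sub>R (h t * g t) = 0"
      using AE_lborel_singleton[of 0]
    proof eventually_elim
      case (elim t)
      then show ?case using q_supp[of t] by (auto simp: indicator_def h_def)
    qed
  qed
  have C0: "C 0 = 0" and D0: "D 0 = 0"
    unfolding C_def D_def using null0 by (simp_all add: c_def)
  obtain N where N: "N \<in> null_sets lebesgue" "\<And>t. t \<notin> N \<Longrightarrow> t \<in> {0<..<1} \<longrightarrow> (F has_vector_derivative F' t) (at t)"
    by (rule AE_lebesgueE[OF dF]) (rule that; assumption)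
  have cF': "continuous_on {0..1} F'"
    by (rule abs_cont_on_imp_continuous_on[OF acF'])
  have Fint: "F x - F 0 = integral {0..x} F'" if x: "x \<in> {0..1}" for x
  proof -
    have "(F' has_integral (F x - F 0)) {0..x}"
      by (rule abs_cont_on_FTC[OF abs_cont_on_subset[OF acF], of _ _ N])
         (use x N in \<open>auto simp: negligible_iff_null_sets\<close>)
    then show ?thesis by (simp add: integral_unique)
  qed
  have dS: "(S r has_vector_derivative F' x) (at x within {0..1})" if x: "x \<in> {0..1}" for x
  proof -
    have "((\<lambda>x. F 0 + integral {0..x} F') has_vector_derivative 0 + F' x) (at x within {0..1})"
      by (intro has_vector_derivative_add has_vector_derivative_const integral_has_vector_derivative cF' x)
    then have D: "((\<lambda>x. F 0 + integral {0..x} F') has_vector_derivative F' x) (at x within {0..1})"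
      by simp
    show ?thesis
    proof (rule has_vector_derivative_transform[OF x _ D])
      fix t :: real assume t: "t \<in> {0..1}"
      show "S r t = F 0 + integral {0..t} F'"
        using Fint[OF t] SF[OF t] by (simp add: algebra_simps)
    qed
  qed
  show "SL_solution q (r\<^sup>2) (S r)"
    unfolding SL_solution_def
  proof (rule exI[of _ F'], intro conjI ballI)
    show "(S r has_vector_derivative F' x) (at x within {0..1})" if "x \<in> {0..1}" for x
      by (rule dS[OF that])
    show "abs_cont_on 0 1 F'" by (rule acF')
    show "AE x in lebesgue. x \<in> {0<..<1} \<longrightarrow> (\<exists>y''. (F' has_vector_derivative y'') (at x) \<and> - y'' + complex_of_real (q x) * S r x = r\<^sup>2 * S r x)"
      using dF'
    proof eventually_elim
      case (elim x)
      show ?case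
      proof
        assume x: "x \<in> {0<..<1}"
        then have "S r x = F x" by (intro SF) auto
        then have "- (h x - r\<^sup>2 * F x) + complex_of_real (q x) * S r x = r\<^sup>2 * S r x"
          by (simp add: h_def scaleR_conv_of_real)
        then show "\<exists>y''. (F' has_vector_derivative y'') (at x) \<and> - y'' + complex_of_real (q x) * S r x = r\<^sup>2 * S r x"
          using elim x by (intro exI[of _ "h x - r\<^sup>2 * F x"] conjI) auto
      qed
    qed
  qed
  show "S r 0 = 0"
    using SF[of 0] by (simp add: F_def D0)
  have "deriv01 (S r) 0 = F' 0"
    by (rule vector_derivative_within_closed_interval[of 0 1, simplified]) (use dS[of 0] in auto)
  also have "F' 0 = 1" by (simp add: F'_def C0 c_def)
  finally show "deriv01 (S r) 0 = 1" .
qed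

text \<open>
  Together with the existence of \<open>S\<close> this shows that the choice in \<open>S_sol\<close> is immaterial on \<open>[0, 1]\<close>.
  The second part is the characteristic function as a Wronskian.
\<close>
lemma SL_solution_eq_S:
  assumes sl: "SL_solution q (r\<^sup>2) y" and y0: "y 0 = 0" and y1: "deriv01 y 0 = 1"
  shows "\<And>x. x \<in> {0..1} \<Longrightarrow> y x = S r x"
    and "y 1 * cos r - deriv01 y 1 * sin_quot r 1 = - (LINT t:{0..1}|lborel. q t *\<^sub>R (y t * sin_quot r t))"
proof -
  obtain y' where dy: "\<forall>x\<in>{0..1}. (y has_vector_derivative y' x) (at x within {0..1})"
    and ac: "abs_cont_on 0 1 y'"
    and ode: "AE x in lebesgue. x \<in> {0<..<1} \<longrightarrow>
           (\<exists>y''. (y' has_vector_derivative y'') (at x) \<and> - y'' + complex_of_real (q x) * y x = r\<^sup>2 * y x)"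
    using sl unfolding SL_solution_def by blast
  have dv: "deriv01 y x = y' x" if "x \<in> {0..1}" for x
    by (rule vector_derivative_within_closed_interval[of 0 1, simplified]) (use dy that in auto)
  have cy: "continuous_on {0..1} y"
    by (rule continuous_on_vector_derivative[OF bspec[OF dy]])
  have leb: "(LINT t:{0..x}|lborel. q t *\<^sub>R (y t * w t)) = integral {0..x} (\<lambda>t. q t *\<^sub>R (y t * w t))"
    if x: "x \<in> {0..1}" and w: "continuous_on UNIV w" for x w
  proof (rule set_borel_integral_eq_integral(2))
    define f where "f = (\<lambda>x. indicat_real {0..1} x *\<^sub>R y x)"
    have fm: "f \<in> borel_measurable borel"
      unfolding f_def by (rule borel_measurable_continuous_on_indicator[OF _ cy]) simp
    have wm: "w \<in> borel_measurable borel" by (rule borel_measurable_continuous_onI[OF w])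
    obtain G where G: "G \<ge> 0" "\<forall>t\<in>{0..1}. norm (w t) \<le> G" using continuous_bounded_Icc[OF w] by blast
    have "compact (y ` {0..1})"
      by (rule compact_continuous_image[OF cy]) auto
    then obtain C2 where C2: "C2 > 0" "\<forall>x\<in>y ` {0..1}. norm x \<le> C2"
      using compact_imp_bounded bounded_pos by blast
    have "set_integrable lborel {0..x} (\<lambda>t. q t *\<^sub>R (f t * w t))"
    proof (rule set_integrable_q[where C = "C2 * G"])
      show "norm (f t * w t) \<le> C2 * G" if "t \<in> {0..x}" for t
        unfolding norm_mult using C2 G that x by (intro mult_mono) (auto simp: f_def)
    qed (use fm wm in measurable)
    moreover have "set_integrable lborel {0..x} (\<lambda>t. q t *\<^sub>R (f t * w t)) \<longleftrightarrow> set_integrable lborel {0..x} (\<lambda>t. q t *\<^sub>R (y t * w t))"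
      by (rule set_integrable_cong) (use x in \<open>auto simp: f_def\<close>)
    ultimately show "set_integrable lborel {0..x} (\<lambda>t. q t *\<^sub>R (y t * w t))" by simp
  qed
  have volt: "y x = sin_quot r x + (LINT t:{0..x}|lborel. q t *\<^sub>R (sin_quot r (x - t) * y t))" if x: "x \<in> {0..1}" for x
  proof -
    define w where "w = (\<lambda>t. sin_quot r (x - t))"
    define w' where "w' = (\<lambda>t. - cos (r * complex_of_real (x - t)))"
    have lin: "((\<lambda>t. x - t) has_vector_derivative -1) (at t)" for t :: real
      by (auto intro!: derivative_eq_intros simp: has_real_derivative_iff_has_vector_derivative[symmetric])
    have dw: "(w has_vector_derivative w' t) (at t)" for t
      using vector_diff_chain_at[OF lin sin_quot_has_vector_derivative[of r "x - t" UNIV]] by (simp add: w_def w'_def o_def)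
    have "((\<lambda>t. cos (r * complex_of_real (x - t))) has_vector_derivative r\<^sup>2 * w t) (at t)" for t
      using vector_diff_chain_at[OF lin cos_has_vector_derivative[of r "x - t" UNIV]] by (simp add: w_def o_def)
    from has_vector_derivative_minus[OF this] have dw': "(w' has_vector_derivative - (r\<^sup>2 * w t)) (at t)" for t
      by (simp add: w'_def)
    from integral_unique[OF wronskian_identity[OF dy ac ode dw dw' x]]
    have e: "- integral {0..x} (\<lambda>t. q t *\<^sub>R (y t * w t)) = - y x + w 0"
      using y0 y1 dv[of 0] by (simp add: w_def w'_def)
    have "y x = w 0 - (- y x + w 0)" by simp
    also have "\<dots> = w 0 - (- integral {0..x} (\<lambda>t. q t *\<^sub>R (y t * w t)))"
      by (simp only: e)
    finally have "y x = w 0 + integral {0..x} (\<lambda>t. q t *\<^sub>R (y t * w t))" by simp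
    moreover have "continuous_on UNIV w"
      by (rule continuous_on_vector_derivative[OF has_vector_derivative_at_within[OF dw]])
    ultimately show ?thesis
      using leb[OF x, of w] by (simp add: w_def mult.commute)
  qed
  show "\<And>x. x \<in> {0..1} \<Longrightarrow> y x = S r x"
    by (rule volterra_unique[OF cy volt])
  from integral_unique[OF wronskian_identity[OF dy ac ode sin_quot_has_vector_derivative cos_has_vector_derivative, of 1]]
  have "- integral {0..1} (\<lambda>t. q t *\<^sub>R (y t * sin_quot r t)) = y 1 * cos r - y' 1 * sin_quot r 1"
    using y0 by simp
  then show "y 1 * cos r - deriv01 y 1 * sin_quot r 1 = - (LINT t:{0..1}|lborel. q t *\<^sub>R (y t * sin_quot r t))"
    using leb[of 1 "sin_quot r"] dv[of 1] continuous_on_sin_quot by simp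
qed

text \<open>
  The density of the characteristic function with respect to \<open>cos_quot r (2 \<xi>)\<close>. The two values of
  \<open>a\<close> come from the two cosines in \<open>sin_quot r (\<xi> + \<eta>) * sin_quot r (\<xi> - \<eta>)\<close>.
\<close>
definition \<phi> :: "real \<Rightarrow> real" where
  "\<phi> \<xi> = q \<xi> / 2 + (LINT \<eta>|lborel. triangle_kernel q (\<xi>, \<eta>) * (a (\<xi>, \<eta>) - a (\<eta>, \<xi>))) / 2"

lemma char_fun_csqrt:
  "char_fun q z = - (LINT t:{0..1}|lborel. q t *\<^sub>R (S (csqrt z) t * sin_quot (csqrt z) t))"
proof -
  let ?r = "csqrt z"
  let ?P = "\<lambda>y. SL_solution q z y \<and> y 0 = 0 \<and> deriv01 y 0 = 1"
  have "?P (S ?r)"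
    using S_is_solution[of ?r] by simp
  then have "?P (S_sol q z)"
    unfolding S_sol_def by (rule someI[where P = ?P])
  then have sl: "SL_solution q (?r\<^sup>2) (S_sol q z)" "S_sol q z 0 = 0" "deriv01 (S_sol q z) 0 = 1"
    by simp_all
  have "char_fun q z = - (LINT t:{0..1}|lborel. q t *\<^sub>R (S_sol q z t * sin_quot ?r t))"
    unfolding char_fun_def by (rule SL_solution_eq_S(2)[OF sl])
  also have "(LINT t:{0..1}|lborel. q t *\<^sub>R (S_sol q z t * sin_quot ?r t)) = (LINT t:{0..1}|lborel. q t *\<^sub>R (S ?r t * sin_quot ?r t))"
    by (rule set_lebesgue_integral_cong) (use SL_solution_eq_S(1)[OF sl] in auto)
  finally show ?thesis .
qed

lemma kernel_slice_integrable:
  "integrable lborel (\<lambda>\<eta>. triangle_kernel q (\<xi>, \<eta>) * a (\<xi>, \<eta>))"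
  "integrable lborel (\<lambda>\<eta>. triangle_kernel q (\<xi>, \<eta>) * a (\<eta>, \<xi>))"
proof -
  have sh: "integrable lborel (\<lambda>\<eta>. B * q (\<xi> + \<eta>))"
    using lborel_integrable_real_affine[OF q_int, of 1 \<xi>] by simp
  have [measurable]: "triangle_kernel q \<in> borel_measurable (borel \<Otimes>\<^sub>M borel)"
    using borel_measurable_triangle_kernel[OF q_meas] by (simp add: borel_prod)
  have bd: "\<bar>triangle_kernel q (\<xi>, \<eta>) * x\<bar> \<le> \<bar>B * q (\<xi> + \<eta>)\<bar>"
    if x: "0 \<le> \<xi> \<Longrightarrow> 0 \<le> \<eta> \<Longrightarrow> \<xi> + \<eta> \<le> 1 \<Longrightarrow> \<bar>x\<bar> \<le> B" for \<eta> x
  proof (cases "triangle_kernel q (\<xi>, \<eta>) = 0")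
    case False
    from triangle_kernel_nonzeroD[OF this q_supp] have "\<bar>x\<bar> \<le> B" by (auto intro!: x)
    then have "\<bar>q (\<xi> + \<eta>)\<bar> * \<bar>x\<bar> \<le> \<bar>q (\<xi> + \<eta>)\<bar> * B" by (rule mult_left_mono) simp
    moreover have "\<bar>triangle_kernel q (\<xi>, \<eta>)\<bar> \<le> \<bar>q (\<xi> + \<eta>)\<bar>"
      by (simp add: triangle_kernel_eq indicator_def)
    then have "\<bar>triangle_kernel q (\<xi>, \<eta>)\<bar> * \<bar>x\<bar> \<le> \<bar>q (\<xi> + \<eta>)\<bar> * \<bar>x\<bar>"
      by (rule mult_right_mono) simp
    ultimately show ?thesis using B_nonneg by (simp add: abs_mult mult.commute)
  qed simp
  show "integrable lborel (\<lambda>\<eta>. triangle_kernel q (\<xi>, \<eta>) * a (\<xi>, \<eta>))"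
  proof (rule Bochner_Integration.integrable_bound[OF sh])
    show "AE \<eta> in lborel. norm (triangle_kernel q (\<xi>, \<eta>) * a (\<xi>, \<eta>)) \<le> norm (B * q (\<xi> + \<eta>))"
      unfolding real_norm_def by (intro AE_I2 bd a_bound)
  qed measurable
  show "integrable lborel (\<lambda>\<eta>. triangle_kernel q (\<xi>, \<eta>) * a (\<eta>, \<xi>))"
  proof (rule Bochner_Integration.integrable_bound[OF sh])
    show "AE \<eta> in lborel. norm (triangle_kernel q (\<xi>, \<eta>) * a (\<eta>, \<xi>)) \<le> norm (B * q (\<xi> + \<eta>))"
      unfolding real_norm_def by (intro AE_I2 bd a_bound) auto
  qed measurable
qed

lemma triangle_kernel_commute: "triangle_kernel q (\<eta>, \<xi>) = triangle_kernel q (\<xi>, \<eta>)"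
  by (simp add: triangle_kernel_eq add.commute mult.commute)

lemma \<phi>_alt: "\<phi> \<xi> = q \<xi> / 2 + ((LINT \<eta>|lborel. triangle_kernel q (\<xi>, \<eta>) * a (\<xi>, \<eta>)) -
    (LINT \<eta>|lborel. triangle_kernel q (\<xi>, \<eta>) * a (\<eta>, \<xi>))) / 2"
  unfolding \<phi>_def right_diff_distrib
  by (subst Bochner_Integration.integral_diff[OF kernel_slice_integrable]) simp

lemma one_in_Icc: "(1::real) \<in> {0..1}"
  by simp

text \<open>
  The main term \<open>q (sin_quot r)\<^sup>2\<close> gives \<open>q / 2\<close> because \<open>cos_quot r\<close> vanishes at 0. In the kernel
  term one cosine depends on \<open>\<xi>\<close> only and the other one on \<open>\<eta>\<close> only, and integrating out the
  respective other variable leaves a single integral.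
\<close>
lemma wronskian_integral:
  "(LINT t:{0..1}|lborel. q t *\<^sub>R (S r t * sin_quot r t)) = (LINT \<xi>|lborel. \<phi> \<xi> *\<^sub>R cos_quot r (2 * \<xi>))"
proof -
  define c where "c = (\<lambda>x. cos_quot r (2 * x) / 2)"
  have cc: "continuous_on UNIV c"
    unfolding c_def by (intro continuous_intros continuous_on_compose2[OF continuous_on_cos_quot[of UNIV]]) auto
  then have cm [measurable]: "c \<in> borel_measurable borel"
    by (rule borel_measurable_continuous_onI)
  obtain B3 where B3: "B3 \<ge> 0" "\<And>t. t \<in> {0..1} \<Longrightarrow> norm (c t) \<le> B3"
    using continuous_bounded_Icc[OF cc, of 0 1] by blast
  obtain B2 where B2: "B2 \<ge> 0" "\<And>t. t \<in> {-2..2} \<Longrightarrow> norm (sin_quot r t) \<le> B2"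
    using sin_quot_bounded by blast
  define P where "P = (\<lambda>s. triangle_kernel q s *\<^sub>R (a s *\<^sub>R c (fst s)))"
  define P' where "P' = (\<lambda>s. triangle_kernel q s *\<^sub>R (a s *\<^sub>R c (snd s)))"
  have bnd: "\<bar>a (\<xi>, \<eta>)\<bar> * norm (c x) \<le> B * B3" if "0 \<le> \<xi>" "0 \<le> \<eta>" "\<xi> + \<eta> \<le> 1" "x \<in> {0..1}" for \<xi> \<eta> x
    using a_bound[OF that(1-3)] B3(2)[OF that(4)] B_nonneg by (intro mult_mono) auto
  have Pi: "integrable lborel P"
    unfolding P_def
  proof (rule integrable_triangle_kernel_scaleR[OF q_int q_supp, where B = "B * B3"])
    show "(\<lambda>s. a s *\<^sub>R c (fst s)) \<in> borel_measurable borel"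
      unfolding borel_prod[symmetric] by measurable
  qed (use bnd in auto)
  have P'i: "integrable lborel P'"
    unfolding P'_def
  proof (rule integrable_triangle_kernel_scaleR[OF q_int q_supp, where B = "B * B3"])
    show "(\<lambda>s. a s *\<^sub>R c (snd s)) \<in> borel_measurable borel"
      unfolding borel_prod[symmetric] by measurable
  qed (use bnd in auto)
  have s1: "norm (sin_quot r t) \<le> B2" if "t \<in> {0..1}" for t
    using B2(2)[of t] that by auto
  have i1: "set_integrable lborel {0..1} (\<lambda>t. q t *\<^sub>R (sin_quot r t * sin_quot r t))"
  proof (rule set_integrable_q[where C = "B2 * B2"])
    show "norm (sin_quot r t * sin_quot r t) \<le> B2 * B2" if "t \<in> {0..1}" for t
      unfolding norm_mult using s1[OF that] B2(1) by (intro mult_mono) auto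
  qed measurable
  have i2: "set_integrable lborel {0..1} (\<lambda>t. q t *\<^sub>R (sin_quot r t * kernel_term r t))"
  proof (rule set_integrable_q[where C = "B2 * (B * B2)"])
    show "norm (sin_quot r t * kernel_term r t) \<le> B2 * (B * B2)" if "t \<in> {0..1}" for t
      unfolding norm_mult using s1[OF that] kernel_term_bound[OF B2 that] B2(1) by (intro mult_mono) auto
  qed measurable
  have "(LINT t:{0..1}|lborel. q t *\<^sub>R (S r t * sin_quot r t)) =
      (LINT t:{0..1}|lborel. q t *\<^sub>R (sin_quot r t * sin_quot r t) + q t *\<^sub>R (sin_quot r t * kernel_term r t))"
    by (simp add: S_def algebra_simps)
  also have "\<dots> = (LINT t:{0..1}|lborel. q t *\<^sub>R (sin_quot r t * sin_quot r t)) + (LINT t:{0..1}|lborel. q t *\<^sub>R (sin_quot r t * kernel_term r t))"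
    by (rule set_integral_add(2)[OF i1 i2])
  also have "(LINT t:{0..1}|lborel. q t *\<^sub>R (sin_quot r t * sin_quot r t)) = (LINT t|lborel. q t *\<^sub>R c t)"
    unfolding set_lebesgue_integral_def
  proof (rule Bochner_Integration.integral_cong[OF refl])
    fix t show "indicat_real {0..1} t *\<^sub>R q t *\<^sub>R (sin_quot r t * sin_quot r t) = q t *\<^sub>R c t"
      using q_supp[of t] by (cases "t \<in> {0..1}") (auto simp: sin_quot_mult c_def)
  qed
  also have "(LINT t:{0..1}|lborel. q t *\<^sub>R (sin_quot r t * kernel_term r t)) = (LINT s|lborel. P s - P' s)"
    unfolding kernel_term_def kernel_swap[OF continuous_on_sin_quot one_in_Icc]
  proof (rule Bochner_Integration.integral_cong[OF refl])
    fix s :: "real \<times> real"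
    show "triangle_kernel q s *\<^sub>R (indicat_real {..1} (fst s + snd s) *\<^sub>R (a s *\<^sub>R (sin_quot r (fst s + snd s) * sin_quot r (fst s - snd s)))) = P s - P' s"
    proof (cases "triangle_kernel q s = 0")
      case False
      from triangle_kernel_nonzeroD[OF this q_supp] have "fst s + snd s \<le> 1" by simp
      moreover have "sin_quot r (fst s + snd s) * sin_quot r (fst s - snd s) = c (fst s) - c (snd s)"
        unfolding sin_quot_mult c_def by (simp add: diff_divide_distrib)
      ultimately show ?thesis by (simp add: P_def P'_def scaleR_diff_right)
    qed (simp add: P_def P'_def)
  qed
  also have "(LINT s|lborel. P s - P' s) = (LINT s|lborel. P s) - (LINT s|lborel. P' s)"
    by (rule Bochner_Integration.integral_diff[OF Pi P'i])
  finally have 1: "(LINT t:{0..1}|lborel. q t *\<^sub>R (S r t * sin_quot r t)) = (LINT t|lborel. q t *\<^sub>R c t) + ((LINT s|lborel. P s) - (LINT s|lborel. P' s))" .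
  define M1 where "M1 = (\<lambda>\<xi>. LINT \<eta>|lborel. triangle_kernel q (\<xi>, \<eta>) * a (\<xi>, \<eta>))"
  define M2 where "M2 = (\<lambda>\<xi>. LINT \<eta>|lborel. triangle_kernel q (\<xi>, \<eta>) * a (\<eta>, \<xi>))"
  have PM: "(LINT \<eta>|lborel. P (\<xi>, \<eta>)) = M1 \<xi> *\<^sub>R c \<xi>" for \<xi>
    unfolding P_def M1_def
    by (simp only: scaleR_scaleR fst_conv) (rule integral_scaleR_left[OF kernel_slice_integrable(1)])
  have P'M: "(LINT \<xi>|lborel. P' (\<xi>, \<eta>)) = M2 \<eta> *\<^sub>R c \<eta>" for \<eta>
    unfolding P'_def M2_def
    by (simp only: scaleR_scaleR snd_conv triangle_kernel_commute[of _ \<eta>])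
       (rule integral_scaleR_left[OF kernel_slice_integrable(2)])
  have Pi': "integrable (lborel \<Otimes>\<^sub>M lborel) P" and P'i': "integrable (lborel \<Otimes>\<^sub>M lborel) (case_prod (\<lambda>x y. P' (x, y)))"
    using Pi P'i by (simp_all add: lborel_prod)
  have 2: "(LINT s|lborel. P s) = (LINT \<xi>|lborel. M1 \<xi> *\<^sub>R c \<xi>)"
    using lborel_pair.integral_fst'[OF Pi'] by (simp add: lborel_prod PM)
  have 3: "(LINT s|lborel. P' s) = (LINT \<xi>|lborel. M2 \<xi> *\<^sub>R c \<xi>)"
    using lborel_pair.integral_snd[OF P'i'] by (simp add: lborel_prod P'M)
  have m1: "integrable lborel (\<lambda>\<xi>. M1 \<xi> *\<^sub>R c \<xi>)"
    using lborel_pair.integrable_fst'[OF Pi'] by (simp add: PM)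
  have m2: "integrable lborel (\<lambda>\<xi>. M2 \<xi> *\<^sub>R c \<xi>)"
    using lborel_pair.integrable_snd[OF P'i'] by (simp add: P'M)
  have m0: "integrable lborel (\<lambda>\<xi>. q \<xi> *\<^sub>R c \<xi>)"
  proof -
    have "set_integrable lborel {0..1} (\<lambda>t. q t *\<^sub>R c t)"
      by (rule set_integrable_q[where C = B3]) (use B3 in auto)
    moreover have "(\<lambda>t. indicat_real {0..1} t *\<^sub>R (q t *\<^sub>R c t)) = (\<lambda>t. q t *\<^sub>R c t)"
    proof
      fix t show "indicat_real {0..1} t *\<^sub>R (q t *\<^sub>R c t) = q t *\<^sub>R c t"
        using q_supp[of t] by (cases "t \<in> {0..1}") auto
    qed
    ultimately show ?thesis by (simp only: set_integrable_def)
  qed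
  have \<phi>M: "\<phi> \<xi> = q \<xi> / 2 + (M1 \<xi> - M2 \<xi>) / 2" for \<xi>
    unfolding \<phi>_alt M1_def M2_def ..
  have "\<phi> \<xi> *\<^sub>R cos_quot r (2 * \<xi>) = q \<xi> *\<^sub>R c \<xi> + (M1 \<xi> *\<^sub>R c \<xi> - M2 \<xi> *\<^sub>R c \<xi>)" for \<xi>
    unfolding \<phi>M c_def by (simp add: scaleR_conv_of_real field_simps)
  then have "(LINT \<xi>|lborel. \<phi> \<xi> *\<^sub>R cos_quot r (2 * \<xi>)) = (LINT \<xi>|lborel. q \<xi> *\<^sub>R c \<xi>) + ((LINT \<xi>|lborel. M1 \<xi> *\<^sub>R c \<xi>) - (LINT \<xi>|lborel. M2 \<xi> *\<^sub>R c \<xi>))"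
    using Bochner_Integration.integral_add[OF m0 Bochner_Integration.integrable_diff[OF m1 m2]] Bochner_Integration.integral_diff[OF m1 m2] by simp
  with 1 2 3 show ?thesis by simp
qed

lemma cos_quot_minus_left: "cos_quot (- r) x = cos_quot r x"
  by (simp add: cos_quot_def)

theorem char_fun_eq: "char_fun q (r\<^sup>2) = - (LINT \<xi>|lborel. \<phi> \<xi> *\<^sub>R cos_quot r (2 * \<xi>))"
proof -
  have "csqrt (r\<^sup>2) = r \<or> csqrt (r\<^sup>2) = - r"
    using power2_eq_iff[of "csqrt (r\<^sup>2)" r] by simp
  then have "cos_quot (csqrt (r\<^sup>2)) x = cos_quot r x" for x
    using cos_quot_minus_left[of r x] by metis
  then show ?thesis
    unfolding char_fun_csqrt wronskian_integral by simp
qed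

text \<open>
  The correction is quadratic in the potential: an integral of \<open>q\<close> against the bounded kernel. So
  \<open>\<phi>\<close> inherits square integrability from \<open>q\<close>.
\<close>
lemma \<phi>_bound: "\<bar>\<phi> \<xi> - q \<xi> / 2\<bar> \<le> B * (LINT t|lborel. \<bar>q t\<bar>)"
proof -
  have sh: "integrable lborel (\<lambda>\<eta>. q (\<xi> + \<eta>))"
    using lborel_integrable_real_affine[OF q_int, of 1 \<xi>] by simp
  have shi: "(LINT \<eta>|lborel. \<bar>q (\<xi> + \<eta>)\<bar>) = (LINT t|lborel. \<bar>q t\<bar>)"
    using lborel_integral_real_affine[of 1 "\<lambda>t. \<bar>q t\<bar>" \<xi>] by simp
  have i: "integrable lborel (\<lambda>\<eta>. triangle_kernel q (\<xi>, \<eta>) * (a (\<xi>, \<eta>) - a (\<eta>, \<xi>)))"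
    unfolding right_diff_distrib by (rule Bochner_Integration.integrable_diff[OF kernel_slice_integrable])
  have "\<bar>LINT \<eta>|lborel. triangle_kernel q (\<xi>, \<eta>) * (a (\<xi>, \<eta>) - a (\<eta>, \<xi>))\<bar> \<le>
      (LINT \<eta>|lborel. \<bar>triangle_kernel q (\<xi>, \<eta>) * (a (\<xi>, \<eta>) - a (\<eta>, \<xi>))\<bar>)"
    using integral_norm_bound[of lborel "\<lambda>\<eta>. triangle_kernel q (\<xi>, \<eta>) * (a (\<xi>, \<eta>) - a (\<eta>, \<xi>))"] by simp
  also have "\<dots> \<le> (LINT \<eta>|lborel. 2 * B * \<bar>q (\<xi> + \<eta>)\<bar>)"
  proof (rule integral_mono)
    show "integrable lborel (\<lambda>\<eta>. \<bar>triangle_kernel q (\<xi>, \<eta>) * (a (\<xi>, \<eta>) - a (\<eta>, \<xi>))\<bar>)"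
      by (rule integrable_abs[OF i])
    show "integrable lborel (\<lambda>\<eta>. 2 * B * \<bar>q (\<xi> + \<eta>)\<bar>)"
      by (rule integrable_mult_right) (rule integrable_abs[OF sh])
    fix \<eta>
    show "\<bar>triangle_kernel q (\<xi>, \<eta>) * (a (\<xi>, \<eta>) - a (\<eta>, \<xi>))\<bar> \<le> 2 * B * \<bar>q (\<xi> + \<eta>)\<bar>"
    proof (cases "triangle_kernel q (\<xi>, \<eta>) = 0")
      case True
      then show ?thesis using B_nonneg by simp
    next
      case False
      from triangle_kernel_nonzeroD[OF this q_supp] have "\<bar>a (\<xi>, \<eta>)\<bar> \<le> B" "\<bar>a (\<eta>, \<xi>)\<bar> \<le> B"
        using a_bound[of \<xi> \<eta>] a_bound[of \<eta> \<xi>] by auto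
      then have "\<bar>a (\<xi>, \<eta>) - a (\<eta>, \<xi>)\<bar> \<le> 2 * B" by linarith
      moreover have "\<bar>triangle_kernel q (\<xi>, \<eta>)\<bar> \<le> \<bar>q (\<xi> + \<eta>)\<bar>"
        by (simp add: triangle_kernel_eq indicator_def)
      ultimately have "\<bar>triangle_kernel q (\<xi>, \<eta>)\<bar> * \<bar>a (\<xi>, \<eta>) - a (\<eta>, \<xi>)\<bar> \<le> \<bar>q (\<xi> + \<eta>)\<bar> * (2 * B)"
        by (intro mult_mono) auto
      then show ?thesis by (simp add: abs_mult mult_ac)
    qed
  qed
  also have "\<dots> = 2 * (B * (LINT t|lborel. \<bar>q t\<bar>))"
    using shi by simp
  finally show ?thesis by (simp add: \<phi>_def)
qed

lemma \<phi>_supp: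
  assumes "\<xi> \<notin> {0..1}"
  shows "\<phi> \<xi> = 0"
proof -
  have "triangle_kernel q (\<xi>, \<eta>) = 0" for \<eta>
  proof (rule ccontr)
    assume "triangle_kernel q (\<xi>, \<eta>) \<noteq> 0"
    from triangle_kernel_nonzeroD[OF this q_supp] show False
      using assms by auto
  qed
  then show ?thesis
    using q_supp[OF assms] by (simp add: \<phi>_def)
qed

lemma \<phi>_meas [measurable]: "\<phi> \<in> borel_measurable borel"
proof -
  have [measurable]: "triangle_kernel q \<in> borel_measurable (borel \<Otimes>\<^sub>M borel)"
    using borel_measurable_triangle_kernel[OF q_meas] by (simp add: borel_prod)
  have "(\<lambda>(\<xi>, \<eta>). triangle_kernel q (\<xi>, \<eta>) * (a (\<xi>, \<eta>) - a (\<eta>, \<xi>))) \<in> borel_measurable (borel \<Otimes>\<^sub>M lborel)"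
    by measurable
  then have [measurable]: "(\<lambda>\<xi>. LINT \<eta>|lborel. triangle_kernel q (\<xi>, \<eta>) * (a (\<xi>, \<eta>) - a (\<eta>, \<xi>))) \<in> borel_measurable borel"
    by (rule lborel.borel_measurable_lebesgue_integral)
  show ?thesis
    unfolding \<phi>_def[abs_def] by measurable
qed

end

section \<open>Characteristic functions as sine transforms\<close>
text \<open>
  Square integrability on a bounded interval leaves the values outside and on null sets open. A Borel
  representative that vanishes outside avoids both, and then it is integrable as well.
\<close>
lemma L2_on_borelE:
  assumes "L2_on a b f"
  obtains g where "g \<in> borel_measurable borel" "\<And>x. x \<notin> {a<..<b} \<Longrightarrow> g x = 0"
    "AE x in lebesgue. x \<in> {a<..<b} \<longrightarrow> g x = f x"
    "integrable lborel g" "integrable lborel (\<lambda>x. (g x)\<^sup>2)"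
proof -
  have m: "(\<lambda>x. indicat_real {a<..<b} x *\<^sub>R f x) \<in> borel_measurable lebesgue"
    and i: "integrable lebesgue (\<lambda>x. indicat_real {a<..<b} x *\<^sub>R (f x)\<^sup>2)"
    using assms by (auto simp: L2_on_def set_borel_measurable_def set_integrable_def)
  obtain h where h: "h \<in> borel_measurable lborel" "AE x in lborel. indicat_real {a<..<b} x *\<^sub>R f x = h x"
    using completion_ex_borel_measurable_real[OF m] by auto
  define g where "g = (\<lambda>x. indicat_real {a<..<b} x * h x)"
  have gm: "g \<in> borel_measurable borel"
    unfolding g_def using h(1) by measurable
  have ae: "AE x in lebesgue. indicat_real {a<..<b} x *\<^sub>R f x = h x"
    by (rule AE_completion[OF h(2)])
  have sq: "integrable lebesgue (\<lambda>x. (g x)\<^sup>2)"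
  proof (rule integrable_cong_AE_imp[OF i])
    show "(\<lambda>x. (g x)\<^sup>2) \<in> borel_measurable lebesgue"
      using gm by (intro borel_measurable_power measurable_completion) simp
    show "AE x in lebesgue. indicat_real {a<..<b} x *\<^sub>R (f x)\<^sup>2 = (g x)\<^sup>2"
      using ae by eventually_elim (auto simp: g_def indicator_def)
  qed
  have sq': "integrable lborel (\<lambda>x. (g x)\<^sup>2)"
    using sq gm by (subst (asm) integrable_completion) auto
  have "integrable lborel g"
  proof (rule Bochner_Integration.integrable_bound)
    show "integrable lborel (\<lambda>x. indicat_real {a<..<b} x + (g x)\<^sup>2)"
      by (intro Bochner_Integration.integrable_add sq' integrable_real_indicator) (use emeasure_bounded_finite[of "{a<..<b}"] in auto)
    show "AE x in lborel. norm (g x) \<le> norm (indicat_real {a<..<b} x + (g x)\<^sup>2)"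
    proof (rule AE_I2)
      fix x
      have "\<bar>g x\<bar> \<le> 1 + (g x)\<^sup>2"
        using sum_squares_bound[of "\<bar>g x\<bar>" 1] by (simp add: power2_eq_square)
      then show "norm (g x) \<le> norm (indicat_real {a<..<b} x + (g x)\<^sup>2)"
        by (auto simp: g_def indicator_def)
    qed
  qed (use gm in simp)
  moreover have "AE x in lebesgue. x \<in> {a<..<b} \<longrightarrow> g x = f x"
    using ae by eventually_elim (auto simp: g_def indicator_def)
  ultimately show thesis
    by (intro that[of g] gm sq') (auto simp: g_def)
qed

lemma L2_onI:
  assumes g: "g \<in> borel_measurable borel" and i: "integrable lborel (\<lambda>x. (g x)\<^sup>2)"
  shows "L2_on a b g"
  unfolding L2_on_def set_borel_measurable_def set_integrable_def
proof
  show "(\<lambda>x. indicat_real {a<..<b} x *\<^sub>R g x) \<in> borel_measurable lebesgue"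
    using g by (intro measurable_completion) simp
  have "integrable lborel (\<lambda>x. indicat_real {a<..<b} x *\<^sub>R (g x)\<^sup>2)"
    by (rule integrable_mult_indicator[OF _ i]) simp
  then show "integrable lebesgue (\<lambda>x. indicat_real {a<..<b} x *\<^sub>R (g x)\<^sup>2)"
    using g by (subst integrable_completion) auto
qed

text \<open>
  The boundary terms vanish as \<open>u 2 = 0\<close> and \<open>cos_quot r 0 = 0\<close>.
\<close>
lemma sine_transform_by_parts:
  fixes u v g :: "real \<Rightarrow> real"
  assumes ac: "abs_cont_on 0 2 u" and u2: "u 2 = 0"
    and du: "AE x in lebesgue. x \<in> {0<..<2} \<longrightarrow> (u has_real_derivative v x) (at x)"
    and gv: "AE x in lebesgue. x \<in> {0<..<2} \<longrightarrow> g x = v x"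
    and g: "integrable lborel g" and g0: "\<And>x. x \<notin> {0..2} \<Longrightarrow> g x = 0"
  shows "integral {0..2} (\<lambda>x. complex_of_real (u x) * sin_quot r x) = - (LINT x|lborel. g x *\<^sub>R cos_quot r x)"
proof -
  define U where "U = (\<lambda>x. complex_of_real (u x))"
  have acU: "abs_cont_on 0 2 U"
    using ac unfolding abs_cont_on_def U_def by (simp flip: of_real_diff)
  have acc: "abs_cont_on 0 2 (cos_quot r)"
    by (rule abs_cont_on_C1[OF cos_quot_has_vector_derivative continuous_on_sin_quot])
  have "AE x in lebesgue. x \<in> {0<..<2} \<longrightarrow> (u has_real_derivative g x) (at x)"
    using du gv by eventually_elim auto
  then obtain N where N: "N \<in> null_sets lebesgue" "\<And>x. x \<notin> N \<Longrightarrow> x \<in> {0<..<2} \<longrightarrow> (u has_real_derivative g x) (at x)"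
    by (rule AE_lebesgueE) (rule that; assumption)
  have "((\<lambda>x. U x * sin_quot r x + complex_of_real (g x) * cos_quot r x) has_integral U 2 * cos_quot r 2 - U 0 * cos_quot r 0) {0..2}"
  proof (rule abs_cont_on_FTC[OF abs_cont_on_mult[OF acU acc]])
    show "negligible N" using N(1) by (simp add: negligible_iff_null_sets)
    fix x assume x: "x \<in> {0<..<2} - N"
    then have "(u has_real_derivative g x) (at x)" using N(2)[of x] by simp
    then have "(U has_vector_derivative complex_of_real (g x)) (at x)"
      unfolding U_def by (rule has_vector_derivative_of_real)
    then show "((\<lambda>x. U x * cos_quot r x) has_vector_derivative U x * sin_quot r x + complex_of_real (g x) * cos_quot r x) (at x)"
      by (rule has_vector_derivative_mult[OF _ cos_quot_has_vector_derivative])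
  qed simp
  then have 1: "((\<lambda>x. U x * sin_quot r x + complex_of_real (g x) * cos_quot r x) has_integral 0) {0..2}"
    using u2 by (simp add: U_def)
  obtain C where C: "C \<ge> 0" "\<forall>x\<in>{0..2}. norm (cos_quot r x) \<le> C"
    using continuous_bounded_Icc[OF continuous_on_cos_quot] by blast
  have gm: "g \<in> borel_measurable borel"
    using g borel_measurable_integrable by auto
  have gi: "integrable lborel (\<lambda>x. g x *\<^sub>R cos_quot r x)"
  proof (rule Bochner_Integration.integrable_bound)
    show "integrable lborel (\<lambda>x. C * g x)" using g by simp
    show "(\<lambda>x. g x *\<^sub>R cos_quot r x) \<in> borel_measurable lborel" using gm by measurable
    show "AE x in lborel. norm (g x *\<^sub>R cos_quot r x) \<le> norm (C * g x)"
    proof (rule AE_I2)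
      fix x show "norm (g x *\<^sub>R cos_quot r x) \<le> norm (C * g x)"
      proof (cases "x \<in> {0..2}")
        case True
        then have "\<bar>g x\<bar> * norm (cos_quot r x) \<le> \<bar>g x\<bar> * C" using C by (intro mult_left_mono) auto
        then show ?thesis using C(1) by (simp add: abs_mult mult.commute)
      qed (use g0[of x] in simp)
    qed
  qed
  have eq: "indicat_real {0..2} x *\<^sub>R (g x *\<^sub>R cos_quot r x) = g x *\<^sub>R cos_quot r x" for x
    using g0[of x] by (cases "x \<in> {0..2}") auto
  have si: "set_integrable lborel {0..2} (\<lambda>x. g x *\<^sub>R cos_quot r x)"
    unfolding set_integrable_def eq by (rule gi)
  have "((\<lambda>x. g x *\<^sub>R cos_quot r x) has_integral (LINT x:{0..2}|lborel. g x *\<^sub>R cos_quot r x)) {0..2}"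
    using set_borel_integral_eq_integral[OF si] by (simp add: has_integral_integral)
  moreover have "(LINT x:{0..2}|lborel. g x *\<^sub>R cos_quot r x) = (LINT x|lborel. g x *\<^sub>R cos_quot r x)"
    unfolding set_lebesgue_integral_def eq ..
  ultimately have 2: "((\<lambda>x. complex_of_real (g x) * cos_quot r x) has_integral (LINT x|lborel. g x *\<^sub>R cos_quot r x)) {0..2}"
    by (simp only: scaleR_conv_of_real)
  from has_integral_diff[OF 1 2] show ?thesis
    by (auto simp: U_def intro: integral_unique)
qed

lemma W12_antiderivative:
  assumes v: "integrable lborel v" and v2: "integrable lborel (\<lambda>x. (v x)\<^sup>2)" and v0: "\<And>x. x \<notin> {0..2} \<Longrightarrow> v x = 0"
  defines "u \<equiv> \<lambda>x. (LINT t:{..x}|lborel. v t) + (- (LINT t|lborel. v t))"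
  shows "W12_on 0 2 u" "u 2 = 0"
    "AE x in lebesgue. x \<in> {0<..<2} \<longrightarrow> (u has_real_derivative v x) (at x)"
proof -
  have ac: "abs_cont_on 0 2 u"
    unfolding u_def by (intro abs_cont_on_add abs_cont_on_indefinite_integral[OF v] abs_cont_on_lipschitz[where L = 0]) auto
  show du: "AE x in lebesgue. x \<in> {0<..<2} \<longrightarrow> (u has_real_derivative v x) (at x)"
    using AE_indefinite_integral_has_vector_derivative[OF v, of 0 2]
  proof eventually_elim
    case (elim x)
    show ?case
    proof
      assume "x \<in> {0<..<2}"
      with elim have "((\<lambda>x. LINT t:{..x}|lborel. v t) has_real_derivative v x) (at x)"
        by (simp add: has_real_derivative_iff_has_vector_derivative)
      then show "(u has_real_derivative v x) (at x)"
        unfolding u_def by (rule DERIV_add[OF _ DERIV_const, THEN DERIV_cong]) simp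
    qed
  qed
  show "W12_on 0 2 u"
    unfolding W12_on_def using ac du L2_onI[OF _ v2] v borel_measurable_integrable by auto
  have "(LINT t:{..2}|lborel. v t) = (LINT t|lborel. v t)"
    unfolding set_lebesgue_integral_def
  proof (rule Bochner_Integration.integral_cong[OF refl])
    fix t show "indicat_real {..2} t *\<^sub>R v t = v t"
      using v0[of t] by (cases "t \<in> {0..2}") auto
  qed
  then show "u 2 = 0" by (simp add: u_def)
qed

lemma char_fun_cong_AE:
  assumes "AE x in lebesgue. x \<in> {0<..<1} \<longrightarrow> q x = q' x"
  shows "char_fun q = char_fun q'"
proof -
  have imp: "SL_solution p' z y" if "SL_solution p z y" and ae: "AE x in lebesgue. x \<in> {0<..<1} \<longrightarrow> p x = p' x" for p p' z y
  proof -
    obtain y' where y': "\<forall>x\<in>{0..1}. (y has_vector_derivative y' x) (at x within {0..1})" "abs_cont_on 0 1 y'"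
      "AE x in lebesgue. x \<in> {0<..<1} \<longrightarrow>
           (\<exists>y''. (y' has_vector_derivative y'') (at x) \<and> - y'' + complex_of_real (p x) * y x = z * y x)"
      using \<open>SL_solution p z y\<close> unfolding SL_solution_def by blast
    have "AE x in lebesgue. x \<in> {0<..<1} \<longrightarrow>
           (\<exists>y''. (y' has_vector_derivative y'') (at x) \<and> - y'' + complex_of_real (p' x) * y x = z * y x)"
      using y'(3) ae by eventually_elim simp
    with y' show ?thesis unfolding SL_solution_def by blast
  qed
  have ae': "AE x in lebesgue. x \<in> {0<..<1} \<longrightarrow> q' x = q x"
    using assms by eventually_elim simp
  have "SL_solution q z y = SL_solution q' z y" for z y
    using imp[OF _ assms] imp[OF _ ae'] by blast
  then have eq: "S_sol q z = S_sol q' z" for z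
    by (simp add: S_sol_def)
  show ?thesis
    by (rule ext) (simp only: char_fun_def eq)
qed

text \<open>
  The \<open>u\<close> sought is the antiderivative, vanishing at 2, of the rescaled density \<open>\<phi> (x / 2) / 2\<close>; the rescaling turns \<open>cos_quot r (2 \<xi>)\<close>
  with \<open>\<xi>\<close> in \<open>[0, 1]\<close> into \<open>cos_quot r x\<close> with \<open>x\<close> in \<open>[0, 2]\<close>.
\<close>
theorem char_fun_sine_transform:
  assumes "L2_on 0 1 q"
  shows "\<exists>u. W12_on 0 2 u \<and> u 2 = 0 \<and> (\<forall>r. char_fun q (r\<^sup>2) = integral {0..2} (\<lambda>x. complex_of_real (u x) * sin_quot r x))"
proof -
  obtain q1 where q1: "q1 \<in> borel_measurable borel" "\<And>x. x \<notin> {0<..<1} \<Longrightarrow> q1 x = 0"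
    "AE x in lebesgue. x \<in> {0<..<1} \<longrightarrow> q1 x = q x" "integrable lborel q1" "integrable lborel (\<lambda>x. (q1 x)\<^sup>2)"
    by (rule L2_on_borelE[OF assms]) (rule that; assumption)
  have supp: "q1 t = 0" if "t \<notin> {0..1}" for t
    using q1(2)[of t] that by auto
  obtain a B where a: "a \<in> borel_measurable borel" "\<forall>p. a p = goursat_map q1 a p"
     "\<forall>\<xi> \<eta>. 0 \<le> \<xi> \<longrightarrow> 0 \<le> \<eta> \<longrightarrow> \<xi> + \<eta> \<le> 1 \<longrightarrow> \<bar>a (\<xi>, \<eta>)\<bar> \<le> B"
    using goursat_solution_exists[OF q1(4) supp] by blast
  interpret goursat_kernel q1 a B
    by unfold_locales (use q1(4) supp a in auto)
  define C where "C = B * (LINT t|lborel. \<bar>q1 t\<bar>)"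
  have \<phi>2: "integrable lborel (\<lambda>x. (\<phi> x)\<^sup>2)"
  proof (rule Bochner_Integration.integrable_bound)
    show "integrable lborel (\<lambda>x. (q1 x)\<^sup>2 + 2 * C\<^sup>2 * indicat_real {0..1} x)"
      by (intro Bochner_Integration.integrable_add q1(5) integrable_mult_right integrable_real_indicator) (auto simp: emeasure_lborel_Icc_eq)
    show "AE x in lborel. norm ((\<phi> x)\<^sup>2) \<le> norm ((q1 x)\<^sup>2 + 2 * C\<^sup>2 * indicat_real {0..1} x)"
    proof (rule AE_I2)
      fix x
      show "norm ((\<phi> x)\<^sup>2) \<le> norm ((q1 x)\<^sup>2 + 2 * C\<^sup>2 * indicat_real {0..1} x)"
      proof (cases "x \<in> {0..1}")
        case True
        define d where "d = \<phi> x - q1 x / 2"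
        have "\<bar>d\<bar> \<le> C" using \<phi>_bound[of x] by (simp add: d_def C_def)
        then have "d\<^sup>2 \<le> C\<^sup>2" by (metis abs_ge_zero power2_abs power_mono)
        moreover have "(\<phi> x)\<^sup>2 + (q1 x / 2 - d)\<^sup>2 = 2 * (q1 x / 2)\<^sup>2 + 2 * d\<^sup>2"
          by (simp add: d_def power2_eq_square algebra_simps)
        moreover have "2 * (q1 x / 2)\<^sup>2 \<le> (q1 x)\<^sup>2" by (simp add: power2_eq_square)
        ultimately have "(\<phi> x)\<^sup>2 \<le> (q1 x)\<^sup>2 + 2 * C\<^sup>2"
          using zero_le_power2[of "q1 x / 2 - d"] by linarith
        then show ?thesis using True by simp
      qed (simp add: \<phi>_supp)
    qed
  qed measurable
  have \<phi>1: "integrable lborel \<phi>"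
  proof (rule Bochner_Integration.integrable_bound)
    show "integrable lborel (\<lambda>x. \<bar>q1 x\<bar> + C * indicat_real {0..1} x)"
      using q1(4) by (intro Bochner_Integration.integrable_add integrable_mult_right integrable_real_indicator) (auto simp: emeasure_lborel_Icc_eq)
    show "AE x in lborel. norm (\<phi> x) \<le> norm (\<bar>q1 x\<bar> + C * indicat_real {0..1} x)"
    proof (rule AE_I2)
      fix x
      show "norm (\<phi> x) \<le> norm (\<bar>q1 x\<bar> + C * indicat_real {0..1} x)"
      proof (cases "x \<in> {0..1}")
        case True
        have "\<bar>\<phi> x - q1 x / 2\<bar> \<le> C" using \<phi>_bound[of x] by (simp add: C_def)
        then have "\<bar>\<phi> x\<bar> \<le> \<bar>q1 x\<bar> + C" by (simp add: abs_if split: if_splits)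
        then show ?thesis using True by simp
      qed (simp add: \<phi>_supp)
    qed
  qed measurable
  define v where "v = (\<lambda>x. \<phi> (x / 2) / 2)"
  have resc: "integrable lborel (\<lambda>x. f (x / 2))" if "integrable lborel f" for f :: "real \<Rightarrow> real"
    using lborel_integrable_real_affine[OF that, of "1/2" 0] by simp
  have v1: "integrable lborel v"
    unfolding v_def using resc[OF \<phi>1] by simp
  have v2: "integrable lborel (\<lambda>x. (v x)\<^sup>2)"
    unfolding v_def using resc[OF \<phi>2] by (simp add: power_divide)
  have v0: "v x = 0" if "x \<notin> {0..2}" for x
  proof -
    have "x / 2 \<notin> {0..1}" using that by auto
    then show ?thesis by (simp add: v_def \<phi>_supp)
  qed
  define u where "u = (\<lambda>x. (LINT t:{..x}|lborel. v t) + (- (LINT t|lborel. v t)))"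
  have W: "W12_on 0 2 u" "u 2 = 0" "AE x in lebesgue. x \<in> {0<..<2} \<longrightarrow> (u has_real_derivative v x) (at x)"
    unfolding u_def by (rule W12_antiderivative[OF v1 v2]; rule v0; assumption)+
  have "char_fun q (r\<^sup>2) = integral {0..2} (\<lambda>x. complex_of_real (u x) * sin_quot r x)" for r
  proof -
    have "char_fun q (r\<^sup>2) = char_fun q1 (r\<^sup>2)"
      using char_fun_cong_AE[OF q1(3)] by simp
    also have "\<dots> = - (LINT \<xi>|lborel. \<phi> \<xi> *\<^sub>R cos_quot r (2 * \<xi>))"
      by (rule char_fun_eq)
    also have "(LINT \<xi>|lborel. \<phi> \<xi> *\<^sub>R cos_quot r (2 * \<xi>)) = (LINT x|lborel. v x *\<^sub>R cos_quot r x)"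
      using lborel_integral_real_affine[of "1/2" "\<lambda>\<xi>. \<phi> \<xi> *\<^sub>R cos_quot r (2 * \<xi>)" 0]
      by (simp add: v_def flip: integral_scaleR_right)
    also have "- (LINT x|lborel. v x *\<^sub>R cos_quot r x) = integral {0..2} (\<lambda>x. complex_of_real (u x) * sin_quot r x)"
      by (rule sine_transform_by_parts[symmetric, OF _ W(2,3) _ v1])
         (use W(1) v0 in \<open>auto simp: W12_on_def\<close>)
    finally show ?thesis .
  qed
  with W(1,2) show ?thesis by blast
qed

section \<open>Recovering the potential from small data\<close>
lemma triangle_kernel_integral_bound:
  assumes q: "integrable lborel q" and q0: "\<And>t. t \<notin> {0..1} \<Longrightarrow> q t = 0"
    and b: "b \<in> borel_measurable borel" "\<And>p. \<bar>b p\<bar> \<le> \<beta>"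
  shows "integrable lborel (\<lambda>s. indicat_real ({..x} \<times> {..y}) s * (triangle_kernel q s * b s))"
    and "\<bar>LINT s|lborel. indicat_real ({..x} \<times> {..y}) s * (triangle_kernel q s * b s)\<bar> \<le> (LINT t|lborel. \<bar>q t\<bar>) * \<beta>"
proof -
  have \<beta>: "\<beta> \<ge> 0" using b(2)[of undefined] by linarith
  have "integrable lborel (\<lambda>s. triangle_kernel q s *\<^sub>R (indicat_real ({..x} \<times> {..y}) s * b s))"
  proof (rule integrable_triangle_kernel_scaleR[OF q q0 borel_measurable_times[OF indicator_quadrant_measurable b(1)]])
    fix \<xi> \<eta> :: real
    show "norm (indicat_real ({..x} \<times> {..y}) (\<xi>, \<eta>) * b (\<xi>, \<eta>)) \<le> \<beta>"
      using b(2)[of "(\<xi>, \<eta>)"] \<beta> by (simp add: indicator_def)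
  qed
  then show i: "integrable lborel (\<lambda>s. indicat_real ({..x} \<times> {..y}) s * (triangle_kernel q s * b s))"
    by (simp add: mult_ac)
  have "\<bar>LINT s|lborel. indicat_real ({..x} \<times> {..y}) s * (triangle_kernel q s * b s)\<bar> \<le>
      (LINT s|lborel. \<bar>indicat_real ({..x} \<times> {..y}) s * (triangle_kernel q s * b s)\<bar>)"
    using integral_norm_bound[of lborel "\<lambda>s. indicat_real ({..x} \<times> {..y}) s * (triangle_kernel q s * b s)"] by simp
  also have "\<dots> \<le> (LINT s|lborel. \<bar>triangle_kernel q s\<bar> * \<beta>)"
  proof (rule integral_mono[OF integrable_abs[OF i]])
    show "integrable lborel (\<lambda>s. \<bar>triangle_kernel q s\<bar> * \<beta>)"
      by (rule integrable_mult_left) (rule integrable_abs[OF integrable_triangle_kernel(1)[OF q q0]])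
    fix s
    have "\<bar>triangle_kernel q s\<bar> * \<bar>b s\<bar> \<le> \<bar>triangle_kernel q s\<bar> * \<beta>"
      by (rule mult_left_mono[OF b(2)]) simp
    then show "\<bar>indicat_real ({..x} \<times> {..y}) s * (triangle_kernel q s * b s)\<bar> \<le> \<bar>triangle_kernel q s\<bar> * \<beta>"
      using \<beta> by (simp add: abs_mult indicator_def)
  qed
  also have "\<dots> = (LINT s|lborel. \<bar>triangle_kernel q s\<bar>) * \<beta>"
    by (rule integral_mult_left_zero)
  also have "\<dots> \<le> (LINT t|lborel. \<bar>q t\<bar>) * \<beta>"
    by (rule mult_right_mono[OF integrable_triangle_kernel(2)[OF q q0] \<beta>])
  finally show "\<bar>LINT s|lborel. indicat_real ({..x} \<times> {..y}) s * (triangle_kernel q s * b s)\<bar> \<le> (LINT t|lborel. \<bar>q t\<bar>) * \<beta>" .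
qed

lemma triangle_kernel_slice_bound:
  assumes q: "integrable lborel q"
    and b: "b \<in> borel_measurable borel" "\<And>\<eta>. \<bar>b \<eta>\<bar> \<le> \<beta>"
  shows "integrable lborel (\<lambda>\<eta>. triangle_kernel q (\<xi>, \<eta>) * b \<eta>)"
    and "\<bar>LINT \<eta>|lborel. triangle_kernel q (\<xi>, \<eta>) * b \<eta>\<bar> \<le> (LINT t|lborel. \<bar>q t\<bar>) * \<beta>"
proof -
  have \<beta>: "\<beta> \<ge> 0" using b(2)[of undefined] by linarith
  have qm [measurable]: "q \<in> borel_measurable borel"
    using q borel_measurable_integrable by auto
  have sh: "integrable lborel (\<lambda>\<eta>. \<bar>q (\<xi> + \<eta>)\<bar> * \<beta>)"
    using lborel_integrable_real_affine[OF q, of 1 \<xi>] by simp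
  have shi: "(LINT \<eta>|lborel. \<bar>q (\<xi> + \<eta>)\<bar>) = (LINT t|lborel. \<bar>q t\<bar>)"
    using lborel_integral_real_affine[of 1 "\<lambda>t. \<bar>q t\<bar>" \<xi>] by simp
  have le: "\<bar>triangle_kernel q (\<xi>, \<eta>) * b \<eta>\<bar> \<le> \<bar>q (\<xi> + \<eta>)\<bar> * \<beta>" for \<eta>
    unfolding abs_mult using b(2)[of \<eta>] by (intro mult_mono) (auto simp: triangle_kernel_eq indicator_def)
  show i: "integrable lborel (\<lambda>\<eta>. triangle_kernel q (\<xi>, \<eta>) * b \<eta>)"
  proof (rule Bochner_Integration.integrable_bound[OF sh])
    show "(\<lambda>\<eta>. triangle_kernel q (\<xi>, \<eta>) * b \<eta>) \<in> borel_measurable lborel"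
      using b(1) unfolding triangle_kernel_eq by measurable
    show "AE \<eta> in lborel. norm (triangle_kernel q (\<xi>, \<eta>) * b \<eta>) \<le> norm (\<bar>q (\<xi> + \<eta>)\<bar> * \<beta>)"
    proof (rule AE_I2)
      fix \<eta> show "norm (triangle_kernel q (\<xi>, \<eta>) * b \<eta>) \<le> norm (\<bar>q (\<xi> + \<eta>)\<bar> * \<beta>)"
        using le[of \<eta>] unfolding real_norm_def by linarith
    qed
  qed
  have "\<bar>LINT \<eta>|lborel. triangle_kernel q (\<xi>, \<eta>) * b \<eta>\<bar> \<le> (LINT \<eta>|lborel. \<bar>triangle_kernel q (\<xi>, \<eta>) * b \<eta>\<bar>)"
    using integral_norm_bound[of lborel "\<lambda>\<eta>. triangle_kernel q (\<xi>, \<eta>) * b \<eta>"] by simp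
  also have "\<dots> \<le> (LINT \<eta>|lborel. \<bar>q (\<xi> + \<eta>)\<bar> * \<beta>)"
    by (rule integral_mono[OF integrable_abs[OF i] sh le])
  also have "\<dots> = (LINT t|lborel. \<bar>q t\<bar>) * \<beta>"
    unfolding shi[symmetric] by (rule integral_mult_left_zero)
  finally show "\<bar>LINT \<eta>|lborel. triangle_kernel q (\<xi>, \<eta>) * b \<eta>\<bar> \<le> (LINT t|lborel. \<bar>q t\<bar>) * \<beta>" .
qed

lemma triangle_kernel_diff: "triangle_kernel (\<lambda>t. q t - q' t) s = triangle_kernel q s - triangle_kernel q' s"
  by (simp add: triangle_kernel_def right_diff_distrib)

text \<open>
  The unknowns, joined into one function on a sum type, are the kernel and the correction
  \<open>q - f\<close>, where \<open>f = 2 \<phi>\<close> is given. The second component solves the definition of \<open>\<phi>\<close> for the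
  potential. The potential itself is square integrable but not bounded, whereas
  the correction is, so it fits a supremum norm.
\<close>
definition inverse_map :: "(real \<Rightarrow> real) \<Rightarrow> ((real \<times> real) + real \<Rightarrow> real) \<Rightarrow> (real \<times> real) + real \<Rightarrow> real" where
  "inverse_map f F i = (case i of
     Inl s \<Rightarrow> goursat_map (\<lambda>t. f t + F (Inr t)) (\<lambda>s. F (Inl s)) s
   | Inr \<xi> \<Rightarrow> - (LINT \<eta>|lborel. triangle_kernel (\<lambda>t. f t + F (Inr t)) (\<xi>, \<eta>) * (F (Inl (\<xi>, \<eta>)) - F (Inl (\<eta>, \<xi>)))))"

text \<open>
  The invariant bounds \<open>1 / 8\<close> and \<open>1 / 16\<close> keep the \<open>L\<^sup>1\<close> norm of the potential below
  \<open>1 / 16 + 1 / 16 = 1 / 8\<close>. Both components of the map are then stable: \<open>1 / 16 + 1 / 64 \<le> 1 / 8\<close> for the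
  kernel and \<open>1 / 8 * 1 / 4 \<le> 1 / 16\<close> for the correction.
\<close>
lemma inverse_fixed_point:
  assumes f: "integrable lborel f" "\<And>t. t \<notin> {0..1} \<Longrightarrow> f t = 0" "(LINT t|lborel. \<bar>f t\<bar>) \<le> 1 / 16"
  shows "\<exists>a p. a \<in> borel_measurable borel \<and> p \<in> borel_measurable borel \<and> (\<forall>s. \<bar>a s\<bar> \<le> 1 / 8) \<and> (\<forall>\<xi>. \<bar>p \<xi>\<bar> \<le> 1 / 16) \<and>
     (\<forall>\<xi>. \<xi> \<notin> {0..1} \<longrightarrow> p \<xi> = 0) \<and> (\<forall>s. a s = goursat_map (\<lambda>t. f t + p t) a s) \<and>
     (\<forall>\<xi>. p \<xi> = - (LINT \<eta>|lborel. triangle_kernel (\<lambda>t. f t + p t) (\<xi>, \<eta>) * (a (\<xi>, \<eta>) - a (\<eta>, \<xi>))))"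
proof -
  define P where "P = (\<lambda>F :: (real \<times> real) + real \<Rightarrow> real. (\<lambda>s. F (Inl s)) \<in> borel_measurable borel \<and> (\<lambda>t. F (Inr t)) \<in> borel_measurable borel \<and>
     (\<forall>s. \<bar>F (Inl s)\<bar> \<le> 1 / 8) \<and> (\<forall>\<xi>. \<bar>F (Inr \<xi>)\<bar> \<le> 1 / 16) \<and> (\<forall>\<xi>. \<xi> \<notin> {0..1} \<longrightarrow> F (Inr \<xi>) = 0))"
  have PD: "(\<lambda>s. F (Inl s)) \<in> borel_measurable borel" "(\<lambda>t. F (Inr t)) \<in> borel_measurable borel"
     "\<bar>F (Inl s)\<bar> \<le> 1 / 8" "\<bar>F (Inr \<xi>)\<bar> \<le> 1 / 16" "\<xi> \<notin> {0..1} \<Longrightarrow> F (Inr \<xi>) = 0" if "P F" for F s \<xi>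
    using that unfolding P_def by blast+
  have int01: "integrable lborel h" "(LINT t|lborel. \<bar>h t\<bar>) \<le> d"
    if h: "h \<in> borel_measurable borel" "\<And>t. \<bar>h t\<bar> \<le> d" "\<And>t. t \<notin> {0..1} \<Longrightarrow> h t = 0" for h :: "real \<Rightarrow> real" and d
  proof -
    have d: "d \<ge> 0" using h(2)[of 0] by linarith
    have le: "\<bar>h t\<bar> \<le> d * indicat_real {0..1} t" for t
      using h(2)[of t] h(3)[of t] by (cases "t \<in> {0..1}") auto
    have di: "integrable lborel (\<lambda>t. d * indicat_real {0..1::real} t)"
      by (rule integrable_mult_right, rule integrable_real_indicator) (auto simp: emeasure_lborel_Icc_eq)
    show i: "integrable lborel h"
    proof (rule Bochner_Integration.integrable_bound[OF di])
      show "AE t in lborel. norm (h t) \<le> norm (d * indicat_real {0..1} t)"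
      proof (rule AE_I2)
        fix t show "norm (h t) \<le> norm (d * indicat_real {0..1} t)"
          using le[of t] unfolding real_norm_def by linarith
      qed
    qed (use h(1) in simp)
    have "(LINT t|lborel. \<bar>h t\<bar>) \<le> (LINT t|lborel. d * indicat_real {0..1::real} t)"
      by (rule integral_mono[OF integrable_abs[OF i] di le])
    also have "\<dots> = d" by simp
    finally show "(LINT t|lborel. \<bar>h t\<bar>) \<le> d" .
  qed
  define Q where "Q = (\<lambda>F :: (real \<times> real) + real \<Rightarrow> real. \<lambda>t. f t + F (Inr t))"
  have Qi: "integrable lborel (Q F)" "\<And>t. t \<notin> {0..1} \<Longrightarrow> Q F t = 0" "(LINT t|lborel. \<bar>Q F t\<bar>) \<le> 1 / 8" if F: "P F" for F
  proof -
    have p: "integrable lborel (\<lambda>t. F (Inr t))" "(LINT t|lborel. \<bar>F (Inr t)\<bar>) \<le> 1 / 16"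
      using int01[OF PD(2,4,5)[OF F]] by blast+
    show "integrable lborel (Q F)"
      unfolding Q_def by (rule Bochner_Integration.integrable_add[OF f(1) p(1)])
    then have "(LINT t|lborel. \<bar>Q F t\<bar>) \<le> (LINT t|lborel. \<bar>f t\<bar> + \<bar>F (Inr t)\<bar>)"
      using f(1) p(1) by (intro integral_mono) (auto simp: Q_def)
    also have "\<dots> = (LINT t|lborel. \<bar>f t\<bar>) + (LINT t|lborel. \<bar>F (Inr t)\<bar>)"
      using f(1) p(1) by (intro Bochner_Integration.integral_add) auto
    finally show "(LINT t|lborel. \<bar>Q F t\<bar>) \<le> 1 / 8" using f(3) p(2) by linarith
    show "Q F t = 0" if "t \<notin> {0..1}" for t
      using f(2)[OF that] PD(5)[OF F that] by (simp add: Q_def)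
  qed
  have T_eq: "inverse_map f F (Inl s) = goursat_map (Q F) (\<lambda>s. F (Inl s)) s"
    "inverse_map f F (Inr \<xi>) = - (LINT \<eta>|lborel. triangle_kernel (Q F) (\<xi>, \<eta>) * (F (Inl (\<xi>, \<eta>)) - F (Inl (\<eta>, \<xi>))))" for F s \<xi>
    by (simp_all add: inverse_map_def Q_def)
  have slice: "(\<lambda>\<eta>. b (\<xi>, \<eta>) - b (\<eta>, \<xi>)) \<in> borel_measurable borel" if "b \<in> borel_measurable borel" for b :: "real \<times> real \<Rightarrow> real" and \<xi>
  proof -
    have [measurable]: "b \<in> borel_measurable (borel \<Otimes>\<^sub>M borel)" using that by (simp add: borel_prod)
    show ?thesis by measurable
  qed
  have PT: "P (inverse_map f F)" if F: "P F" for F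
  proof -
    note D = PD[OF F] and q = Qi[OF F]
    have qm: "Q F \<in> borel_measurable borel" using q(1) borel_measurable_integrable by auto
    have 1: "\<bar>inverse_map f F (Inl s)\<bar> \<le> 1 / 8" for s
    proof -
      have "\<bar>LINT s'|lborel. indicat_real ({..fst s} \<times> {..snd s}) s' * (triangle_kernel (Q F) s' * F (Inl s'))\<bar> \<le> (LINT t|lborel. \<bar>Q F t\<bar>) * (1 / 8)"
        by (rule triangle_kernel_integral_bound(2)[OF q(1,2) D(1,3)])
      moreover have "\<bar>((LINT t:{..fst s}|lborel. Q F t) - (LINT t:{..snd s}|lborel. Q F t)) / 2\<bar> \<le> (LINT t|lborel. \<bar>Q F t\<bar>) / 2"
        using abs_integral_le_atMost[OF q(1), of "fst s" "snd s"] by simp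
      ultimately show ?thesis
        using q(3) unfolding T_eq goursat_map_def by linarith
    qed
    have d4: "\<bar>F (Inl s) - F (Inl s')\<bar> \<le> 1 / 4" for s s'
      using D(3)[of s] D(3)[of s'] by linarith
    have 2: "\<bar>inverse_map f F (Inr \<xi>)\<bar> \<le> 1 / 16" for \<xi>
    proof -
      have "\<bar>LINT \<eta>|lborel. triangle_kernel (Q F) (\<xi>, \<eta>) * (F (Inl (\<xi>, \<eta>)) - F (Inl (\<eta>, \<xi>)))\<bar> \<le> (LINT t|lborel. \<bar>Q F t\<bar>) * (1 / 4)"
        by (rule triangle_kernel_slice_bound(2)[OF q(1) slice[OF D(1)] d4])
      then show ?thesis using q(3) unfolding T_eq abs_minus_cancel by linarith
    qed
    have 3: "inverse_map f F (Inr \<xi>) = 0" if "\<xi> \<notin> {0..1}" for \<xi>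
    proof -
      have "triangle_kernel (Q F) (\<xi>, \<eta>) = 0" for \<eta>
      proof (rule ccontr)
        assume "triangle_kernel (Q F) (\<xi>, \<eta>) \<noteq> 0"
        from triangle_kernel_nonzeroD[OF this q(2)] show False using that by auto
      qed
      then show ?thesis by (simp add: T_eq)
    qed
    have 4: "(\<lambda>s. inverse_map f F (Inl s)) \<in> borel_measurable borel"
      unfolding T_eq by (rule borel_measurable_goursat_map[OF qm D(1)])
    have 5: "(\<lambda>\<xi>. inverse_map f F (Inr \<xi>)) \<in> borel_measurable borel"
    proof -
      have [measurable]: "triangle_kernel (Q F) \<in> borel_measurable (borel \<Otimes>\<^sub>M borel)"
        using borel_measurable_triangle_kernel[OF qm] by (simp add: borel_prod)
      have [measurable]: "(\<lambda>s. F (Inl s)) \<in> borel_measurable (borel \<Otimes>\<^sub>M borel)"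
        using D(1) by (simp add: borel_prod)
      have "(\<lambda>(\<xi>, \<eta>). triangle_kernel (Q F) (\<xi>, \<eta>) * (F (Inl (\<xi>, \<eta>)) - F (Inl (\<eta>, \<xi>)))) \<in> borel_measurable (borel \<Otimes>\<^sub>M lborel)"
        by measurable
      then have "(\<lambda>\<xi>. LINT \<eta>|lborel. triangle_kernel (Q F) (\<xi>, \<eta>) * (F (Inl (\<xi>, \<eta>)) - F (Inl (\<eta>, \<xi>)))) \<in> borel_measurable borel"
        by (rule lborel.borel_measurable_lebesgue_integral)
      then show ?thesis unfolding T_eq by (rule borel_measurable_uminus)
    qed
    show ?thesis unfolding P_def using 1 2 3 4 5 by blast
  qed
  have "\<exists>F. P F \<and> (\<forall>i. inverse_map f F i = F i)"
  proof (rule weighted_fixed_point[where P = P and w = "\<lambda>_. 1" and c = "3/4" and ?d0.0 = "1/4" and ?f0.0 = "\<lambda>_. 0"])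
    show P0: "P (\<lambda>_. 0)" by (simp add: P_def)
    show "P (inverse_map f F)" if "P F" for F by (rule PT[OF that])
    show "P F" if Fn: "\<And>n. P (Fn n)" "\<And>i. (\<lambda>n. Fn n i) \<longlonglongrightarrow> F i" for Fn F
    proof -
      have "(\<lambda>s. F (Inl s)) \<in> borel_measurable borel"
        by (rule borel_measurable_LIMSEQ_real[OF Fn(2)]) (use PD(1)[OF Fn(1)] in simp)
      moreover have "(\<lambda>t. F (Inr t)) \<in> borel_measurable borel"
        by (rule borel_measurable_LIMSEQ_real[OF Fn(2)]) (use PD(2)[OF Fn(1)] in simp)
      moreover have "\<bar>F (Inl s)\<bar> \<le> 1 / 8" for s
        by (rule tendsto_upperbound[OF tendsto_rabs[OF Fn(2)[of "Inl s"]]]) (use PD(3)[OF Fn(1)] in auto)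
      moreover have "\<bar>F (Inr \<xi>)\<bar> \<le> 1 / 16" for \<xi>
        by (rule tendsto_upperbound[OF tendsto_rabs[OF Fn(2)[of "Inr \<xi>"]]]) (use PD(4)[OF Fn(1)] in auto)
      moreover have "F (Inr \<xi>) = 0" if "\<xi> \<notin> {0..1}" for \<xi>
      proof (rule LIMSEQ_unique[OF Fn(2)[of "Inr \<xi>"]])
        show "(\<lambda>n. Fn n (Inr \<xi>)) \<longlonglongrightarrow> 0" using PD(5)[OF Fn(1) that] by simp
      qed
      ultimately show ?thesis unfolding P_def by blast
    qed
    show "norm (inverse_map f F i - inverse_map f G i) \<le> 3 / 4 * d * 1"
      if FG: "P F" "P G" "0 \<le> d" and le: "\<And>i. norm (F i - G i) \<le> d * 1" for F G d i
    proof -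
      note DF = PD[OF FG(1)] and DG = PD[OF FG(2)] and qF = Qi[OF FG(1)] and qG = Qi[OF FG(2)]
      have le': "\<bar>F i - G i\<bar> \<le> d" for i using le[of i] by simp
      define h where "h = (\<lambda>t. Q F t - Q G t)"
      have hi: "integrable lborel h" unfolding h_def by (rule Bochner_Integration.integrable_diff[OF qF(1) qG(1)])
      have h0: "h t = 0" if "t \<notin> {0..1}" for t using qF(2)[OF that] qG(2)[OF that] by (simp add: h_def)
      have hn: "(LINT t|lborel. \<bar>h t\<bar>) \<le> d"
      proof (rule int01(2))
        show "h \<in> borel_measurable borel" using hi borel_measurable_integrable by auto
        show "\<bar>h t\<bar> \<le> d" for t using le'[of "Inr t"] by (simp add: h_def Q_def)
        show "h t = 0" if "t \<notin> {0..1}" for t by (rule h0[OF that])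
      qed
      have dm: "(\<lambda>s. F (Inl s) - G (Inl s)) \<in> borel_measurable borel"
        by (rule borel_measurable_diff[OF DF(1) DG(1)])
      show ?thesis
      proof (cases i)
        case (Inl s)
        let ?I = "\<lambda>q b s'. indicat_real ({..fst s} \<times> {..snd s}) s' * (triangle_kernel q s' * b s')"
        have I1: "integrable lborel (?I h (\<lambda>s. F (Inl s)))" "\<bar>LINT s'|lborel. ?I h (\<lambda>s. F (Inl s)) s'\<bar> \<le> (LINT t|lborel. \<bar>h t\<bar>) * (1 / 8)"
          subgoal by (rule triangle_kernel_integral_bound(1)[OF hi h0 DF(1,3)])
          subgoal by (rule triangle_kernel_integral_bound(2)[OF hi h0 DF(1,3)])
          done
        have I2: "integrable lborel (?I (Q G) (\<lambda>s. F (Inl s) - G (Inl s)))" "\<bar>LINT s'|lborel. ?I (Q G) (\<lambda>s. F (Inl s) - G (Inl s)) s'\<bar> \<le> (LINT t|lborel. \<bar>Q G t\<bar>) * d"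
          subgoal by (rule triangle_kernel_integral_bound(1)[OF qG(1,2) dm le'])
          subgoal by (rule triangle_kernel_integral_bound(2)[OF qG(1,2) dm le'])
          done
        have IF: "integrable lborel (?I (Q F) (\<lambda>s. F (Inl s)))"
          by (rule triangle_kernel_integral_bound(1)[OF qF(1,2) DF(1,3)])
        have IG: "integrable lborel (?I (Q G) (\<lambda>s. G (Inl s)))"
          by (rule triangle_kernel_integral_bound(1)[OF qG(1,2) DG(1,3)])
        have pw: "?I (Q F) (\<lambda>s. F (Inl s)) s' - ?I (Q G) (\<lambda>s. G (Inl s)) s' = ?I h (\<lambda>s. F (Inl s)) s' + ?I (Q G) (\<lambda>s. F (Inl s) - G (Inl s)) s'" for s'
          unfolding h_def triangle_kernel_diff by (simp add: algebra_simps)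
        have A: "(LINT s'|lborel. ?I (Q F) (\<lambda>s. F (Inl s)) s') - (LINT s'|lborel. ?I (Q G) (\<lambda>s. G (Inl s)) s') =
           (LINT s'|lborel. ?I h (\<lambda>s. F (Inl s)) s') + (LINT s'|lborel. ?I (Q G) (\<lambda>s. F (Inl s) - G (Inl s)) s')"
          unfolding Bochner_Integration.integral_diff[OF IF IG, symmetric] pw by (rule Bochner_Integration.integral_add[OF I1(1) I2(1)])
        have si: "set_integrable lborel {..x} (Q F)" "set_integrable lborel {..x} (Q G)" for x
          unfolding set_integrable_def using qF(1) qG(1) by (auto intro!: integrable_mult_indicator simp del: real_scaleR_def)
        have lin: "(LINT t:{..x}|lborel. h t) = (LINT t:{..x}|lborel. Q F t) - (LINT t:{..x}|lborel. Q G t)" for x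
          unfolding h_def by (rule set_integral_diff(2)[OF si])
        have B: "\<bar>(LINT t:{..fst s}|lborel. h t) - (LINT t:{..snd s}|lborel. h t)\<bar> \<le> d"
          using abs_integral_le_atMost[OF hi, of "fst s" "snd s"] hn by linarith
        have C: "(LINT t|lborel. \<bar>Q G t\<bar>) * d \<le> 1 / 8 * d"
          by (rule mult_right_mono[OF qG(3) FG(3)])
        have c1: "\<bar>LINT s'|lborel. ?I h (\<lambda>s. F (Inl s)) s'\<bar> \<le> d / 8"
          using I1(2) hn by linarith
        have c2: "\<bar>LINT s'|lborel. ?I (Q G) (\<lambda>s. F (Inl s) - G (Inl s)) s'\<bar> \<le> d / 8"
          using I2(2) C by linarith
        have gen: "\<bar>(p1 - p2) / 2 + iF - ((r1 - r2) / 2 + iG)\<bar> \<le> 3 / 4 * d * 1"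
          if "iF - iG = x + y" "\<bar>(p1 - r1) - (p2 - r2)\<bar> \<le> d" "\<bar>x\<bar> \<le> d / 8" "\<bar>y\<bar> \<le> d / 8"
          for p1 p2 r1 r2 iF iG x y :: real
          using that by argo
        show ?thesis
          unfolding Inl T_eq goursat_map_def real_norm_def
          by (rule gen[OF A B[unfolded lin] c1 c2])
      next
        case (Inr \<xi>)
        let ?I = "\<lambda>q b \<eta>. triangle_kernel q (\<xi>, \<eta>) * (b (\<xi>, \<eta>) - b (\<eta>, \<xi>))"
        have d4: "\<bar>F (Inl s) - F (Inl s')\<bar> \<le> 1 / 4" "\<bar>G (Inl s) - G (Inl s')\<bar> \<le> 1 / 4" for s s'
          using DF(3)[of s] DF(3)[of s'] DG(3)[of s] DG(3)[of s'] by linarith+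
        have d2: "\<bar>(F (Inl s) - G (Inl s)) - (F (Inl s') - G (Inl s'))\<bar> \<le> 2 * d" for s s'
          using le'[of "Inl s"] le'[of "Inl s'"] by linarith
        have I1: "integrable lborel (?I h (\<lambda>s. F (Inl s)))" "\<bar>LINT s'|lborel. ?I h (\<lambda>s. F (Inl s)) s'\<bar> \<le> (LINT t|lborel. \<bar>h t\<bar>) * (1 / 4)"
          by (rule triangle_kernel_slice_bound[OF hi slice[OF DF(1)] d4(1)])+
        have I2: "integrable lborel (?I (Q G) (\<lambda>s. F (Inl s) - G (Inl s)))" "\<bar>LINT s'|lborel. ?I (Q G) (\<lambda>s. F (Inl s) - G (Inl s)) s'\<bar> \<le> (LINT t|lborel. \<bar>Q G t\<bar>) * (2 * d)"
          by (rule triangle_kernel_slice_bound[OF qG(1) slice[OF dm] d2])+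
        have IF: "integrable lborel (?I (Q F) (\<lambda>s. F (Inl s)))"
          by (rule triangle_kernel_slice_bound(1)[OF qF(1) slice[OF DF(1)] d4(1)])
        have IG: "integrable lborel (?I (Q G) (\<lambda>s. G (Inl s)))"
          by (rule triangle_kernel_slice_bound(1)[OF qG(1) slice[OF DG(1)] d4(2)])
        have pw: "?I (Q F) (\<lambda>s. F (Inl s)) s' - ?I (Q G) (\<lambda>s. G (Inl s)) s' = ?I h (\<lambda>s. F (Inl s)) s' + ?I (Q G) (\<lambda>s. F (Inl s) - G (Inl s)) s'" for s'
          unfolding h_def triangle_kernel_diff by (simp add: algebra_simps)
        have A: "(LINT s'|lborel. ?I (Q F) (\<lambda>s. F (Inl s)) s') - (LINT s'|lborel. ?I (Q G) (\<lambda>s. G (Inl s)) s') =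
           (LINT s'|lborel. ?I h (\<lambda>s. F (Inl s)) s') + (LINT s'|lborel. ?I (Q G) (\<lambda>s. F (Inl s) - G (Inl s)) s')"
          unfolding Bochner_Integration.integral_diff[OF IF IG, symmetric] pw by (rule Bochner_Integration.integral_add[OF I1(1) I2(1)])
        have C: "(LINT t|lborel. \<bar>Q G t\<bar>) * (2 * d) \<le> 1 / 8 * (2 * d)"
          by (rule mult_right_mono[OF qG(3)]) (use FG(3) in simp)
        have "\<bar>inverse_map f F i - inverse_map f G i\<bar> = \<bar>(LINT s'|lborel. ?I (Q F) (\<lambda>s. F (Inl s)) s') - (LINT s'|lborel. ?I (Q G) (\<lambda>s. G (Inl s)) s')\<bar>"
          unfolding Inr T_eq by linarith
        also have "\<dots> \<le> d * (1 / 4) + 1 / 8 * (2 * d)"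
          unfolding A using I1(2) I2(2) C hn by linarith
        also have "\<dots> \<le> 3 / 4 * d * 1" using FG(3) by simp
        finally show ?thesis by simp
      qed
    qed
    show "norm (inverse_map f (\<lambda>_. 0) i - 0) \<le> 1 / 4 * 1" for i
    proof (cases i)
      case (Inl s)
      then show ?thesis using PD(3)[OF PT[OF P0], of s] by simp
    next
      case (Inr \<xi>)
      then show ?thesis using PD(4)[OF PT[OF P0], of \<xi>] by simp
    qed
  qed auto
  then obtain F where F: "P F" "\<And>i. inverse_map f F i = F i" by blast
  show ?thesis
  proof (intro exI[of _ "\<lambda>s. F (Inl s)"] exI[of _ "\<lambda>t. F (Inr t)"] conjI allI impI)
    show "F (Inl s) = goursat_map (\<lambda>t. f t + F (Inr t)) (\<lambda>s. F (Inl s)) s" for s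
      using F(2)[of "Inl s"] unfolding T_eq Q_def by simp
    show "F (Inr \<xi>) = - (LINT \<eta>|lborel. triangle_kernel (\<lambda>t. f t + F (Inr t)) (\<xi>, \<eta>) * (F (Inl (\<xi>, \<eta>)) - F (Inl (\<eta>, \<xi>))))" for \<xi>
      using F(2)[of "Inr \<xi>"] unfolding T_eq Q_def by simp
  qed (use PD[OF F(1)] in auto)
qed

text \<open>
  Since \<open>\<phi>\<close> is to be \<open>c g (2 \<xi>) * 2\<close> for \<open>g = u'\<close>, the data of the fixed point problem is
  \<open>f = 2 \<phi> = 4 c g (2 \<xi>)\<close>. Its \<open>L\<^sup>1\<close> norm is \<open>2 c\<close> times that of \<open>g\<close>, which dictates the choice of \<open>c\<close>.
\<close>
theorem sine_transform_realizable:
  assumes W: "W12_on 0 2 u" and u2: "u 2 = 0"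
  shows "\<exists>c>0. \<exists>q. L2_on 0 1 q \<and> (\<forall>r. char_fun q (r\<^sup>2) = complex_of_real c * integral {0..2} (\<lambda>x. complex_of_real (u x) * sin_quot r x))"
proof -
  obtain v where v: "L2_on 0 2 v" "AE x in lebesgue. x \<in> {0<..<2} \<longrightarrow> (u has_real_derivative v x) (at x)"
    and ac: "abs_cont_on 0 2 u"
    using W unfolding W12_on_def by blast
  obtain g where g: "g \<in> borel_measurable borel" "\<And>x. x \<notin> {0<..<2} \<Longrightarrow> g x = 0"
    "AE x in lebesgue. x \<in> {0<..<2} \<longrightarrow> g x = v x" "integrable lborel g" "integrable lborel (\<lambda>x. (g x)\<^sup>2)"
    by (rule L2_on_borelE[OF v(1)]) (rule that; assumption)
  have g0: "g x = 0" if "x \<notin> {0..2}" for x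
    using g(2)[of x] that by auto
  define n where "n = (LINT x|lborel. \<bar>g x\<bar>)"
  have n: "n \<ge> 0" by (simp add: n_def)
  define c where "c = 1 / (32 * (n + 1))"
  have c: "c > 0" using n by (simp add: c_def)
  (* The potential to be found is f plus a bounded correction. *)
  define f where "f = (\<lambda>\<xi>. 4 * c * g (2 * \<xi>))"
  have resc: "integrable lborel (\<lambda>x. h (2 * x))" if "integrable lborel h" for h :: "real \<Rightarrow> real"
    using lborel_integrable_real_affine[OF that, of 2 0] by simp
  have fi: "integrable lborel f" unfolding f_def using resc[OF g(4)] by simp
  have f2: "integrable lborel (\<lambda>x. (f x)\<^sup>2)" unfolding f_def power_mult_distrib using resc[OF g(5)] by simp
  have f0: "f t = 0" if "t \<notin> {0..1}" for t
  proof -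
    have "2 * t \<notin> {0..2}" using that by auto
    from g0[OF this] show ?thesis by (simp add: f_def)
  qed
  have fn: "(LINT t|lborel. \<bar>f t\<bar>) \<le> 1 / 16"
  proof -
    have "n = 2 * (LINT t|lborel. \<bar>g (2 * t)\<bar>)"
      unfolding n_def using lborel_integral_real_affine[of 2 "\<lambda>x. \<bar>g x\<bar>" 0] by simp
    then have "(LINT t|lborel. \<bar>f t\<bar>) = 2 * c * n"
      unfolding f_def using c by (simp add: abs_mult)
    also have "\<dots> \<le> 1 / 16" using n by (simp add: c_def field_simps)
    finally show ?thesis .
  qed
  obtain a p where ap: "a \<in> borel_measurable borel" "p \<in> borel_measurable borel" "\<And>s. \<bar>a s\<bar> \<le> 1 / 8" "\<And>\<xi>. \<bar>p \<xi>\<bar> \<le> 1 / 16"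
     "\<And>\<xi>. \<xi> \<notin> {0..1} \<Longrightarrow> p \<xi> = 0" "\<And>s. a s = goursat_map (\<lambda>t. f t + p t) a s"
     "\<And>\<xi>. p \<xi> = - (LINT \<eta>|lborel. triangle_kernel (\<lambda>t. f t + p t) (\<xi>, \<eta>) * (a (\<xi>, \<eta>) - a (\<eta>, \<xi>)))"
    using inverse_fixed_point[OF fi f0 fn] by blast
  define q where "q = (\<lambda>t. f t + p t)"
  have p_le: "\<bar>p t\<bar> \<le> indicat_real {0..1} t" for t
    using ap(4)[of t] ap(5)[of t] by (cases "t \<in> {0..1}") auto
  have ii: "integrable lborel (indicat_real {0..1::real})"
    by (rule integrable_real_indicator) (auto simp: emeasure_lborel_Icc_eq)
  have pi: "integrable lborel p"
  proof (rule Bochner_Integration.integrable_bound[OF ii])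
    show "AE t in lborel. norm (p t) \<le> norm (indicat_real {0..1} t)"
    proof (rule AE_I2)
      fix t show "norm (p t) \<le> norm (indicat_real {0..1} t)" using p_le[of t] unfolding real_norm_def by linarith
    qed
  qed (use ap(2) in simp)
  have qi: "integrable lborel q" unfolding q_def by (rule Bochner_Integration.integrable_add[OF fi pi])
  have q0: "q t = 0" if "t \<notin> {0..1}" for t using f0[OF that] ap(5)[OF that] by (simp add: q_def)
  have qm: "q \<in> borel_measurable borel" using qi borel_measurable_integrable by auto
  have q2: "integrable lborel (\<lambda>x. (q x)\<^sup>2)"
  proof (rule Bochner_Integration.integrable_bound)
    show "integrable lborel (\<lambda>x. 2 * (f x)\<^sup>2 + 2 * indicat_real {0..1} x)"
      by (intro Bochner_Integration.integrable_add integrable_mult_right f2 ii)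
    show "AE x in lborel. norm ((q x)\<^sup>2) \<le> norm (2 * (f x)\<^sup>2 + 2 * indicat_real {0..1} x)"
    proof (rule AE_I2)
      fix x
      have "\<bar>p x\<bar> * \<bar>p x\<bar> \<le> indicat_real {0..1} x * indicat_real {0..1} x"
        by (rule mult_mono[OF p_le p_le]) auto
      also have "\<dots> = indicat_real {0..1} x" by (simp add: indicator_def)
      finally have "(p x)\<^sup>2 \<le> indicat_real {0..1} x" by (simp add: power2_eq_square)
      moreover have "(q x)\<^sup>2 + (f x - p x)\<^sup>2 = 2 * (f x)\<^sup>2 + 2 * (p x)\<^sup>2"
        by (simp add: q_def power2_eq_square algebra_simps)
      ultimately have "(q x)\<^sup>2 \<le> 2 * (f x)\<^sup>2 + 2 * indicat_real {0..1} x"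
        using zero_le_power2[of "f x - p x"] by linarith
      then show "norm ((q x)\<^sup>2) \<le> norm (2 * (f x)\<^sup>2 + 2 * indicat_real {0..1} x)" by simp
    qed
  qed (use qm in measurable)
  interpret goursat_kernel q a "1/8"
    by unfold_locales (use qi q0 ap(1,3) ap(6)[folded q_def] in auto)
  (* This is what the second component of the fixed point says. *)
  have \<phi>f: "\<phi> \<xi> = f \<xi> / 2" for \<xi>
    using ap(7)[of \<xi>, folded q_def] by (simp add: \<phi>_def) (simp add: q_def)
  have "char_fun q (r\<^sup>2) = complex_of_real c * integral {0..2} (\<lambda>x. complex_of_real (u x) * sin_quot r x)" for r
  proof -
    have "char_fun q (r\<^sup>2) = - (LINT \<xi>|lborel. (f \<xi> / 2) *\<^sub>R cos_quot r (2 * \<xi>))"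
      unfolding char_fun_eq \<phi>f ..
    also have "(LINT \<xi>|lborel. (f \<xi> / 2) *\<^sub>R cos_quot r (2 * \<xi>)) = c *\<^sub>R (LINT x|lborel. g x *\<^sub>R cos_quot r x)"
      using lborel_integral_real_affine[of 2 "\<lambda>x. g x *\<^sub>R cos_quot r x" 0]
      by (simp add: f_def mult.left_commute flip: integral_scaleR_right)
    also have "- (c *\<^sub>R (LINT x|lborel. g x *\<^sub>R cos_quot r x)) = complex_of_real c * (- (LINT x|lborel. g x *\<^sub>R cos_quot r x))"
      by (simp add: scaleR_conv_of_real)
    also have "- (LINT x|lborel. g x *\<^sub>R cos_quot r x) = integral {0..2} (\<lambda>x. complex_of_real (u x) * sin_quot r x)"
      by (rule sine_transform_by_parts[symmetric, OF ac u2 v(2) g(3,4) g0])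
    finally show ?thesis .
  qed
  then show ?thesis
    using c L2_onI[OF qm q2] by blast
qed

section \<open>Entire functions of order at most one half\<close>
text \<open>
  The Schwarz lemma for \<open>h / (2 A - h)\<close>, which maps the half-plane \<open>Re < A\<close> into the unit disc.
\<close>
lemma borel_caratheodory_ball:
  assumes h: "h holomorphic_on ball 0 R" and h0: "h 0 = 0" and R: "R > 0"
    and A: "A > 0" "\<And>z. norm z < R \<Longrightarrow> Re (h z) < A" and z: "norm z < R"
  shows "norm (h z) \<le> 2 * A * norm z / (R - norm z)"
proof -
  define g where "g = (\<lambda>w. h (of_real R * w))"
  have g: "g holomorphic_on ball 0 1"
    unfolding g_def
  proof (rule holomorphic_on_compose_gen[OF _ h, unfolded o_def])
    show "(\<lambda>w::complex. of_real R * w) ` ball 0 1 \<subseteq> ball 0 R"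
      using R by (auto simp: dist_norm norm_mult)
  qed (intro holomorphic_intros)
  have Re: "Re (g w) < A" if "norm w < 1" for w
    unfolding g_def using A(2)[of "of_real R * w"] R that by (simp add: norm_mult)
  have nz: "of_real (2 * A) - g w \<noteq> 0" if "norm w < 1" for w
  proof
    assume "of_real (2 * A) - g w = 0"
    then have "Re (g w) = 2 * A" by (simp add: complex_eq_iff)
    then show False using Re[OF that] A(1) by simp
  qed
  define \<psi> where "\<psi> = (\<lambda>w. g w / (of_real (2 * A) - g w))"
  have lt: "norm (g w) < norm (of_real (2 * A) - g w)" if "norm w < 1" for w
  proof -
    have "(norm (of_real (2 * A) - g w))\<^sup>2 - (norm (g w))\<^sup>2 = 4 * A * (A - Re (g w))"
      by (simp only: cmod_power2) (simp add: power2_eq_square algebra_simps)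
    also have "\<dots> > 0" using A(1) Re[OF that] by simp
    finally show ?thesis by (intro power2_less_imp_less[of _ "norm (of_real (2 * A) - g w)"]) auto
  qed
  define w where "w = z / of_real R"
  have w: "norm w < 1" "of_real R * w = z" "norm w = norm z / R"
    using z R by (auto simp: w_def norm_divide)
  have "norm (\<psi> w) \<le> norm w"
  proof (rule Schwarz_Lemma(1))
    show "\<psi> holomorphic_on ball 0 1"
      unfolding \<psi>_def using nz by (intro holomorphic_intros g) auto
    show "\<psi> 0 = 0" by (simp add: \<psi>_def g_def h0)
    show "norm (\<psi> v) < 1" if "norm v < 1" for v
      unfolding \<psi>_def norm_divide using lt[OF that] by (simp add: divide_less_eq)
  qed (rule w(1))
  then have "norm (g w) \<le> norm w * norm (of_real (2 * A) - g w)"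
    unfolding \<psi>_def norm_divide using nz[OF w(1)] by (simp add: divide_le_eq)
  also have "\<dots> \<le> norm w * (2 * A + norm (g w))"
    using norm_triangle_ineq4[of "of_real (2 * A) :: complex" "g w"] A(1) by (intro mult_left_mono) auto
  finally have "norm (g w) * (1 - norm w) \<le> 2 * A * norm w"
    by (simp add: algebra_simps)
  then have "norm (g w) * ((R - norm z) / R) \<le> 2 * A * (norm z / R)"
    unfolding w(3) using R by (simp add: diff_divide_distrib)
  from mult_right_mono[OF this, of R] have "norm (g w) * (R - norm z) \<le> 2 * A * norm z"
    using R by simp
  moreover have "g w = h z" by (simp add: g_def w(2))
  ultimately show ?thesis using z by (simp add: field_simps)
qed

text \<open>
  Absolutely convergent products may be exhausted by arbitrary finite sets, such as the zeros in
  growing discs.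
\<close>
lemma prod_exhaustion_tendsto_prodinf:
  fixes f :: "nat \<Rightarrow> complex"
  assumes s: "summable (\<lambda>k. norm (f k - 1))"
    and K: "filterlim K (finite_subsets_at_top UNIV) sequentially"
  shows "(\<lambda>n. \<Prod>k\<in>K n. f k) \<longlonglongrightarrow> prodinf f"
proof -
  have "abs_convergent_prod f"
    using s by (simp add: abs_convergent_prod_conv_summable)
  then have conv: "convergent_prod f"
    by (rule abs_convergent_prod_imp_convergent_prod)
  have sub: "\<forall>\<^sub>F n in sequentially. finite (K' n) \<and> X \<subseteq> K' n"
    if K': "filterlim K' (finite_subsets_at_top UNIV) sequentially" and X: "finite X" for K' and X :: "nat set"
  proof -
    have "\<forall>\<^sub>F n in sequentially. finite (K' n) \<and> X \<subseteq> K' n \<and> K' n \<subseteq> UNIV"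
      using K'[unfolded filterlim_finite_subsets_at_top, rule_format, of X] X by simp
    then show ?thesis by eventually_elim simp
  qed
  show ?thesis
  proof (cases "\<exists>k. f k = 0")
    case True
    then obtain k where k: "f k = 0" by blast
    have "prodinf f = 0"
      using has_prod_eq_0_iff[OF convergent_prod_has_prod[OF conv]] k by auto
    moreover have "\<forall>\<^sub>F n in sequentially. finite (K n) \<and> {k} \<subseteq> K n"
      by (rule sub[OF K]) simp
    then have "\<forall>\<^sub>F n in sequentially. (\<Prod>k\<in>K n. f k) = 0"
    proof eventually_elim
      case (elim n)
      then show ?case by (intro prod_zero) (use k in auto)
    qed
    ultimately show ?thesis by (simp add: tendsto_eventually)
  next
    case False
    have lim: "(\<lambda>k. norm (f k - 1)) \<longlonglongrightarrow> 0"
      using s by (rule summable_LIMSEQ_zero)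
    have ev: "\<forall>\<^sub>F k in sequentially. norm (f k - 1) < 1 / 2"
      using order_tendstoD(2)[OF lim, of "1/2"] by simp
    have "summable (\<lambda>k. norm (Ln (f k)))"
    proof (rule summable_comparison_test_ev)
      show "\<forall>\<^sub>F k in sequentially. norm (norm (Ln (f k))) \<le> 2 * norm (f k - 1)"
        using ev
      proof eventually_elim
        case (elim k)
        then show ?case using norm_Ln_le[of "f k - 1"] by simp
      qed
      show "summable (\<lambda>k. 2 * norm (f k - 1))" using s by (rule summable_mult)
    qed
    moreover from this have "summable (\<lambda>k. Ln (f k))" by (rule summable_norm_cancel)
    ultimately have hs: "((\<lambda>k. Ln (f k)) has_sum (\<Sum>k. Ln (f k))) UNIV"
      by (intro norm_summable_imp_has_sum summable_sums)
    have lim: "(\<lambda>n. \<Prod>k\<in>K' n. f k) \<longlonglongrightarrow> exp (\<Sum>k. Ln (f k))" if K': "filterlim K' (finite_subsets_at_top UNIV) sequentially" for K'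
    proof -
      have "(\<lambda>n. \<Sum>k\<in>K' n. Ln (f k)) \<longlonglongrightarrow> (\<Sum>k. Ln (f k))"
        using filterlim_compose[OF hs[unfolded has_sum_def] K'] .
      then have "(\<lambda>n. exp (\<Sum>k\<in>K' n. Ln (f k))) \<longlonglongrightarrow> exp (\<Sum>k. Ln (f k))"
        by (rule tendsto_exp)
      moreover have "\<forall>\<^sub>F n in sequentially. exp (\<Sum>k\<in>K' n. Ln (f k)) = (\<Prod>k\<in>K' n. f k)"
        using sub[OF K' finite.emptyI]
      proof eventually_elim
        case (elim n)
        then show ?case using False by (simp add: exp_sum)
      qed
      ultimately show ?thesis by (rule Lim_transform_eventually)
    qed
    have "(\<lambda>n. \<Prod>k\<in>{..n}. f k) \<longlonglongrightarrow> exp (\<Sum>k. Ln (f k))"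
      by (rule lim[OF filterlim_atMost_at_top])
    from LIMSEQ_unique[OF this convergent_prod_LIMSEQ[OF conv]] lim[OF K] show ?thesis by simp
  qed
qed

lemma entire_eventually_nonzero:
  assumes f: "f holomorphic_on UNIV" and nz: "f w \<noteq> 0"
  shows "\<forall>\<^sub>F z in at a. f z \<noteq> (0::complex)"
  using non_zero_neighbour_alt[OF f _ _ _ UNIV_I nz, of a] by auto

lemma zorder_linear: "zorder (\<lambda>z. z - a) w = (if w = a then 1 else 0)"
proof (cases "w = a")
  case True
  have "zorder (\<lambda>z. z - a) a = 1"
    by (rule zorder_zero_eqI'[where n = 1, simplified]) (auto intro!: analytic_intros)
  then show ?thesis using True by simp
next
  case False
  then show ?thesis by (auto intro!: zorder_eq_0I analytic_intros)
qed

text \<open>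
  One linear factor at a time: each division lowers the order at one point by one, which
  keeps the assumption on the orders for the remaining indices.
\<close>
lemma divide_out_zeros:
  assumes "finite A" "f holomorphic_on UNIV" "f w0 \<noteq> 0"
    and "\<And>z. int (card {k\<in>A. lam k = z}) \<le> zorder f z"
  shows "\<exists>g. g holomorphic_on UNIV \<and> (\<forall>z. f z = (\<Prod>k\<in>A. z - lam k) * g z) \<and>
     (\<forall>z. zorder f z = int (card {k\<in>A. lam k = z}) + zorder g z)"
  using assms
proof (induction A arbitrary: f rule: finite_induct)
  case empty
  then show ?case by (intro exI[of _ f]) auto
next
  case (insert k A)
  define a where "a = lam k"
  have ana: "f analytic_on {z}" for z
    using insert.prems(1) by (auto simp: analytic_on_holomorphic)
  have fin: "finite {j \<in> insert k A. lam j = z}" for z using insert.hyps(1) by auto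
  have "card {j \<in> insert k A. lam j = a} \<noteq> 0"
    using fin[of a] by (auto simp: a_def)
  then have "zorder f a \<noteq> 0" using insert.prems(3)[of a] by linarith
  then have fa: "f a = 0" using zorder_eq_0I[OF ana] by blast
  define g where "g = (\<lambda>z. if z = a then deriv f a else (f z - f a) / (z - a))"
  have g: "g holomorphic_on UNIV"
    unfolding g_def by (rule pole_lemma[OF insert.prems(1)]) simp
  have fg: "f z = (z - a) * g z" for z
    by (simp add: g_def fa)
  have "w0 \<noteq> a" using fa insert.prems(2) by auto
  then have g0: "g w0 \<noteq> 0" using insert.prems(2) fg[of w0] by auto
  have gana: "g analytic_on {z}" for z
    using g by (auto simp: analytic_on_holomorphic)
  have zo: "zorder f z = (if z = a then 1 else 0) + zorder g z" for z
  proof -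
    have "f = (\<lambda>z. (z - a) * g z)" using fg by auto
    then have "zorder f z = zorder (\<lambda>z. (z - a) * g z) z" by simp
    also have "\<dots> = zorder (\<lambda>z. z - a) z + zorder g z"
    proof (rule zorder_times_analytic)
      show "\<forall>\<^sub>F x in at z. (x - a) * g x \<noteq> 0"
        using entire_eventually_nonzero[OF insert.prems(1,2), of z] by (simp add: fg)
    qed (auto intro!: analytic_intros gana)
    finally show ?thesis by (simp add: zorder_linear)
  qed
  have card: "int (card {j \<in> insert k A. lam j = z}) = (if z = a then 1 else 0) + int (card {j \<in> A. lam j = z})" for z
  proof (cases "z = a")
    case True
    have "{j \<in> insert k A. lam j = a} = insert k {j \<in> A. lam j = a}" by (auto simp: a_def)
    then show ?thesis using True insert.hyps by simp
  next
    case False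
    then have "{j \<in> insert k A. lam j = z} = {j \<in> A. lam j = z}" by (auto simp: a_def)
    then show ?thesis using False by simp
  qed
  have "int (card {j \<in> A. lam j = z}) \<le> zorder g z" for z
    using insert.prems(3)[of z] card[of z] zo[of z] by linarith
  from insert.IH[OF g g0 this] obtain h where h: "h holomorphic_on UNIV" "\<And>z. g z = (\<Prod>k\<in>A. z - lam k) * h z"
    "\<And>z. zorder g z = int (card {k\<in>A. lam k = z}) + zorder h z" by blast
  show ?case
  proof (intro exI[of _ h] conjI allI)
    show "f z = (\<Prod>k\<in>insert k A. z - lam k) * h z" for z
      using insert.hyps fg[of z] h(2)[of z] by (simp add: a_def)
    show "zorder f z = int (card {j \<in> insert k A. lam j = z}) + zorder h z" for z
      using zo[of z] card[of z] h(3)[of z] by linarith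
  qed (rule h(1))
qed

text \<open>
  An entire function of order at most one half and finite type, together with the list of its
  zeros. The list is infinite, being indexed by the natural numbers with finite fibres.
\<close>
locale entire_with_zeros =
  fixes D :: "complex \<Rightarrow> complex" and lam :: "nat \<Rightarrow> complex" and C c :: real
  assumes D_holo: "D holomorphic_on UNIV" and D_nz: "\<exists>z. D z \<noteq> 0"
    and growth: "\<And>z. 1 \<le> norm z \<Longrightarrow> norm (D z) \<le> C * exp (c * sqrt (norm z))" and C_pos: "C > 0" and c_nonneg: "c \<ge> 0"
    and fin: "\<And>z. finite {k. lam k = z}" and mult: "\<And>z. int (card {k. lam k = z}) = zorder D z"
begin

definition s where "s = card {k. lam k = 0}"

definition small_zeros where "small_zeros \<rho> = {k. lam k \<noteq> 0 \<and> norm (lam k) \<le> \<rho>}"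

definition canonical_part where "canonical_part \<rho> z = (\<Prod>k\<in>small_zeros \<rho>. 1 - z / lam k)"

text \<open>
  Infinitely many zeros in a disc would accumulate.
\<close>
lemma finite_cball: "finite {k. norm (lam k) \<le> \<rho>}"
proof -
  have "finite {z\<in>cball 0 \<rho>. D z = 0}"
  proof (rule holomorphic_compact_finite_zeros[OF D_holo])
    show "\<not> D constant_on UNIV"
    proof
      assume "D constant_on UNIV"
      then obtain d where d: "\<And>z. D z = d" by (auto simp: constant_on_def)
      then have "d \<noteq> 0" using D_nz by auto
      have "zorder D z = 0" for z
        using D_holo d \<open>d \<noteq> 0\<close> by (intro zorder_eq_0I) (auto simp: analytic_on_holomorphic)
      then have "{k. lam k = z} = {}" for z using mult[of z] fin[of z] by simp
      then show False by blast
    qed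
  qed auto
  moreover have "D (lam k) = 0" for k
  proof -
    have "card {j. lam j = lam k} \<noteq> 0" using fin[of "lam k"] by auto
    then have "zorder D (lam k) \<noteq> 0" using mult[of "lam k"] by linarith
    moreover have "D analytic_on {lam k}" using D_holo by (auto simp: analytic_on_holomorphic)
    ultimately show ?thesis using zorder_eq_0I by blast
  qed
  then have "{k. norm (lam k) \<le> \<rho>} \<subseteq> (\<Union>z\<in>{z\<in>cball 0 \<rho>. D z = 0}. {k. lam k = z})" by auto
  ultimately show ?thesis
    using fin by (meson finite_UN_I finite_subset)
qed

lemma finite_small_zeros [simp]: "finite (small_zeros \<rho>)"
  by (rule finite_subset[OF _ finite_cball[of \<rho>]]) (auto simp: small_zeros_def)

lemma quotient_exists:
  "\<exists>g. g holomorphic_on UNIV \<and> (\<forall>z. D z = z ^ s * canonical_part \<rho> z * g z) \<and> (\<forall>z. norm z \<le> \<rho> \<longrightarrow> g z \<noteq> 0)"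
proof -
  define A where "A = {k. lam k = 0} \<union> small_zeros \<rho>"
  have finA: "finite A" using fin by (simp add: A_def)
  obtain w0 where w0: "D w0 \<noteq> 0" using D_nz by blast
  have le: "int (card {k\<in>A. lam k = z}) \<le> zorder D z" for z
    unfolding mult[symmetric] using fin[of z] by (intro of_nat_mono card_mono) auto
  obtain g where g: "g holomorphic_on UNIV" "\<And>z. D z = (\<Prod>k\<in>A. z - lam k) * g z"
     "\<And>z. zorder D z = int (card {k\<in>A. lam k = z}) + zorder g z"
    using divide_out_zeros[OF finA D_holo w0 le] by blast
  define e where "e = (\<Prod>k\<in>small_zeros \<rho>. - lam k)"
  have e: "e \<noteq> 0" unfolding e_def prod_zero_iff[OF finite_small_zeros] by (auto simp: small_zeros_def)
  have pr: "(\<Prod>k\<in>A. z - lam k) = z ^ s * (canonical_part \<rho> z * e)" for z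
  proof -
    have "(\<Prod>k\<in>A. z - lam k) = (\<Prod>k\<in>{k. lam k = 0}. z - lam k) * (\<Prod>k\<in>small_zeros \<rho>. z - lam k)"
      unfolding A_def by (rule prod.union_disjoint[OF fin finite_small_zeros]) (auto simp: small_zeros_def)
    also have "(\<Prod>k\<in>{k. lam k = 0}. z - lam k) = z ^ s" by (simp add: s_def)
    also have "(\<Prod>k\<in>small_zeros \<rho>. z - lam k) = canonical_part \<rho> z * e"
      unfolding canonical_part_def e_def prod.distrib[symmetric] by (intro prod.cong) (auto simp: small_zeros_def field_simps)
    finally show ?thesis .
  qed
  have gw: "g w0 \<noteq> 0" using g(2)[of w0] w0 by auto
  have "g z \<noteq> 0" if "norm z \<le> \<rho>" for z
  proof -
    have "{k\<in>A. lam k = z} = {k. lam k = z}" using that by (auto simp: A_def small_zeros_def)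
    then have "zorder g z = 0" using g(3)[of z] mult[of z] by simp
    moreover have "g analytic_on {z}" using g(1) by (auto simp: analytic_on_holomorphic)
    moreover have "\<exists>\<^sub>F w in at z. g w \<noteq> 0"
      using entire_eventually_nonzero[OF g(1) gw, of z] by (intro eventually_frequently) auto
    ultimately show ?thesis using zorder_eq_0_iff by blast
  qed
  then show ?thesis
    using g(1,2) e pr by (intro exI[of _ "\<lambda>z. e * g z"]) (auto intro!: holomorphic_intros simp: mult_ac)
qed

text \<open>
  What is left of \<open>D\<close> after dividing out the zeros in the disc of radius \<open>\<rho>\<close>. It has no zeros in
  that disc, so it has a logarithm there.
\<close>
definition zero_free_part where "zero_free_part \<rho> = (SOME g. g holomorphic_on UNIV \<and> (\<forall>z. D z = z ^ s * canonical_part \<rho> z * g z) \<and> (\<forall>z. norm z \<le> \<rho> \<longrightarrow> g z \<noteq> 0))"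

lemma zero_free_part: "zero_free_part \<rho> holomorphic_on UNIV" "D z = z ^ s * canonical_part \<rho> z * zero_free_part \<rho> z" "norm z \<le> \<rho> \<Longrightarrow> zero_free_part \<rho> z \<noteq> 0"
  using someI_ex[OF quotient_exists[of \<rho>], folded zero_free_part_def] by blast+

lemma zero_free_part_isCont: "isCont (zero_free_part \<rho>) z"
  using zero_free_part(1)[of \<rho>] by (metis UNIV_I continuous_on_eq_continuous_at holomorphic_on_imp_continuous_on open_UNIV)

lemma canonical_part_tendsto: "(canonical_part \<rho> \<longlongrightarrow> 1) (at 0)"
proof -
  have "((\<lambda>z. \<Prod>k\<in>small_zeros \<rho>. 1 - z / lam k) \<longlongrightarrow> (\<Prod>k\<in>small_zeros \<rho>. 1 - 0 / lam k)) (at 0)"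
    by (intro tendsto_intros) (auto simp: small_zeros_def)
  then show ?thesis unfolding canonical_part_def[abs_def] by simp
qed

lemma D_div_tendsto: "((\<lambda>z. D z / z ^ s) \<longlongrightarrow> zero_free_part \<rho> 0) (at 0)"
proof -
  have "((\<lambda>z. canonical_part \<rho> z * zero_free_part \<rho> z) \<longlongrightarrow> 1 * zero_free_part \<rho> 0) (at 0)"
    using zero_free_part_isCont[where \<rho> = \<rho> and z = 0] by (intro tendsto_mult canonical_part_tendsto) (simp add: isCont_def)
  moreover have "\<forall>\<^sub>F z in at 0. canonical_part \<rho> z * zero_free_part \<rho> z = D z / z ^ s"
    using eventually_neq_at_within[of 0 0 UNIV] by eventually_elim (simp add: zero_free_part(2)[of _ \<rho>])
  ultimately show ?thesis by (simp add: Lim_transform_eventually)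
qed

text \<open>
  The first nonvanishing Taylor coefficient of \<open>D\<close> at 0, which does not depend on the radius used
  here to define it.
\<close>
definition leading_coeff where "leading_coeff = zero_free_part 0 0"

lemma zero_free_part_0: "zero_free_part \<rho> 0 = leading_coeff"
  unfolding leading_coeff_def by (rule tendsto_unique[OF _ D_div_tendsto D_div_tendsto]) simp

lemma leading_coeff_nz: "leading_coeff \<noteq> 0"
  unfolding leading_coeff_def by (rule zero_free_part(3)) simp

text \<open>
  On the circle of radius \<open>R\<close> the canonical factors of zeros with \<open>(m + 1) * \<bar>lam k\<bar> \<le> R\<close> are at
  least \<open>m\<close> in modulus, and the maximum principle carries the bound inside. The case \<open>m = 3\<close> at the
  origin counts zeros as in Jensen's formula; the case \<open>m = 1\<close> bounds the quotient.
\<close>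
lemma zero_free_part_bound:
  assumes R: "R \<ge> 1" and m: "0 \<le> m" "(m + 1) * \<rho> \<le> R" and m1: "m \<ge> 1" and z: "norm z \<le> R"
  shows "m ^ card (small_zeros \<rho>) * norm (zero_free_part \<rho> z) \<le> C * exp (c * sqrt R)"
proof -
  have fr: "norm (zero_free_part \<rho> w) \<le> C * exp (c * sqrt R) / m ^ card (small_zeros \<rho>)" if w: "norm w = R" for w
  proof -
    have "m ^ card (small_zeros \<rho>) = (\<Prod>k\<in>small_zeros \<rho>. m)" by simp
    also have "\<dots> \<le> (\<Prod>k\<in>small_zeros \<rho>. norm (1 - w / lam k))"
    proof (rule prod_mono)
      fix k assume k: "k \<in> small_zeros \<rho>"
      then have l: "norm (lam k) > 0" "norm (lam k) \<le> \<rho>" by (auto simp: small_zeros_def)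
      have "(m + 1) * norm (lam k) \<le> (m + 1) * \<rho>" using l m by (intro mult_left_mono) auto
      then have "m + 1 \<le> R / norm (lam k)" using l m by (simp add: field_simps)
      also have "R / norm (lam k) = norm (w / lam k)" by (simp add: norm_divide w)
      also have "\<dots> \<le> norm (1 - w / lam k) + 1"
        using norm_triangle_ineq4[of 1 "1 - w / lam k"] by simp
      finally show "0 \<le> m \<and> m \<le> norm (1 - w / lam k)" using m by auto
    qed
    also have "\<dots> = norm (canonical_part \<rho> w)" by (simp add: canonical_part_def prod_norm)
    finally have 1: "m ^ card (small_zeros \<rho>) \<le> norm (canonical_part \<rho> w)" .
    have "1 * m ^ card (small_zeros \<rho>) * norm (zero_free_part \<rho> w) \<le> norm w ^ s * norm (canonical_part \<rho> w) * norm (zero_free_part \<rho> w)"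
      using 1 R w m by (intro mult_right_mono mult_mono) auto
    also have "\<dots> = norm (D w)" by (simp add: zero_free_part(2)[of w \<rho>] norm_mult norm_power)
    also have "\<dots> \<le> C * exp (c * sqrt R)" using growth[of w] w R by simp
    finally show ?thesis using m1 by (simp add: field_simps)
  qed
  have "norm (zero_free_part \<rho> z) \<le> C * exp (c * sqrt R) / m ^ card (small_zeros \<rho>)"
  proof (rule maximum_modulus_frontier[where S = "cball 0 R" and f = "zero_free_part \<rho>" and \<xi> = z])
    show "zero_free_part \<rho> holomorphic_on interior (cball 0 R)"
      using zero_free_part(1) by (rule holomorphic_on_subset) simp
    show "continuous_on (closure (cball 0 R)) (zero_free_part \<rho>)"
      using holomorphic_on_imp_continuous_on[OF zero_free_part(1)] by (rule continuous_on_subset) simp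
    show "norm (zero_free_part \<rho> w) \<le> C * exp (c * sqrt R) / m ^ card (small_zeros \<rho>)" if "w \<in> frontier (cball 0 R)" for w
      using fr[of w] that R by (simp add: frontier_cball)
    show "z \<in> cball 0 R" using z by simp
  qed simp
  then show ?thesis using m1 by (simp add: field_simps)
qed

lemma card_small_zeros_bound: "\<exists>K\<ge>0. \<forall>\<rho>\<ge>1. real (card (small_zeros \<rho>)) \<le> K * sqrt \<rho>"
proof -
  define K where "K = (\<bar>ln (C / norm leading_coeff)\<bar> + 2 * c) / ln 3"
  have K: "K \<ge> 0" using c_nonneg by (simp add: K_def)
  have "real (card (small_zeros \<rho>)) \<le> K * sqrt \<rho>" if \<rho>: "\<rho> \<ge> 1" for \<rho>
  proof -
    have "3 ^ card (small_zeros \<rho>) * norm (zero_free_part \<rho> 0) \<le> C * exp (c * sqrt (4 * \<rho>))"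
      by (rule zero_free_part_bound) (use \<rho> in auto)
    then have "3 ^ card (small_zeros \<rho>) \<le> C / norm leading_coeff * exp (c * sqrt (4 * \<rho>))"
      using leading_coeff_nz by (simp add: zero_free_part_0 field_simps)
    then have "ln (3 ^ card (small_zeros \<rho>)) \<le> ln (C / norm leading_coeff * exp (c * sqrt (4 * \<rho>)))"
      using C_pos leading_coeff_nz by (subst ln_le_cancel_iff) auto
    also have "\<dots> = ln (C / norm leading_coeff) + c * sqrt (4 * \<rho>)"
      using C_pos leading_coeff_nz by (subst ln_mult) auto
    also have "ln (3 ^ card (small_zeros \<rho>)) = real (card (small_zeros \<rho>)) * ln 3" by (simp add: ln_realpow)
    also have "sqrt (4 * \<rho>) = 2 * sqrt \<rho>" by (simp add: real_sqrt_mult)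
    finally have "real (card (small_zeros \<rho>)) * ln 3 \<le> \<bar>ln (C / norm leading_coeff)\<bar> * 1 + 2 * c * sqrt \<rho>" by simp
    also have "\<dots> \<le> \<bar>ln (C / norm leading_coeff)\<bar> * sqrt \<rho> + 2 * c * sqrt \<rho>"
      using \<rho> by (intro add_right_mono mult_left_mono) auto
    finally show ?thesis by (simp add: K_def field_simps)
  qed
  then show ?thesis using K by blast
qed

text \<open>
  Among the indices with \<open>4 ^ (i - 1) < \<bar>lam k\<bar> \<le> 4 ^ i\<close> there are \<open>O(2 ^ i)\<close>, and each contributes at
  most \<open>4 / 4 ^ i\<close>.
\<close>
lemma summable_inverse_zeros: "summable (\<lambda>k. 1 / norm (lam k))"
proof -
  obtain K where K: "K \<ge> 0" "\<And>\<rho>. \<rho> \<ge> 1 \<Longrightarrow> real (card (small_zeros \<rho>)) \<le> K * sqrt \<rho>"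
    using card_small_zeros_bound by blast
  define j where "j = (\<lambda>k. LEAST n::nat. norm (lam k) \<le> 4 ^ n)"
  have jex: "\<exists>n::nat. norm (lam k) \<le> 4 ^ n" for k
    using real_arch_pow[of 4 "norm (lam k)"] by (auto intro: less_imp_le)
  have j1: "norm (lam k) \<le> 4 ^ j k" for k
    unfolding j_def by (rule LeastI_ex[OF jex])
  have j2: "4 ^ n < norm (lam k)" if "n < j k" for k n
    using not_less_Least[of n "\<lambda>n. norm (lam k) \<le> 4 ^ n"] that by (auto simp: j_def)
  define B where "B = (\<Sum>k\<in>small_zeros 1. 1 / norm (lam k))"
  show ?thesis
  proof (rule summableI_nonneg_bounded[where x = "B + 8 * K"])
    show "0 \<le> 1 / norm (lam k)" for k by simp
    fix n
    define F where "F = {k\<in>{..<n}. norm (lam k) > 1}"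
    have finF: "finite F" by (simp add: F_def)
    define J where "J = Max (insert 0 (j ` F))"
    have jJ: "j k \<in> {1..J}" if "k \<in> F" for k
    proof -
      have "j k \<le> J" unfolding J_def using finF that by (intro Max_ge) auto
      moreover have "j k \<noteq> 0"
      proof
        assume "j k = 0"
        then show False using j1[of k] that by (simp add: F_def)
      qed
      ultimately show ?thesis by simp
    qed
    have block: "(\<Sum>k\<in>{k\<in>F. j k = i}. 1 / norm (lam k)) \<le> 4 * K * (1 / 2) ^ i" if i: "i \<in> {1..J}" for i
    proof -
      have sub: "{k\<in>F. j k = i} \<subseteq> small_zeros (4 ^ i)"
        using j1 by (auto simp: F_def small_zeros_def)
      have le4: "1 / norm (lam k) \<le> 4 / 4 ^ i" if "k \<in> {k\<in>F. j k = i}" for k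
      proof -
        have "j k = i" using that by simp
        then have "i - 1 < j k" using i by simp
        from j2[OF this] have lt: "4 ^ (i - 1) < norm (lam k)" .
        have pos: "(0::real) < 4 ^ (i - 1)" by simp
        have "1 / norm (lam k) \<le> 1 / 4 ^ (i - 1)"
          by (rule frac_le) (use lt pos in linarith)+
        also have "\<dots> = 4 / 4 ^ i" using i by (cases i) auto
        finally show ?thesis .
      qed
      have "(\<Sum>k\<in>{k\<in>F. j k = i}. 1 / norm (lam k)) \<le> real (card {k\<in>F. j k = i}) * (4 / 4 ^ i)"
        by (rule sum_bounded_above) (rule le4)
      also have "\<dots> \<le> (K * sqrt (4 ^ i)) * (4 / 4 ^ i)"
      proof (rule mult_right_mono)
        have "real (card {k\<in>F. j k = i}) \<le> real (card (small_zeros (4 ^ i)))"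
          using card_mono[OF finite_small_zeros sub] by simp
        also have "\<dots> \<le> K * sqrt (4 ^ i)" by (rule K(2)) simp
        finally show "real (card {k\<in>F. j k = i}) \<le> K * sqrt (4 ^ i)" .
      qed simp
      also have "sqrt (4 ^ i) = (2::real) ^ i" by (simp add: real_sqrt_power)
      also have "(K * 2 ^ i) * (4 / 4 ^ i) = 4 * K * (1 / 2) ^ i"
      proof -
        have "(4::real) ^ i = 2 ^ i * 2 ^ i" by (simp flip: power_mult_distrib)
        then show ?thesis by (simp add: power_divide field_simps)
      qed
      finally show ?thesis .
    qed
    have "(\<Sum>k<n. 1 / norm (lam k)) = (\<Sum>k\<in>{k\<in>{..<n}. norm (lam k) \<le> 1}. 1 / norm (lam k)) + (\<Sum>k\<in>F. 1 / norm (lam k))"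
    proof -
      have u: "{..<n} = {k\<in>{..<n}. norm (lam k) \<le> 1} \<union> F" by (auto simp: F_def)
      have "(\<Sum>k\<in>{k\<in>{..<n}. norm (lam k) \<le> 1} \<union> F. 1 / norm (lam k)) =
          (\<Sum>k\<in>{k\<in>{..<n}. norm (lam k) \<le> 1}. 1 / norm (lam k)) + (\<Sum>k\<in>F. 1 / norm (lam k))"
        by (rule sum.union_disjoint) (auto simp: F_def)
      then show ?thesis unfolding u[symmetric] .
    qed
    also have "(\<Sum>k\<in>{k\<in>{..<n}. norm (lam k) \<le> 1}. 1 / norm (lam k)) \<le> B"
    proof -
      have "(\<Sum>k\<in>{k\<in>{..<n}. norm (lam k) \<le> 1}. 1 / norm (lam k)) = (\<Sum>k\<in>{k\<in>{..<n}. k \<in> small_zeros 1}. 1 / norm (lam k))"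
        by (rule sum.mono_neutral_right) (auto simp: small_zeros_def)
      also have "\<dots> \<le> B" unfolding B_def by (rule sum_mono2) auto
      finally show ?thesis .
    qed
    also have "(\<Sum>k\<in>F. 1 / norm (lam k)) = (\<Sum>i\<in>{1..J}. \<Sum>k\<in>{k\<in>F. j k = i}. 1 / norm (lam k))"
      by (rule sum.group[symmetric]) (use finF jJ in auto)
    also have "\<dots> \<le> (\<Sum>i\<in>{1..J}. 4 * K * (1 / 2) ^ i)"
      by (rule sum_mono) (rule block)
    also have "\<dots> = 4 * K * (\<Sum>i\<in>{1..J}. (1 / 2) ^ i)"
      by (simp add: sum_distrib_left)
    also have "\<dots> \<le> 4 * K * 2"
    proof (rule mult_left_mono)
      have "(\<Sum>i\<in>{1..J}. (1 / 2) ^ i :: real) \<le> (\<Sum>i. (1 / 2) ^ i)"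
        by (rule sum_le_suminf) (auto intro!: summable_geometric)
      also have "\<dots> = 2" by (subst suminf_geometric) auto
      finally show "(\<Sum>i\<in>{1..J}. (1 / 2) ^ i :: real) \<le> 2" .
    qed (use K in simp)
    finally show "(\<Sum>k<n. 1 / norm (lam k)) \<le> B + 8 * K" by simp
  qed
qed

text \<open>
  The logarithm of the normalized quotient on the disc of radius \<open>n\<close> vanishes at 0 and has real
  part \<open>O(sqrt n)\<close>, so by the Borel-Caratheodory inequality it is \<open>O(sqrt n / n)\<close> at any fixed point. This is
  where an order below one excludes an exponential factor.
\<close>
lemma zero_free_part_tendsto: "(\<lambda>n. zero_free_part (real n) z) \<longlonglongrightarrow> leading_coeff"
proof -
  define a where "a = \<bar>ln (C / norm leading_coeff)\<bar> + 1"
  define A where "A = (\<lambda>n. a + c * sqrt (2 * real n))"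
  have bound: "\<forall>\<^sub>F n in sequentially. norm (zero_free_part (real n) z / leading_coeff - 1) \<le> 2 * (2 * A n * norm z / (real n - norm z))"
    if small: "\<forall>\<^sub>F n in sequentially. 2 * A n * norm z / (real n - norm z) \<le> 1 / 2"
  proof -
    have "\<forall>\<^sub>F n in sequentially. n \<ge> nat \<lceil>norm z\<rceil> + 1"
      by (rule eventually_ge_at_top)
    with small show ?thesis
    proof eventually_elim
      case (elim n)
      have n: "real n > norm z" "real n \<ge> 1" using elim(2) by linarith+
      let ?g = "\<lambda>w. zero_free_part (real n) w / leading_coeff"
      have gh: "?g holomorphic_on ball 0 (real n)"
        using holomorphic_on_subset[OF zero_free_part(1)] leading_coeff_nz by (intro holomorphic_intros) auto
      have gnz: "?g w \<noteq> 0" if "w \<in> ball 0 (real n)" for w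
        using zero_free_part(3)[of w "real n"] that leading_coeff_nz by auto
      obtain h0 where h0: "h0 holomorphic_on ball 0 (real n)" "\<And>w. w \<in> ball 0 (real n) \<Longrightarrow> ?g w = exp (h0 w)"
        by (rule contractible_imp_holomorphic_log[OF gh _ gnz]) (auto intro!: convex_imp_contractible)
      define h where "h = (\<lambda>w. h0 w - h0 0)"
      have e0: "exp (h0 0) = 1" using h0(2)[of 0] n by (simp add: zero_free_part_0 leading_coeff_nz)
      have he: "exp (h w) = ?g w" if "w \<in> ball 0 (real n)" for w
        using h0(2)[OF that] by (simp add: h_def exp_diff e0)
      have Re: "Re (h w) < A n" if w: "norm w < real n" for w
      proof -
        have "exp (Re (h w)) = norm (zero_free_part (real n) w) / norm leading_coeff"
          using he[of w] w by (simp add: norm_divide flip: norm_exp_eq_Re)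
        also have "1 ^ card (small_zeros (real n)) * norm (zero_free_part (real n) w) \<le> C * exp (c * sqrt (2 * real n))"
          by (rule zero_free_part_bound) (use n w in auto)
        then have "norm (zero_free_part (real n) w) / norm leading_coeff \<le> C / norm leading_coeff * exp (c * sqrt (2 * real n))"
          using leading_coeff_nz by (simp add: field_simps)
        also have "\<dots> = exp (ln (C / norm leading_coeff) + c * sqrt (2 * real n))"
          using C_pos leading_coeff_nz by (simp add: exp_add)
        finally have "Re (h w) \<le> ln (C / norm leading_coeff) + c * sqrt (2 * real n)" by simp
        then show ?thesis by (simp add: A_def a_def)
      qed
      have Apos: "A n > 0" using c_nonneg by (simp add: A_def a_def add_pos_nonneg)
      have hb: "norm (h z) \<le> 2 * A n * norm z / (real n - norm z)"
        by (rule borel_caratheodory_ball[OF _ _ _ Apos Re]) (use n h0(1) in \<open>auto simp: h_def intro!: holomorphic_intros\<close>)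
      then have "norm (h z) \<le> 1 / 2" using elim(1) by linarith
      then have "norm (exp (h z) - 1) \<le> 3 / 2 * norm (h z)" by (rule norm_exp_bounds)
      also have "\<dots> \<le> 2 * (2 * A n * norm z / (real n - norm z))"
      proof -
        have "3 / 2 * norm (h z) \<le> 2 * norm (h z)" by simp
        also have "\<dots> \<le> 2 * (2 * A n * norm z / (real n - norm z))" using hb by (rule mult_left_mono) simp
        finally show ?thesis .
      qed
      finally show ?case using he[of z] n by simp
    qed
  qed
  have lim: "(\<lambda>n. 2 * A n * norm z / (real n - norm z)) \<longlonglongrightarrow> 0"
  proof -
    have l1: "(\<lambda>n. 1 / (real n - norm z)) \<longlonglongrightarrow> 0" by real_asymp
    have l2: "(\<lambda>n. sqrt (2 * real n) / (real n - norm z)) \<longlonglongrightarrow> 0" by real_asymp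
    have "(\<lambda>n. 2 * norm z * (a * (1 / (real n - norm z)) + c * (sqrt (2 * real n) / (real n - norm z)))) \<longlonglongrightarrow> 2 * norm z * (a * 0 + c * 0)"
      by (intro tendsto_mult_left tendsto_add l1 l2)
    moreover have "2 * A n * norm z / (real n - norm z) = 2 * norm z * (a * (1 / (real n - norm z)) + c * (sqrt (2 * real n) / (real n - norm z)))" for n
      by (simp add: A_def algebra_simps add_divide_distrib)
    ultimately show ?thesis by simp
  qed
  have "\<forall>\<^sub>F n in sequentially. 2 * A n * norm z / (real n - norm z) \<le> 1 / 2"
    using order_tendstoD(2)[OF lim, of "1/2"] by (auto elim: eventually_mono)
  from bound[OF this] have "(\<lambda>n. zero_free_part (real n) z / leading_coeff - 1) \<longlonglongrightarrow> 0"
    by (rule Lim_null_comparison) (rule tendsto_mult_right_zero[OF lim])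
  then have "(\<lambda>n. zero_free_part (real n) z / leading_coeff) \<longlonglongrightarrow> 1"
    by (rule LIM_zero_cancel)
  from tendsto_mult_right[OF this, of leading_coeff] show ?thesis
    using leading_coeff_nz by simp
qed

lemma Theta_factor_summable: "summable (\<lambda>k. norm (Theta_factor lam z k - 1))"
proof (rule summable_comparison_test')
  show "summable (\<lambda>k. norm z * (1 / norm (lam k)))"
    by (rule summable_mult[OF summable_inverse_zeros])
  show "norm (norm (Theta_factor lam z k - 1)) \<le> norm z * (1 / norm (lam k))" if "k \<ge> 0" for k
    by (simp add: Theta_factor_def norm_divide)
qed

theorem hadamard_product: "D z = leading_coeff * Theta lam z"
proof -
  define K where "K = (\<lambda>n. {k. norm (lam k) \<le> real n})"
  have "filterlim K (finite_subsets_at_top UNIV) sequentially"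
    unfolding filterlim_finite_subsets_at_top
  proof (intro allI impI)
    fix X :: "nat set" assume X: "finite X \<and> X \<subseteq> UNIV"
    obtain N where N: "\<And>k. k \<in> X \<Longrightarrow> norm (lam k) \<le> real N"
    proof -
      obtain b where "\<forall>k\<in>X. norm (lam k) \<le> b"
        using X finite_imp_bounded[of "lam ` X"] by (auto simp: bounded_iff)
      then show thesis using that real_arch_simple[of b] by (metis order_trans)
    qed
    show "\<forall>\<^sub>F n in sequentially. finite (K n) \<and> X \<subseteq> K n \<and> K n \<subseteq> UNIV"
      using eventually_ge_at_top[of N]
      by eventually_elim (use N finite_cball in \<open>force simp: K_def\<close>)
  qed
  from prod_exhaustion_tendsto_prodinf[OF Theta_factor_summable this]
  have "(\<lambda>n. \<Prod>k\<in>K n. Theta_factor lam z k) \<longlonglongrightarrow> prodinf (Theta_factor lam z)" .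
  moreover have "(\<Prod>k\<in>K n. Theta_factor lam z k) = canonical_part (real n) z" for n
  proof -
    have "(\<Prod>k\<in>K n. Theta_factor lam z k) = (\<Prod>k\<in>small_zeros (real n). Theta_factor lam z k)"
      by (rule prod.mono_neutral_right) (use finite_cball in \<open>auto simp: K_def small_zeros_def Theta_factor_def\<close>)
    also have "\<dots> = canonical_part (real n) z"
      unfolding canonical_part_def by (rule prod.cong) (auto simp: small_zeros_def Theta_factor_def)
    finally show ?thesis .
  qed
  ultimately have "(\<lambda>n. canonical_part (real n) z) \<longlonglongrightarrow> prodinf (Theta_factor lam z)" by simp
  then have "(\<lambda>n. z ^ s * canonical_part (real n) z * zero_free_part (real n) z) \<longlonglongrightarrow> z ^ s * prodinf (Theta_factor lam z) * leading_coeff"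
    by (intro tendsto_mult tendsto_const zero_free_part_tendsto)
  then have "(\<lambda>n::nat. D z) \<longlonglongrightarrow> z ^ s * prodinf (Theta_factor lam z) * leading_coeff"
    by (simp flip: zero_free_part(2))
  from LIMSEQ_unique[OF tendsto_const this] show ?thesis
    by (simp add: Theta_def s_def mult.commute)
qed

end

section \<open>Unconditional convergence\<close>
text \<open>
  Appending \<open>n\<close> in step \<open>n\<close>, unless it is already listed, makes the resulting enumeration exhaustive.
\<close>
definition fresh_block :: "(nat set \<Rightarrow> nat set) \<Rightarrow> nat \<Rightarrow> nat list \<Rightarrow> nat list" where
  "fresh_block G n xs = sorted_list_of_set (G (set xs)) @ (if n \<in> set xs \<union> G (set xs) then [] else [n])"

fun block_list :: "(nat set \<Rightarrow> nat set) \<Rightarrow> nat \<Rightarrow> nat list" where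
  "block_list G 0 = []"
| "block_list G (Suc n) = block_list G n @ fresh_block G n (block_list G n)"

text \<open>
  A set \<open>G F\<close> avoiding \<open>F\<close> is available at any stage, so an enumeration of all natural numbers can be
  arranged in which such sets appear as consecutive blocks arbitrarily late.
\<close>
lemma block_list_enumeration:
  assumes G: "\<And>F. finite F \<Longrightarrow> finite (G F) \<and> G F \<inter> F = {}"
  obtains p :: "nat \<Rightarrow> nat" where "bij p"
    "\<And>n. \<exists>m\<ge>n. \<exists>l. p ` {m..<l} = G (p ` {..<m})"
proof -
  define L where "L = block_list G"
  have L_Suc: "L (Suc n) = L n @ sorted_list_of_set (G (set (L n))) @ (if n \<in> set (L n) \<union> G (set (L n)) then [] else [n])" for n
    by (simp add: L_def fresh_block_def)
  have Gf: "finite (G (set (L n)))" "G (set (L n)) \<inter> set (L n) = {}" for n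
    using G[of "set (L n)"] by auto
  have dist: "distinct (L n)" for n
  proof (induction n)
    case 0 then show ?case by (simp add: L_def)
  next
    case (Suc n)
    then show ?case using Gf[of n] by (auto simp: L_Suc)
  qed
  have mem: "n \<in> set (L (Suc n))" for n
    using Gf[of n] by (auto simp: L_Suc)
  have pref: "take (length (L m)) (L n) = L m" if "m \<le> n" for m n
    using that
  proof (induction n)
    case 0 then show ?case by simp
  next
    case (Suc n)
    show ?case
    proof (cases "m = Suc n")
      case False
      then have e: "take (length (L m)) (L n) = L m" using Suc by simp
      then have "length (L m) \<le> length (L n)" by (metis length_take min.cobounded2 nle_le min.absorb1)
      then show ?thesis using e by (simp add: L_Suc)
    qed simp
  qed
  have len_mono: "length (L m) \<le> length (L n)" if "m \<le> n" for m n
    using pref[OF that] by (metis length_take min.cobounded1)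
  have nth: "L n ! i = L m ! i" if "m \<le> n" "i < length (L m)" for m n i
    using pref[OF that(1)] that(2) by (metis nth_take)
  have len: "n \<le> length (L n)" for n
  proof -
    have "{..<n} \<subseteq> set (L n)"
    proof
      fix i assume "i \<in> {..<n}"
      then have "Suc i \<le> n" by simp
      from pref[OF this] mem[of i] show "i \<in> set (L n)" by (metis in_set_takeD)
    qed
    from card_mono[OF _ this] show ?thesis using distinct_card[OF dist[of n]] by simp
  qed
  define p where "p = (\<lambda>k. L (Suc k) ! k)"
  have p_eq: "p i = L n ! i" if "i < length (L n)" for i n
  proof -
    have "i < length (L (Suc i))" using len[of "Suc i"] by simp
    then show ?thesis unfolding p_def
      using nth[of n "Suc i" i] nth[of "Suc i" n i] that by (cases "n \<le> Suc i") auto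
  qed
  have p_img: "p ` {..<length (L n)} = set (L n)" for n
    using p_eq[of _ n] by (force simp: in_set_conv_nth image_iff)
  have "inj p"
  proof (rule injI)
    fix i j assume eq: "p i = p j"
    define n where "n = Suc (max i j)"
    have "i < length (L n)" "j < length (L n)" using len[of n] by (auto simp: n_def)
    then show "i = j" using eq p_eq[of i n] p_eq[of j n] nth_eq_iff_index_eq[OF dist[of n]] by simp
  qed
  moreover have "surj p"
    unfolding surj_def
  proof
    fix n
    have "n \<in> p ` {..<length (L (Suc n))}" using mem[of n] p_img[of "Suc n"] by (simp only:)
    then show "\<exists>i. n = p i" by (auto elim: imageE)
  qed
  ultimately have "bij p" by (simp add: bij_def)
  moreover have "\<exists>m\<ge>n. \<exists>l. p ` {m..<l} = G (p ` {..<m})" for n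
  proof -
    let ?g = "sorted_list_of_set (G (set (L n)))" and ?m = "length (L n)"
    have "p (?m + i) = ?g ! i" if "i < length ?g" for i
      using p_eq[of "?m + i" "Suc n"] that by (simp add: L_Suc nth_append)
    moreover have "{?m..<?m + length ?g} = (\<lambda>i. ?m + i) ` {..<length ?g}"
      by (metis add_0 atLeast0LessThan image_add_atLeastLessThan add.commute)
    ultimately have "p ` {?m..<?m + length ?g} = (\<lambda>i. ?g ! i) ` {..<length ?g}"
      by (simp add: image_image)
    also have "\<dots> = set ?g" by (auto simp: set_conv_nth)
    also have "\<dots> = G (p ` {..<?m})" using Gf(1)[of n] by (simp add: p_img)
    finally show ?thesis using len[of n] by blast
  qed
  ultimately show thesis by (rule that)
qed

text \<open>
  If the norms were not summable, then outside every finite set there would be a finite set whose sum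
  has norm at least 1. An enumeration containing such sets as blocks violates the Cauchy criterion.
  Finite dimension enters where small subset sums bound the sum of the norms.
\<close>
theorem unconditionally_summable_imp_summable_norm:
  fixes a :: "nat \<Rightarrow> 'a::euclidean_space"
  assumes a: "\<And>p. bij p \<Longrightarrow> summable (\<lambda>k. a (p k))"
  shows "summable (\<lambda>k. norm (a k))"
proof (rule ccontr)
  assume div: "\<not> summable (\<lambda>k. norm (a k))"
  have "\<exists>G. finite G \<and> G \<inter> F = {} \<and> norm (sum a G) \<ge> 1" if F: "finite F" for F
  proof (rule ccontr)
    assume "\<not> ?thesis"
    then have small: "norm (sum a G) \<le> 1" if "finite G" "G \<inter> F = {}" for G
      using that by (meson nle_le)
    have "(\<Sum>k<n. norm (a k)) \<le> (\<Sum>k\<in>F. norm (a k)) + 2 * real DIM('a) * 1" for n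
    proof -
      have "(\<Sum>k<n. norm (a k)) \<le> (\<Sum>k\<in>F \<union> ({..<n} - F). norm (a k))"
        using F by (intro sum_mono2) auto
      also have "\<dots> = (\<Sum>k\<in>F. norm (a k)) + (\<Sum>k\<in>{..<n} - F. norm (a k))"
        using F by (intro sum.union_disjoint) auto
      also have "(\<Sum>k\<in>{..<n} - F. norm (a k)) \<le> 2 * real DIM('a) * 1"
      proof (rule sum_norm_allsubsets_bound)
        fix Q assume "Q \<subseteq> {..<n} - F"
        then show "norm (sum a Q) \<le> 1" by (intro small) (auto intro: finite_subset)
      qed simp
      finally show ?thesis by simp
    qed
    then have "summable (\<lambda>k. norm (a k))" by (intro summableI_nonneg_bounded) auto
    with div show False ..
  qed
  then obtain G where G: "\<And>F. finite F \<Longrightarrow> finite (G F) \<and> G F \<inter> F = {} \<and> norm (sum a (G F)) \<ge> 1"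
    by metis
  have G': "finite (G F) \<and> G F \<inter> F = {}" if "finite F" for F using G[OF that] by blast
  obtain p :: "nat \<Rightarrow> nat" where p: "bij p" "\<And>n. \<exists>m\<ge>n. \<exists>l. p ` {m..<l} = G (p ` {..<m})"
    by (rule block_list_enumeration[OF G']; (assumption | rule that; assumption))
  from a[OF p(1)] obtain N where N: "\<And>m n. m \<ge> N \<Longrightarrow> norm (\<Sum>k=m..<n. a (p k)) < 1"
    unfolding summable_Cauchy by (meson zero_less_one)
  obtain m l where m: "m \<ge> N" "p ` {m..<l} = G (p ` {..<m})" using p(2) by blast
  have "(\<Sum>k=m..<l. a (p k)) = sum a (p ` {m..<l})"
    using bij_is_inj[OF p(1)] by (subst sum.reindex) (auto intro: inj_on_subset)
  then have "norm (\<Sum>k=m..<l. a (p k)) \<ge> 1"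
    using G[of "p ` {..<m}"] m(2) by simp
  with N[OF m(1), of l] show False by simp
qed

text \<open>
  The logarithms of the factors form an unconditionally convergent series, and \<open>Ln w\<close> and \<open>w - 1\<close> are comparable
  near 1.
\<close>
lemma unconditional_prod_imp_summable_norm:
  fixes f :: "nat \<Rightarrow> complex"
  assumes nz: "\<And>k. f k \<noteq> 0" and conv: "\<And>p. bij p \<Longrightarrow> convergent_prod (\<lambda>k. f (p k))"
  shows "summable (\<lambda>k. norm (f k - 1))"
proof -
  have s: "summable (\<lambda>k. norm (Ln (f k)))"
  proof (rule unconditionally_summable_imp_summable_norm)
    fix p :: "nat \<Rightarrow> nat" assume "bij p"
    from conv[OF this] show "summable (\<lambda>k. Ln (f (p k)))"
      using convergent_prod_iff_summable_complex[of "\<lambda>k. f (p k)"] nz by blast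
  qed
  have "\<forall>\<^sub>F k in sequentially. norm (Ln (f k)) < 1 / 2"
    using order_tendstoD(2)[OF summable_LIMSEQ_zero[OF s], of "1 / 2"] by simp
  then have "\<forall>\<^sub>F k in sequentially. norm (norm (f k - 1)) \<le> 3 / 2 * norm (Ln (f k))"
  proof eventually_elim
    case (elim k)
    have "norm (exp (Ln (f k)) - 1) \<le> 3 / 2 * norm (Ln (f k))"
      by (rule norm_exp_bounds) (use elim in simp)
    then show ?case using exp_Ln[OF nz[of k]] by simp
  qed
  then show ?thesis
    by (rule summable_comparison_test_ev) (rule summable_mult[OF s])
qed

section \<open>The zeros of the product\<close>
text \<open>
  At such a point no factor of the product vanishes, whatever the sequence is.
\<close>
lemma obtain_outside_range:
  fixes lam :: "nat \<Rightarrow> complex"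
  obtains z where "z \<noteq> 0" "\<And>k. lam k \<noteq> z"
proof -
  have "countable (insert 0 (range lam))" by simp
  moreover have "uncountable (UNIV :: complex set)"
    using uncountable_ball[of 1 "0::complex"] countable_subset[OF subset_UNIV] by auto
  ultimately have "insert 0 (range lam) \<noteq> UNIV" by metis
  then obtain z where "z \<notin> insert 0 (range lam)" by blast
  with that[of z] show thesis by auto
qed

lemma Theta_convergent_imp_summable_inverse:
  assumes "\<And>z. Theta_convergent lam z"
  shows "summable (\<lambda>k. 1 / norm (lam k))"
proof -
  obtain z where z: "z \<noteq> 0" "\<And>k. lam k \<noteq> z" by (rule obtain_outside_range[of lam]) (rule that; assumption)
  have "summable (\<lambda>k. norm (Theta_factor lam z k - 1))"
  proof (rule unconditional_prod_imp_summable_norm)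
    show "Theta_factor lam z k \<noteq> 0" for k using z(2)[of k] by (auto simp: Theta_factor_def)
    show "convergent_prod (\<lambda>k. Theta_factor lam z (p k))" if "bij p" for p
      using assms[of z] that by (simp add: Theta_convergent_def)
  qed
  then have "summable (\<lambda>k. (1 / norm z) * norm (Theta_factor lam z k - 1))" by (rule summable_mult)
  also have "(\<lambda>k. (1 / norm z) * norm (Theta_factor lam z k - 1)) = (\<lambda>k. 1 / norm (lam k))"
    using z(1) by (auto simp: Theta_factor_def norm_divide)
  finally show ?thesis .
qed

lemma summable_inverse_imp_Theta_convergent:
  assumes "summable (\<lambda>k. 1 / norm (lam k))"
  shows "Theta_convergent lam z"
  unfolding Theta_convergent_def
proof (intro allI impI)
  fix p :: "nat \<Rightarrow> nat" assume p: "bij p"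
  have "summable (\<lambda>k. norm z * (1 / norm (lam k)))" by (rule summable_mult) (rule assms)
  then have "summable (\<lambda>k. norm (Theta_factor lam z k - 1))"
    by (rule summable_comparison_test') (simp add: Theta_factor_def norm_divide)
  from summable_reindex[OF this bij_is_inj[OF p]]
  have "summable (\<lambda>k. norm (Theta_factor lam z (p k) - 1))" by (simp add: o_def)
  then have "abs_convergent_prod (\<lambda>k. Theta_factor lam z (p k))"
    by (simp add: abs_convergent_prod_conv_summable)
  then show "convergent_prod (\<lambda>k. Theta_factor lam z (p k))"
    by (rule abs_convergent_prod_imp_convergent_prod)
qed

text \<open>
  Finitely many factors are treated as a polynomial, which also absorbs the power of \<open>z\<close>; the others
  form a Weierstrass product of genus zero, whose zeros are known.
\<close>
lemma Theta_zeros: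
  assumes fin0: "finite {k. lam k = 0}" and sum: "summable (\<lambda>k. 1 / norm (lam k))"
  shows "finite {k. lam k = w}" "zorder (Theta lam) w = int (card {k. lam k = w})" "\<exists>z. Theta lam z \<noteq> 0"
proof -
  obtain N where N: "\<And>k. lam k = 0 \<Longrightarrow> k < N"
    using fin0 by (metis (mono_tags) finite_nat_set_iff_bounded mem_Collect_eq)
  define a where "a = (\<lambda>n. lam (n + N))"
  have a_nz: "a n \<noteq> 0" for n using N[of "n + N"] by (auto simp: a_def)
  have suma: "summable (\<lambda>n. 1 / norm (a n))"
    using sum by (simp add: a_def summable_iff_shift[of "\<lambda>k. 1 / norm (lam k)"])
  have "filterlim (\<lambda>n. inverse (1 / norm (a n))) at_top sequentially"
    by (rule filterlim_inverse_at_top[OF summable_LIMSEQ_zero[OF suma]]) (use a_nz in simp)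
  then have "filterlim (\<lambda>n. norm (a n)) at_top sequentially" by simp
  then have a_inf: "filterlim a at_infinity sequentially" by (rule filterlim_norm_at_top_imp_at_infinity)
  interpret W: weierstrass_product a "\<lambda>_. 0"
  proof
    show "summable (\<lambda>n. (r / norm (a n)) ^ Suc 0)" for r
      using summable_mult[OF suma, of r] by simp
  qed (use a_nz a_inf in auto)
  have Wf: "weierstrass_factor 0 (z / a n) = Theta_factor lam z (n + N)" for z n
    using a_nz[of n] by (simp add: weierstrass_factor_def Theta_factor_def a_def)
  define e where "e = (\<Prod>k<N. if lam k = 0 then 1 else - 1 / lam k)"
  have e: "e \<noteq> 0" by (simp add: e_def)
  have Theta_eq: "Theta lam z = e * ((\<Prod>k<N. z - lam k) * W.f z)" for z
  proof -
    have conv: "convergent_prod (Theta_factor lam z)"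
      using summable_inverse_imp_Theta_convergent[OF sum, of z] by (auto simp: Theta_convergent_def dest: spec[of _ id])
    have "prodinf (Theta_factor lam z) = (\<Prod>k<N. Theta_factor lam z k) * W.f z"
      using has_prod_unique[OF has_prod_ignore_initial_segment'[OF conv, of N]] by (simp add: W.f_def Wf)
    moreover have "z ^ card {k. lam k = 0} = (\<Prod>k<N. if lam k = 0 then z else 1)"
    proof -
      have "{k. lam k = 0} = {k\<in>{..<N}. lam k = 0}" using N by auto
      then show ?thesis by (simp add: prod.If_cases Int_def)
    qed
    moreover have "(\<Prod>k<N. if lam k = 0 then z else 1) * (\<Prod>k<N. Theta_factor lam z k) = e * (\<Prod>k<N. z - lam k)"
      unfolding e_def prod.distrib[symmetric] by (rule prod.cong) (auto simp: Theta_factor_def field_simps)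
    ultimately show ?thesis by (simp add: Theta_def)
  qed
  obtain z where z: "z \<noteq> 0" "\<And>k. lam k \<noteq> z" by (rule obtain_outside_range[of lam]) (rule that; assumption)
  have nz: "(\<Prod>k<N. z - lam k) * W.f z \<noteq> 0"
  proof -
    have "z \<notin> range a" using z(2) by (force simp: a_def)
    then have "W.f z \<noteq> 0" by (simp only: W.zero not_False_eq_True)
    moreover have "(\<Prod>k<N. z - lam k) \<noteq> 0"
      using z(2) by (simp add: prod_zero_iff) metis
    ultimately show ?thesis by (rule no_zero_divisors[rotated])
  qed
  then show "\<exists>z. Theta lam z \<noteq> 0" using e Theta_eq by auto
  have split: "{k. lam k = w} = {k\<in>{..<N}. lam k = w} \<union> (\<lambda>n. n + N) ` (a -` {w})"
  proof (intro equalityI subsetI)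
    fix k assume k: "k \<in> {k. lam k = w}"
    show "k \<in> {k\<in>{..<N}. lam k = w} \<union> (\<lambda>n. n + N) ` (a -` {w})"
    proof (cases "k < N")
      case False
      then show ?thesis using k by (intro UnI2 image_eqI[of _ _ "k - N"]) (auto simp: a_def)
    qed (use k in simp)
  qed (auto simp: a_def)
  have finW: "finite (a -` {w})" by (rule W.finite_occs_a)
  then show "finite {k. lam k = w}" unfolding split by simp
  have hol: "(\<lambda>z. (\<Prod>k<N. z - lam k) * W.f z) holomorphic_on UNIV"
    by (intro holomorphic_intros W.holomorphic)
  have ev: "\<forall>\<^sub>F z in at w. (\<Prod>k<N. z - lam k) * W.f z \<noteq> 0"
    by (rule entire_eventually_nonzero[OF hol nz])
  have "zorder (Theta lam) w = zorder (\<lambda>z. (\<Prod>k<N. z - lam k) * W.f z) w"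
    unfolding Theta_eq[abs_def] by (rule zorder_cmult) (rule e)
  also have "\<dots> = zorder (\<lambda>z. \<Prod>k<N. z - lam k) w + zorder W.f w"
    by (rule zorder_times_analytic) (use ev in \<open>auto intro!: analytic_intros W.analytic\<close>)
  also have "zorder (\<lambda>z. \<Prod>k<N. z - lam k) w = (\<Sum>k<N. zorder (\<lambda>z. z - lam k) w)"
  proof (rule zorder_prod_analytic)
    show "\<forall>\<^sub>F z in at w. (\<Prod>k<N. z - lam k) \<noteq> 0" using ev by eventually_elim simp
  qed (auto intro!: analytic_intros)
  also have "\<dots> = int (card {k\<in>{..<N}. lam k = w})"
  proof -
    have "(\<Sum>k<N. zorder (\<lambda>z. z - lam k) w) = (\<Sum>k<N. if lam k = w then 1 else 0)"
      by (rule sum.cong) (auto simp: zorder_linear)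
    then show ?thesis by (simp add: sum.If_cases Int_def)
  qed
  also have "zorder W.f w = int (card (a -` {w}))" by (rule W.zorder)
  also have "card (a -` {w}) = card ((\<lambda>n. n + N) ` (a -` {w}))"
    by (rule card_image[symmetric]) (simp add: inj_on_def)
  also have "int (card {k\<in>{..<N}. lam k = w}) + int (card ((\<lambda>n. n + N) ` (a -` {w}))) = int (card {k. lam k = w})"
    unfolding split using finW by (subst card_Un_disjoint) auto
  finally show "zorder (Theta lam) w = int (card {k. lam k = w})" .
qed

section \<open>Sine transforms as entire functions of the square\<close>
text \<open>
  The power series of the sine has odd powers only.
\<close>
lemma entire_sinc_sqrt:
  obtains S :: "complex \<Rightarrow> complex" where "S holomorphic_on UNIV" "\<And>r. r * S (r\<^sup>2) = sin r" "S 0 = 1"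
proof -
  define c :: "nat \<Rightarrow> complex" where "c = (\<lambda>n. of_real (sin_coeff (2 * n + 1)))"
  have s: "(\<lambda>n. r * (c n * (r\<^sup>2) ^ n)) sums sin r" for r
  proof -
    have "(\<lambda>n. sin_coeff (2 * n + 1) *\<^sub>R r ^ (2 * n + 1)) sums sin r"
    proof (subst sums_mono_reindex[where g = "\<lambda>n. 2 * n + 1" and f = "\<lambda>n. sin_coeff n *\<^sub>R r ^ n"])
      show "strict_mono (\<lambda>n::nat. 2 * n + 1)" by (auto simp: strict_mono_def)
      show "sin_coeff n *\<^sub>R r ^ n = 0" if "n \<notin> range (\<lambda>n. 2 * n + 1)" for n
        using that by (auto simp: sin_coeff_def elim!: oddE)
    qed (rule sin_converges)
    moreover have "sin_coeff (2 * n + 1) *\<^sub>R r ^ (2 * n + 1) = r * (c n * (r\<^sup>2) ^ n)" for n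
      unfolding c_def scaleR_conv_of_real power_add power_mult power_one_right by (simp only: mult_ac)
    ultimately show ?thesis by simp
  qed
  have sm: "summable (\<lambda>n. c n * w ^ n)" for w
  proof (cases "w = 0")
    case False
    define r where "r = csqrt w"
    have r: "r\<^sup>2 = w" "r \<noteq> 0" using False by (auto simp: r_def)
    have "summable (\<lambda>n. inverse r * (r * (c n * (r\<^sup>2) ^ n)))"
      by (rule summable_mult) (rule sums_summable[OF s])
    then show ?thesis using r by simp
  qed (simp add: summable_0_powser)
  define S where "S = (\<lambda>w. \<Sum>n. c n * w ^ n)"
  have "S holomorphic_on UNIV"
  proof (rule holomorphic_on_subset)
    have "S field_differentiable at w" for w
    proof -
      have "S holomorphic_on ball 0 (norm w + 1)"
        by (rule power_series_holomorphic[where a = c]) (use sm in \<open>auto simp: S_def summable_sums\<close>)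
      then show ?thesis by (rule holomorphic_on_imp_differentiable_at) auto
    qed
    then show "S holomorphic_on UNIV" by (auto simp: holomorphic_on_def field_differentiable_at_within)
  qed simp
  moreover have "r * S (r\<^sup>2) = sin r" for r
    using sums_unique2[OF sums_mult[OF summable_sums[OF sm[of "r\<^sup>2"]], of r] s[of r]] by (simp add: S_def)
  moreover have "S 0 = 1" unfolding S_def powser_zero by (simp add: c_def sin_coeff_def)
  ultimately show thesis by (rule that)
qed

text \<open>
  Rewriting \<open>sin_quot (csqrt z) x\<close> as \<open>x S(z x\<^sup>2)\<close> with entire \<open>S\<close> removes the branch of the square
  root, and the integral may be differentiated in \<open>z\<close>.
\<close>
lemma sine_transform_entire:
  fixes u :: "real \<Rightarrow> real"
  assumes u: "continuous_on {0..2} u"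
  shows "(\<lambda>z. integral {0..2} (\<lambda>x. complex_of_real (u x) * sin_quot (csqrt z) x)) holomorphic_on UNIV"
proof -
  obtain S :: "complex \<Rightarrow> complex" where S: "S holomorphic_on UNIV" "\<And>r. r * S (r\<^sup>2) = sin r" "S 0 = 1"
    by (rule entire_sinc_sqrt) (rule that; assumption)
  have sq: "sin_quot (csqrt z) x = complex_of_real x * S (z * complex_of_real (x\<^sup>2))" for z x
  proof (cases "z = 0")
    case False
    then have "csqrt z \<noteq> 0" by simp
    then show ?thesis
      using S(2)[of "csqrt z * complex_of_real x"] by (simp add: sin_quot_def power_mult_distrib field_simps)
  qed (simp add: sin_quot_def S(3))
  have dS: "(S has_field_derivative deriv S w) (at w)" for w
    using S(1) by (intro holomorphic_derivI[of S UNIV]) auto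
  have cS: "continuous_on A S" and cdS: "continuous_on A (deriv S)" for A
    using holomorphic_on_imp_continuous_on[OF S(1)]
      holomorphic_on_imp_continuous_on[OF holomorphic_deriv[OF S(1) open_UNIV]]
    by (auto intro: continuous_on_subset)
  have "(\<lambda>z. integral (cbox 0 2) (\<lambda>x. complex_of_real (u x * x) * S (z * complex_of_real (x\<^sup>2)))) holomorphic_on UNIV"
  proof (rule leibniz_rule_holomorphic)
    show "((\<lambda>z. complex_of_real (u t * t) * S (z * complex_of_real (t\<^sup>2))) has_field_derivative
        complex_of_real (u t * t) * (deriv S (z * complex_of_real (t\<^sup>2)) * complex_of_real (t\<^sup>2))) (at z within UNIV)" for z t
      by (intro DERIV_cmult DERIV_chain2[OF dS]) (auto intro!: derivative_eq_intros)
    show "(\<lambda>x. complex_of_real (u x * x) * S (z * complex_of_real (x\<^sup>2))) integrable_on cbox 0 2" for z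
      using u by (intro integrable_continuous continuous_intros continuous_on_compose2[OF cS[of UNIV]]) auto
    have u': "continuous_on (UNIV \<times> cbox 0 2) (\<lambda>p :: complex \<times> real. u (snd p))"
      using u by (intro continuous_on_compose2[of "{0..2}" u _ snd] continuous_intros) auto
    show "continuous_on (UNIV \<times> cbox 0 2) (\<lambda>(z, t). complex_of_real (u t * t) * (deriv S (z * complex_of_real (t\<^sup>2)) * complex_of_real (t\<^sup>2)))"
      unfolding case_prod_unfold
      by (intro continuous_intros u' continuous_on_compose2[OF cdS[of UNIV]]) auto
  qed simp
  then show ?thesis unfolding sq by (simp add: mult.assoc)
qed

lemma norm_sin_le: "norm (sin (z::complex)) \<le> exp (norm z)"
proof -
  have "norm (sin z) = norm (exp (\<i> * z) - exp (- (\<i> * z))) / 2"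
    by (simp add: sin_exp_eq norm_divide norm_mult)
  also have "\<dots> \<le> (norm (exp (\<i> * z)) + norm (exp (- (\<i> * z)))) / 2"
    by (intro divide_right_mono norm_triangle_ineq4) simp
  also have "\<dots> \<le> (exp (norm z) + exp (norm z)) / 2"
    using norm_exp[of "\<i> * z"] norm_exp[of "- (\<i> * z)"] by (intro divide_right_mono add_mono) (auto simp: norm_mult)
  finally show ?thesis by simp
qed

lemma sine_transform_growth:
  fixes u :: "real \<Rightarrow> real"
  assumes u: "continuous_on {0..2} u"
  shows "\<exists>C>0. \<forall>z. 1 \<le> norm z \<longrightarrow>
    norm (integral {0..2} (\<lambda>x. complex_of_real (u x) * sin_quot (csqrt z) x)) \<le> C * exp (2 * sqrt (norm z))"
proof -
  have "bounded (u ` {0..2})" using u by (intro compact_imp_bounded compact_continuous_image) auto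
  then obtain B where B: "B > 0" "\<And>x. x \<in> {0..2} \<Longrightarrow> \<bar>u x\<bar> \<le> B"
    by (auto simp: bounded_pos)
  have "norm (integral {0..2} (\<lambda>x. complex_of_real (u x) * sin_quot (csqrt z) x)) \<le> (2 * B) * exp (2 * sqrt (norm z))"
    if z: "1 \<le> norm z" for z
  proof -
    have r: "norm (csqrt z) = sqrt (norm z)" by simp
    have r1: "1 \<le> norm (csqrt z)" using z by simp
    have "norm (integral {0..2} (\<lambda>x. complex_of_real (u x) * sin_quot (csqrt z) x)) \<le> (B * exp (2 * sqrt (norm z))) * (2 - 0)"
    proof (rule integral_bound)
      show "continuous_on {0..2} (\<lambda>x. complex_of_real (u x) * sin_quot (csqrt z) x)"
        by (intro continuous_intros u continuous_on_sin_quot)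
      fix x :: real assume x: "x \<in> {0..2}"
      have "csqrt z \<noteq> 0" using r1 by auto
      then have "norm (sin_quot (csqrt z) x) = norm (sin (csqrt z * complex_of_real x)) / norm (csqrt z)"
        by (simp add: sin_quot_def norm_divide)
      also have "\<dots> \<le> norm (sin (csqrt z * complex_of_real x)) / 1"
        using r1 by (intro divide_left_mono) auto
      also have "\<dots> \<le> exp (norm (csqrt z) * \<bar>x\<bar>)"
        using norm_sin_le[of "csqrt z * complex_of_real x"] by (simp add: norm_mult)
      also have "\<dots> \<le> exp (norm (csqrt z) * 2)"
        using x by (intro exp_le_cancel_iff[THEN iffD2] mult_left_mono) auto
      finally have "norm (sin_quot (csqrt z) x) \<le> exp (2 * sqrt (norm z))" by (simp add: r mult.commute)
      then show "norm (complex_of_real (u x) * sin_quot (csqrt z) x) \<le> B * exp (2 * sqrt (norm z))"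
        using B(2)[OF x] B(1) unfolding norm_mult norm_of_real by (intro mult_mono) auto
    qed simp
    then show ?thesis by simp
  qed
  with B(1) show ?thesis by (intro exI[of _ "2 * B"]) auto
qed

lemma sine_transform_real:
  "integral {0..2} (\<lambda>x. complex_of_real (u x) * sin_quot (complex_of_real r) x) \<in> \<real>"
proof -
  have "cnj (sin_quot (complex_of_real r) x) = sin_quot (complex_of_real r) x" for x
    by (simp add: sin_quot_def cnj_sin)
  then have "cnj (integral {0..2} (\<lambda>x. complex_of_real (u x) * sin_quot (complex_of_real r) x)) =
      integral {0..2} (\<lambda>x. complex_of_real (u x) * sin_quot (complex_of_real r) x)"
    by (simp add: Henstock_Kurzweil_Integration.integral_cnj)
  then show ?thesis by (simp add: Reals_cnj_iff)
qed

section \<open>Characterization of the spectra\<close>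
lemma W12_on_cmult:
  assumes "W12_on a b u"
  shows "W12_on a b (\<lambda>x. c * u x)"
proof -
  from assms obtain v where u: "abs_cont_on a b u" and v: "L2_on a b v"
    and d: "AE x in lebesgue. x \<in> {a<..<b} \<longrightarrow> (u has_real_derivative v x) (at x)"
    unfolding W12_on_def by blast
  have "abs_cont_on a b (\<lambda>x. c * u x)"
    by (rule abs_cont_on_mult[OF _ u]) (rule abs_cont_on_lipschitz[where L = 0], simp)
  moreover have "L2_on a b (\<lambda>x. c * v x)"
    unfolding L2_on_def
  proof
    show "set_borel_measurable lebesgue {a<..<b} (\<lambda>x. c * v x)"
    proof -
      have "(\<lambda>x. indicat_real {a<..<b} x *\<^sub>R v x) \<in> borel_measurable lebesgue"
        using v by (simp only: L2_on_def set_borel_measurable_def)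
      then have "(\<lambda>x. c * (indicat_real {a<..<b} x *\<^sub>R v x)) \<in> borel_measurable lebesgue"
        by (intro borel_measurable_times borel_measurable_const)
      then show ?thesis unfolding set_borel_measurable_def by (simp only: mult_scaleR_right)
    qed
    show "set_integrable lebesgue {a<..<b} (\<lambda>x. (c * v x)\<^sup>2)"
      using v by (simp add: L2_on_def power_mult_distrib)
  qed
  moreover have "AE x in lebesgue. x \<in> {a<..<b} \<longrightarrow> ((\<lambda>x. c * u x) has_real_derivative c * v x) (at x)"
    using d by eventually_elim (auto intro: DERIV_cmult)
  ultimately show ?thesis unfolding W12_on_def by blast
qed

lemma W12_on_continuous: "W12_on a b u \<Longrightarrow> continuous_on {a..b} u"
  unfolding W12_on_def using abs_cont_on_imp_continuous_on by blast

context entire_with_zeros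
begin

text \<open>
  The leading coefficient is the limit of \<open>D z / z ^ s\<close> along positive real \<open>z\<close>.
\<close>
lemma leading_coeff_real:
  assumes "\<And>r. D ((complex_of_real r)\<^sup>2) \<in> \<real>"
  shows "leading_coeff \<in> \<real>"
proof -
  (* Squares, because realness is known in terms of the square root. *)
  define X where "X = (\<lambda>n. (complex_of_real (inverse (real (Suc n))))\<^sup>2)"
  have "X \<longlonglongrightarrow> (complex_of_real 0)\<^sup>2"
    unfolding X_def by (intro tendsto_power tendsto_of_real LIMSEQ_inverse_real_of_nat)
  then have "filterlim X (at 0) sequentially"
    unfolding filterlim_at by (simp add: X_def del: of_nat_Suc)
  from filterlim_compose[OF D_div_tendsto this]
  have "(\<lambda>n. D (X n) / X n ^ s) \<longlonglongrightarrow> leading_coeff" by (simp add: zero_free_part_0)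
  moreover have "D (X n) / X n ^ s \<in> \<real>" for n
    unfolding X_def by (intro Reals_divide Reals_power assms Reals_of_real)
  ultimately show ?thesis
    using closed_complex_Reals by (rule_tac Lim_in_closed_set[of \<real> "\<lambda>n. D (X n) / X n ^ s" sequentially]) auto
qed

end

theorem theoremB1:
  fixes lam :: "nat \<Rightarrow> complex"
  shows "(\<exists>q :: real \<Rightarrow> real. L2_on 0 1 q \<and> is_spectrum q lam) \<longleftrightarrow>
    finite {k. lam k = 0} \<and>
    (\<forall>z. Theta_convergent lam z) \<and>
    (\<exists>u :: real \<Rightarrow> real. W12_on 0 2 u \<and> u 2 = 0 \<and>
       (\<forall>r. Theta lam (r\<^sup>2) =
          integral {0..2} (\<lambda>x. complex_of_real (u x) * sin_quot r x)))"
proof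
  assume "\<exists>q :: real \<Rightarrow> real. L2_on 0 1 q \<and> is_spectrum q lam"
  then obtain q where q: "L2_on 0 1 q" and nz: "\<exists>z. char_fun q z \<noteq> 0"
    and fin: "\<And>z. finite {k. lam k = z}" and mult: "\<And>z. int (card {k. lam k = z}) = zorder (char_fun q) z"
    unfolding is_spectrum_def by blast
  obtain u where u: "W12_on 0 2 u" "u 2 = 0"
    and rep: "\<And>r. char_fun q (r\<^sup>2) = integral {0..2} (\<lambda>x. complex_of_real (u x) * sin_quot r x)"
    using char_fun_sine_transform[OF q] by blast
  have cont: "continuous_on {0..2} u" by (rule W12_on_continuous[OF u(1)])
  have D_eq: "char_fun q = (\<lambda>z. integral {0..2} (\<lambda>x. complex_of_real (u x) * sin_quot (csqrt z) x))"
    by (rule ext) (subst rep[symmetric], simp)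
  obtain C where C: "C > 0" "\<And>z. 1 \<le> norm z \<Longrightarrow> norm (char_fun q z) \<le> C * exp (2 * sqrt (norm z))"
    using sine_transform_growth[OF cont] unfolding D_eq by blast
  (* The type 2 is the length of the interval of integration. *)
  interpret entire_with_zeros "char_fun q" lam C 2
  proof
    show "char_fun q holomorphic_on UNIV" unfolding D_eq by (rule sine_transform_entire[OF cont])
  qed (use nz fin mult C in auto)
  have "char_fun q ((complex_of_real t)\<^sup>2) \<in> \<real>" for t
    unfolding rep by (rule sine_transform_real)
  then have "leading_coeff \<in> \<real>" by (rule leading_coeff_real)
  then obtain d where d: "leading_coeff = complex_of_real d" by (auto elim: Reals_cases)
  have d_nz: "d \<noteq> 0" using leading_coeff_nz d by auto
  have "Theta lam (r\<^sup>2) = integral {0..2} (\<lambda>x. complex_of_real (1 / d * u x) * sin_quot r x)" for r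
  proof -
    have "integral {0..2} (\<lambda>x. complex_of_real (1 / d * u x) * sin_quot r x) =
        integral {0..2} (\<lambda>x. complex_of_real (1 / d) * (complex_of_real (u x) * sin_quot r x))"
      by (simp only: of_real_mult mult.assoc)
    also have "\<dots> = complex_of_real (1 / d) * char_fun q (r\<^sup>2)"
      by (simp only: integral_mult_right rep)
    also have "\<dots> = Theta lam (r\<^sup>2)"
      using d_nz hadamard_product[of "r\<^sup>2"] by (simp add: d)
    finally show ?thesis ..
  qed
  moreover have "W12_on 0 2 (\<lambda>x. 1 / d * u x)" by (rule W12_on_cmult[OF u(1)])
  moreover have "1 / d * u 2 = 0" using u(2) by simp
  ultimately have "\<exists>u. W12_on 0 2 u \<and> u 2 = 0 \<and>
      (\<forall>r. Theta lam (r\<^sup>2) = integral {0..2} (\<lambda>x. complex_of_real (u x) * sin_quot r x))"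
    by blast
  then show "finite {k. lam k = 0} \<and> (\<forall>z. Theta_convergent lam z) \<and>
    (\<exists>u :: real \<Rightarrow> real. W12_on 0 2 u \<and> u 2 = 0 \<and>
       (\<forall>r. Theta lam (r\<^sup>2) = integral {0..2} (\<lambda>x. complex_of_real (u x) * sin_quot r x)))"
    using fin summable_inverse_imp_Theta_convergent[OF summable_inverse_zeros] by blast
next
  assume "finite {k. lam k = 0} \<and> (\<forall>z. Theta_convergent lam z) \<and>
    (\<exists>u :: real \<Rightarrow> real. W12_on 0 2 u \<and> u 2 = 0 \<and>
       (\<forall>r. Theta lam (r\<^sup>2) = integral {0..2} (\<lambda>x. complex_of_real (u x) * sin_quot r x)))"
  then obtain u where fin0: "finite {k. lam k = 0}" and conv: "\<And>z. Theta_convergent lam z"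
    and u: "W12_on 0 2 u" "u 2 = 0"
    and rep: "\<And>r. Theta lam (r\<^sup>2) = integral {0..2} (\<lambda>x. complex_of_real (u x) * sin_quot r x)"
    by blast
  note zeros = Theta_zeros[OF fin0 Theta_convergent_imp_summable_inverse[OF conv]]
  obtain c q where c: "c > 0" and q: "L2_on 0 1 q"
    and real: "\<And>r. char_fun q (r\<^sup>2) = complex_of_real c * integral {0..2} (\<lambda>x. complex_of_real (u x) * sin_quot r x)"
    using sine_transform_realizable[OF u] by blast
  have eq: "char_fun q = (\<lambda>z. complex_of_real c * Theta lam z)"
  proof
    show "char_fun q z = complex_of_real c * Theta lam z" for z
      using real[of "csqrt z"] rep[of "csqrt z"] by simp
  qed
  have "zorder (char_fun q) z = zorder (Theta lam) z" for z
    unfolding eq by (rule zorder_cmult) (use c in simp)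
  then have "is_spectrum q lam"
    unfolding is_spectrum_def using zeros c by (auto simp: eq)
  with q show "\<exists>q :: real \<Rightarrow> real. L2_on 0 1 q \<and> is_spectrum q lam" by blast
qed

end
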